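(* Let $X_{\mathbb C}$ be a complexification of a real Banach space $X_{\mathbb R}$, let $\mathcal C_{\mathbb R}\subset X_{\mathbb R}$ be an $\mathbb R$-cone with dual cone $\mathcal C_{\mathbb R}'$, and let $\mathcal C_{\mathbb C}\subset X_{\mathbb C}$ be its canonical complexification. Let $P\in L(X_{\mathbb R})$ satisfy $P(\mathcal C_{\mathbb R}^* )\subset \mathcal C_{\mathbb R}^*$ and $\Delta_P=\operatorname{diam}_{\mathcal C_{\mathbb R}}P(\mathcal C_{\mathbb R}^* )<+\infty$. Suppose that $M\in L(X_{\mathbb C})$ is dominated by $P$ with constants $0\le\gamma<\alpha\le\beta<+\infty$ that satisfy $$\gamma\,\cosh\frac{\Delta_P}{2}<\alpha .$$ Then $M(\mathcal C_{\mathbb C}^* )\subset\mathcal C_{\mathbb C}^*$ and $\operatorname{diam}_{\mathcal C_{\mathbb C}}M(\mathcal C_{\mathbb C}^* )<+\infty$. If, in addition, $\mathcal C_{\mathbb R}$ is $M^{n_0}$-inner regular for some integer $n_0\ge0$ and is of uniformly bounded sectional aperture, then $M$ has a spectral gap.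
   Context: For a subset $S$ of a vector space, $S^*=S\setminus\{0\}$. $L(X)$ denotes the bounded linear operators on $X$. Complexification: a complexification $X_{\mathbb C}$ of a real Banach space $X_{\mathbb R}$ is a complex Banach space with a bounded antilinear involution $J$ ($J^2=1$) such that $X_{\mathbb R}=\frac12(1+J)X_{\mathbb C}$; then $X_{\mathbb C}=X_{\mathbb R}\oplus iX_{\mathbb R}$. Real functionals $\ell\in X_{\mathbb R}'$ are extended complex linearly to $X_{\mathbb C}$. For $M\in L(X_{\mathbb C})$, $\overline M=JMJ$, so that $\langle \ell,\overline Mx\rangle=\overline{\langle\ell,Mx\rangle}$ for $x\in X_{\mathbb R}$, $\ell\in X_{\mathbb R}'$. $\mathbb R$-cone: a closed convex subset $\mathcal C_{\mathbb R}\subset X_{\mathbb R}$, not reduced to a point, with $\mathbb R_+\mathcal C_{\mathbb R}=\mathcal C_{\mathbb R}$ and $\mathcal C_{\mathbb R}\cap-\mathcal C_{\mathbb R}=\{0\}$. Dual cone: $\mathcal C_{\mathbb R}'=\{m\in X_{\mathbb R}':\langle m,x\rangle\ge0\ \forall x\in\mathcal C_{\mathbb R}\}$. Hilbert (projective) metric: $d_{\mathcal C_{\mathbb R}}(x,y)=\log(\beta(x,y)\beta(y,x))\in[0,+\infty]$ with $\beta(x,y)=\inf\{\lambda>0:\lambda x-y\in\mathcal C_{\mathbb R}\}$, $x,y\in\mathcal C_{\mathbb R}^*$; $\operatorname{diam}_{\mathcal C_{\mathbb R}}(A)=\sup_{x,y\in A}d_{\mathcal C_{\mathbb R}}(x,y)$.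 Canonical complexification: $\mathcal C_{\mathbb C}=\{u\in X_{\mathbb C}:\operatorname{Re}\langle m,u\rangle\overline{\langle\ell,u\rangle}\ge0\ \ \forall m,\ell\in\mathcal C_{\mathbb R}'\}$. Gauge on a complex cone $\mathcal C$: for $x,y\in\mathcal C^*$ put $D(x,y)=\{\lambda\in\widehat{\mathbb C}:(1+\lambda)x+(1-\lambda)y\in\mathcal C\}$, with $\infty\in D(x,y)$ iff $x-y\in\mathcal C$, and let $D^o(x,y)$ be its interior in the Riemann sphere $\widehat{\mathbb C}$. If $x,y$ are co-linear, $d_{\mathcal C}(x,y)=0$. If they are independent and $-1,1$ lie in the same connected component $U$ of $D^o(x,y)$, then $d_{\mathcal C}(x,y)=d_U(-1,1)$, the hyperbolic distance in $U$ (normalized by $ds=2|dz|/(1-|z|^2)$ on the unit disk). Otherwise $d_{\mathcal C}(x,y)=+\infty$. $\operatorname{diam}_{\mathcal C}(A)=\sup_{x,y\in A}d_{\mathcal C}(x,y)$. Domination: $M$ is dominated by $P$ with constants $0\le\gamma<\alpha\le\beta<+\infty$ if for all $\ell,\ell_1,\ell_2\in\mathcal C_{\mathbb R}'$ and $x,x_1,x_2\in\mathcal C_{\mathbb R}$: (a) $\operatorname{Re}\langle\ell_1,Mx\rangle\langle\ell_2,\overline Mx\rangle\ge\alpha\langle\ell_1,Px\rangle\langle\ell_2,Px\rangle$; (b) $\operatorname{Re}\langle\ell,Mx\rangle\langle\ell,\overline Mx\rangle\le\beta\langle\ell,Px\rangle\langle\ell,Px\rangle$; (c) $|\operatorname{Im}\langle\ell_1,Mx_1\rangle\langle\ell_2,\overline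 Mx_2\rangle|\le\gamma\langle\ell_1,Px_1\rangle\langle\ell_2,Px_2\rangle$. $\mathcal C_{\mathbb R}$ is $M^{n_0}$-inner regular if there are $x_0\in\mathcal C_{\mathbb R}$ and $C<\infty$ with $|\langle\ell,M^{n_0}u\rangle|\le C\langle\ell,x_0\rangle\|u\|$ for all $u\in X_{\mathbb C}$, $\ell\in\mathcal C_{\mathbb R}'$. $\mathcal C_{\mathbb R}$ is of uniformly bounded sectional aperture if there is $K<\infty$ such that for every $x,y\in X_{\mathbb R}$ there is a non-zero linear functional $m$ on $\operatorname{Span}_{\mathbb R}\{x,y\}$ with $|\langle m,u\rangle|\ge\frac1K\|u\|\,\|m\|$ for all $u\in\operatorname{Span}_{\mathbb R}\{x,y\}\cap\mathcal C_{\mathbb R}$. Spectral gap: a bounded operator has a spectral gap if it has a simple isolated eigenvalue whose modulus equals the spectral radius $r_{\rm sp}$ and the rest of the spectrum lies in a disk centered at $0$ of radius strictly smaller than $r_{\rm sp}$. *)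

theory Defs
  imports "HOL-Complex_Analysis.Complex_Analysis"
begin

section \<open>Complex Banach spaces and complexifications\<close>

class complex_banach = banach +
  fixes scaleC :: "complex \<Rightarrow> 'a \<Rightarrow> 'a"  (infixr \<open>*\<^sub>C\<close> 75)
  assumes scaleC_add_right: "c *\<^sub>C (x + y) = c *\<^sub>C x + c *\<^sub>C y"
    and scaleC_add_left: "(c + d) *\<^sub>C x = c *\<^sub>C x + d *\<^sub>C x"
    and scaleC_scaleC: "c *\<^sub>C d *\<^sub>C x = (c * d) *\<^sub>C x"
    and scaleC_of_real: "complex_of_real r *\<^sub>C x = r *\<^sub>R x"
    and norm_scaleC: "norm (c *\<^sub>C x) = cmod c * norm x"

definition bounded_clinear :: "('c::complex_banach \<Rightarrow> 'c) \<Rightarrow> bool" where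
  "bounded_clinear T \<longleftrightarrow> bounded_linear T \<and> (\<forall>c u. T (c *\<^sub>C u) = c *\<^sub>C T u)"

text \<open>The real space is kept as a type of its own; \<open>\<iota>\<close> identifies it, with its norm, with the
  real part \<open>\<onehalf>(1 + J)X\<^sub>\<complex>\<close> of the complex space.\<close>

definition complexification ::
    "('r::banach \<Rightarrow> 'c::complex_banach) \<Rightarrow> ('c \<Rightarrow> 'c) \<Rightarrow> bool" where
  "complexification \<iota> J \<longleftrightarrow>
     bounded_linear J \<and> (\<forall>c u. J (c *\<^sub>C u) = cnj c *\<^sub>C J u) \<and> (\<forall>u. J (J u) = u) \<and>
     linear \<iota> \<and> (\<forall>x. norm (\<iota> x) = norm x) \<and>
     range \<iota> = range (\<lambda>u. (1/2) *\<^sub>R (u + J u))"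

text \<open>The components of \<open>u = \<iota> (re_part u) + \<i> *\<^sub>C \<iota> (im_part u)\<close>.\<close>

definition re_part ::
    "('r::banach \<Rightarrow> 'c::complex_banach) \<Rightarrow> ('c \<Rightarrow> 'c) \<Rightarrow> 'c \<Rightarrow> 'r" where
  "re_part \<iota> J u = inv \<iota> ((1/2) *\<^sub>R (u + J u))"

definition im_part ::
    "('r::banach \<Rightarrow> 'c::complex_banach) \<Rightarrow> ('c \<Rightarrow> 'c) \<Rightarrow> 'c \<Rightarrow> 'r" where
  "im_part \<iota> J u = inv \<iota> ((1 / (2 * \<i>)) *\<^sub>C (u - J u))"

definition cpair ::
    "('r::banach \<Rightarrow> 'c::complex_banach) \<Rightarrow> ('c \<Rightarrow> 'c) \<Rightarrow> ('r \<Rightarrow>\<^sub>L real) \<Rightarrow> 'c \<Rightarrow> complex" where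
  "cpair \<iota> J l u = Complex (l (re_part \<iota> J u)) (l (im_part \<iota> J u))"

definition conj_op :: "('c \<Rightarrow> 'c) \<Rightarrow> ('c \<Rightarrow> 'c) \<Rightarrow> 'c \<Rightarrow> 'c" where
  "conj_op J M = J \<circ> M \<circ> J"


section \<open>Real cones and the Hilbert metric\<close>

definition real_cone :: "'r::banach set \<Rightarrow> bool" where
  "real_cone C \<longleftrightarrow> closed C \<and> convex C \<and> \<not> (\<exists>x. C = {x}) \<and> cone C \<and> C \<inter> uminus ` C = {0}"

definition dual_cone :: "'r::banach set \<Rightarrow> ('r \<Rightarrow>\<^sub>L real) set" where
  "dual_cone C = {m. \<forall>x\<in>C. 0 \<le> blinfun_apply m x}"

definition hilbert_beta :: "'r::banach set \<Rightarrow> 'r \<Rightarrow> 'r \<Rightarrow> ereal" where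
  "hilbert_beta C x y = Inf (ereal ` {t. 0 < t \<and> t *\<^sub>R x - y \<in> C})"

definition log_ereal :: "ereal \<Rightarrow> ereal" where
  "log_ereal b =
     (if b = \<infinity> then \<infinity> else if 0 < b then ereal (ln (real_of_ereal b)) else -\<infinity>)"

definition hilbert_dist :: "'r::banach set \<Rightarrow> 'r \<Rightarrow> 'r \<Rightarrow> ereal" where
  "hilbert_dist C x y = log_ereal (hilbert_beta C x y * hilbert_beta C y x)"

definition hilbert_diam :: "'r::banach set \<Rightarrow> 'r set \<Rightarrow> ereal" where
  "hilbert_diam C A = (SUP x\<in>A. SUP y\<in>A. hilbert_dist C x y)"


section \<open>The Riemann sphere and the hyperbolic distance of its subdomains\<close>

datatype sphere = Fin complex | Infty

instantiation sphere :: topological_space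
begin

text \<open>The one-point compactification of the plane.\<close>

definition open_sphere :: "sphere set \<Rightarrow> bool" where
  "open_sphere S \<longleftrightarrow> open {z. Fin z \<in> S} \<and> (Infty \<in> S \<longrightarrow> compact {z. Fin z \<notin> S})"

instance
proof
  show "open (UNIV :: sphere set)"
    by (simp add: open_sphere_def)
next
  fix S T :: "sphere set"
  assume ST: "open S" "open T"
  have "{z. Fin z \<in> S \<inter> T} = {z. Fin z \<in> S} \<inter> {z. Fin z \<in> T}"
       "{z. Fin z \<notin> S \<inter> T} = {z. Fin z \<notin> S} \<union> {z. Fin z \<notin> T}" by auto
  then show "open (S \<inter> T)"
    using ST by (auto simp: open_sphere_def)
next
  fix K :: "sphere set set"
  assume K: "\<forall>S\<in>K. open S"
  have "{z. Fin z \<in> \<Union>K} = (\<Union>S\<in>K. {z. Fin z \<in> S})" by auto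
  then have o: "open {z. Fin z \<in> \<Union>K}"
    using K by (auto simp: open_sphere_def)
  have "compact {z. Fin z \<notin> \<Union>K}" if "S \<in> K" "Infty \<in> S" for S
  proof -
    have "compact {z. Fin z \<notin> S}"
      using K that by (auto simp: open_sphere_def)
    moreover have "{z. Fin z \<notin> \<Union>K} = {z. Fin z \<notin> S} \<inter> - {z. Fin z \<in> \<Union>K}"
      using that by auto
    ultimately show ?thesis
      using o by (metis closed_Compl compact_Int_closed)
  qed
  then show "open (\<Union>K)"
    using o by (auto simp: open_sphere_def)
qed

end

fun sphere_inverse :: "sphere \<Rightarrow> sphere" where
  "sphere_inverse Infty = Fin 0"
| "sphere_inverse (Fin z) = (if z = 0 then Infty else Fin (1 / z))"

text \<open>Holomorphic maps into the sphere: near every point, \<open>f\<close> or \<open>1 / f\<close> is a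
  holomorphic function with finite values.\<close>

definition sphere_holomorphic_on :: "(complex \<Rightarrow> sphere) \<Rightarrow> complex set \<Rightarrow> bool" where
  "sphere_holomorphic_on f S \<longleftrightarrow>
     (\<forall>z\<in>S. \<exists>r>0. \<exists>g. g holomorphic_on ball z r \<and>
        ((\<forall>w\<in>ball z r. f w = Fin (g w)) \<or> (\<forall>w\<in>ball z r. f w = sphere_inverse (Fin (g w)))))"

text \<open>The distance on the unit disk of the length element \<open>ds = 2|dz|/(1 - |z|\<^sup>2)\<close>.\<close>

definition disk_dist :: "complex \<Rightarrow> complex \<Rightarrow> real" where
  "disk_dist p q = 2 * artanh (cmod ((p - q) / (1 - cnj p * q)))"

text \<open>The hyperbolic metric of a domain \<open>U\<close> in the sphere is the image of that of the unit disk
  under a holomorphic universal covering \<open>\<phi>\<close>, so that the distance of two points of \<open>U\<close> is the least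
  distance between points above them.  Coverings of \<open>U\<close> by the disk differ only by automorphisms of
  the disk, so the infimum over \<open>\<phi>\<close> does not change the value; by uniformization it is over a
  non-empty set exactly when the complement of \<open>U\<close> has at least three points.\<close>

definition hyperbolic_dist :: "sphere set \<Rightarrow> sphere \<Rightarrow> sphere \<Rightarrow> ereal" where
  "hyperbolic_dist U a b =
     Inf {ereal (disk_dist p q) | \<phi> p q.
            sphere_holomorphic_on \<phi> (ball 0 1) \<and> covering_space (ball 0 1) \<phi> U \<and>
            p \<in> ball 0 1 \<and> q \<in> ball 0 1 \<and> \<phi> p = a \<and> \<phi> q = b}"


section \<open>Complex cones and their gauge\<close>

definition canonical_complexification ::
    "('r::banach \<Rightarrow> 'c::complex_banach) \<Rightarrow> ('c \<Rightarrow> 'c) \<Rightarrow> 'r set \<Rightarrow> 'c set" where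
  "canonical_complexification \<iota> J C =
     {u. \<forall>m\<in>dual_cone C. \<forall>l\<in>dual_cone C. 0 \<le> Re (cpair \<iota> J m u * cnj (cpair \<iota> J l u))}"

definition gauge_set :: "'c::complex_banach set \<Rightarrow> 'c \<Rightarrow> 'c \<Rightarrow> sphere set" where
  "gauge_set C x y =
     {Fin l | l. (1 + l) *\<^sub>C x + (1 - l) *\<^sub>C y \<in> C} \<union> (if x - y \<in> C then {Infty} else {})"

definition complex_collinear :: "'c::complex_banach \<Rightarrow> 'c \<Rightarrow> bool" where
  "complex_collinear x y \<longleftrightarrow> (\<exists>a b. (a, b) \<noteq> (0, 0) \<and> a *\<^sub>C x + b *\<^sub>C y = 0)"

definition gauge_dist :: "'c::complex_banach set \<Rightarrow> 'c \<Rightarrow> 'c \<Rightarrow> ereal" where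
  "gauge_dist C x y =
     (if complex_collinear x y then 0
      else let U = connected_component_set (interior (gauge_set C x y)) (Fin (-1))
           in if Fin 1 \<in> U then hyperbolic_dist U (Fin (-1)) (Fin 1) else \<infinity>)"

definition gauge_diam :: "'c::complex_banach set \<Rightarrow> 'c set \<Rightarrow> ereal" where
  "gauge_diam C A = (SUP x\<in>A. SUP y\<in>A. gauge_dist C x y)"


section \<open>Domination and regularity of the cone\<close>

definition dominated ::
    "('r::banach \<Rightarrow> 'c::complex_banach) \<Rightarrow> ('c \<Rightarrow> 'c) \<Rightarrow> 'r set \<Rightarrow>
     ('c \<Rightarrow> 'c) \<Rightarrow> ('r \<Rightarrow> 'r) \<Rightarrow> real \<Rightarrow> real \<Rightarrow> real \<Rightarrow> bool" where
  "dominated \<iota> J C M P \<gamma> \<alpha> \<beta> \<longleftrightarrow>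
     0 \<le> \<gamma> \<and> \<gamma> < \<alpha> \<and> \<alpha> \<le> \<beta> \<and>
     (\<forall>l1\<in>dual_cone C. \<forall>l2\<in>dual_cone C. \<forall>x\<in>C.
        Re (cpair \<iota> J l1 (M (\<iota> x)) * cpair \<iota> J l2 (conj_op J M (\<iota> x)))
          \<ge> \<alpha> * blinfun_apply l1 (P x) * blinfun_apply l2 (P x)) \<and>
     (\<forall>l\<in>dual_cone C. \<forall>x\<in>C.
        Re (cpair \<iota> J l (M (\<iota> x)) * cpair \<iota> J l (conj_op J M (\<iota> x)))
          \<le> \<beta> * blinfun_apply l (P x) * blinfun_apply l (P x)) \<and>
     (\<forall>l1\<in>dual_cone C. \<forall>l2\<in>dual_cone C. \<forall>x1\<in>C. \<forall>x2\<in>C.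
        \<bar>Im (cpair \<iota> J l1 (M (\<iota> x1)) * cpair \<iota> J l2 (conj_op J M (\<iota> x2)))\<bar>
          \<le> \<gamma> * blinfun_apply l1 (P x1) * blinfun_apply l2 (P x2))"

definition inner_regular ::
    "('r::banach \<Rightarrow> 'c::complex_banach) \<Rightarrow> ('c \<Rightarrow> 'c) \<Rightarrow> 'r set \<Rightarrow> ('c \<Rightarrow> 'c) \<Rightarrow> bool" where
  "inner_regular \<iota> J C T \<longleftrightarrow>
     (\<exists>x0\<in>C. \<exists>K. \<forall>u. \<forall>l\<in>dual_cone C. cmod (cpair \<iota> J l (T u)) \<le> K * blinfun_apply l x0 * norm u)"

definition norm_on :: "'r::real_normed_vector set \<Rightarrow> ('r \<Rightarrow> real) \<Rightarrow> real" where
  "norm_on S m = (SUP u\<in>S - {0}. \<bar>m u\<bar> / norm u)"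

text \<open>Linear functionals on \<open>span {x, y}\<close> are represented by (arbitrary) linear extensions to the
  whole space, of which only the values on the span matter.  The pair \<open>x = y = 0\<close> is left out:
  its span carries no non-zero functional.\<close>

definition bounded_sectional_aperture :: "'r::banach set \<Rightarrow> bool" where
  "bounded_sectional_aperture C \<longleftrightarrow>
     (\<exists>K>0. \<forall>x y. (x, y) \<noteq> (0, 0) \<longrightarrow>
        (\<exists>m. linear m \<and> (\<exists>u\<in>span {x, y}. m u \<noteq> 0) \<and>
           (\<forall>u\<in>span {x, y} \<inter> C. \<bar>m u\<bar> \<ge> 1 / K * norm u * norm_on (span {x, y}) m)))"


section \<open>Spectral gap\<close>

definition cspectrum :: "('c::complex_banach \<Rightarrow> 'c) \<Rightarrow> complex set" where
  "cspectrum T = {z. \<not> (\<exists>R. bounded_clinear R \<and>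
     (\<forall>u. R (z *\<^sub>C u - T u) = u) \<and> (\<forall>u. z *\<^sub>C R u - T (R u) = u))}"

definition cspectral_radius :: "('c::complex_banach \<Rightarrow> 'c) \<Rightarrow> real" where
  "cspectral_radius T = (SUP z\<in>cspectrum T. cmod z)"

text \<open>An isolated eigenvalue \<open>z\<close> is simple if its spectral projection \<open>Q\<close> has rank one.  Here \<open>Q\<close> is
  the bounded projection commuting with \<open>T\<close> for which the spectrum of \<open>T\<close> is \<open>{z}\<close> on the range of
  \<open>Q\<close> (spanned by an eigenvector \<open>h\<close>) and avoids \<open>z\<close> on the kernel, a closed subspace, where a
  bijective \<open>z - T\<close> has a bounded inverse.\<close>

definition simple_isolated_eigenvalue :: "('c::complex_banach \<Rightarrow> 'c) \<Rightarrow> complex \<Rightarrow> bool" where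
  "simple_isolated_eigenvalue T z \<longleftrightarrow>
     z isolated_in cspectrum T \<and>
     (\<exists>h Q. h \<noteq> 0 \<and> T h = z *\<^sub>C h \<and>
        bounded_clinear Q \<and> Q \<circ> Q = Q \<and> Q \<circ> T = T \<circ> Q \<and> range Q = range (\<lambda>c. c *\<^sub>C h) \<and>
        bij_betw (\<lambda>u. z *\<^sub>C u - T u) {u. Q u = 0} {u. Q u = 0})"

definition spectral_gap :: "('c::complex_banach \<Rightarrow> 'c) \<Rightarrow> bool" where
  "spectral_gap T \<longleftrightarrow>
     (\<exists>z. simple_isolated_eigenvalue T z \<and> cmod z = cspectral_radius T \<and>
        (\<exists>\<rho>\<ge>0. \<rho> < cspectral_radius T \<and> cspectrum T - {z} \<subseteq> cball 0 \<rho>))"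

end

theory Submission
  imports Defs
begin

text \<open>Up to a phase, an element of \<open>\<C>\<^sub>\<complex>\<close> is \<open>x + \<i>y\<close> with \<open>x, y \<in> \<C>\<^sub>\<real>\<close>; the domination inequalities
  and \<open>\<gamma> cosh (\<Delta>/2) < \<alpha>\<close> then show that its image under \<open>M\<close> lies inside \<open>\<C>\<^sub>\<complex>\<close> with a margin measured by
  \<open>P(x + y)\<close>.  By convexity the margin persists, with uniform constants, on a complex neighbourhood of
  the segment joining two images, so that the two are joined by a holomorphic disk in \<open>\<C>\<^sub>\<complex>\<close> on which
  they have a bounded hyperbolic distance.

  For the gauge, the section of the cone by a complex line has a connected complement, since the
  zeros of the functionals on a segment of the dual cone avoid it.  Components of its interior are
  therefore simply connected, the Riemann mapping provides the covering, and Schwarz's lemma compares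
  the hyperbolic distance with that in the disk.

  For the spectral gap, the ratio of two functionals of \<open>\<C>\<^sub>\<real>'\<close> along such a disk takes values in the right
  half-plane, so by Schwarz's lemma again the oscillation of \<open>\<langle>m, M\<^sup>n u\<rangle> / \<langle>l, M\<^sup>n u\<rangle>\<close> over
  \<open>u\<close> decays geometrically.  Bounded aperture makes the cone normal and inner regularity supplies an
  order unit for the images, so that \<open>M\<^sup>n\<close>, suitably normalised, is exponentially close in norm to
  operators of rank one, which yields the eigenvector and the spectral projection.\<close>

section \<open>Separation from closed cones\<close>

text \<open>\<open>CC\<close> is in general not convex, so a segment between two image points may
  leave it. Dividing out the phases first repairs this: the vectors x + iy with x, y in
  \<open>C\<close> do form a convex cone, and complex factors of the two endpoints are absorbed by
  the coefficients of the disk. The cosh arises as follows. At u = x + iy the cross terms of the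
  form Re m(Mu) conj l(Mu) are imaginary parts, bounded by \<gamma>(A + B) with A = m(Px) l(Py) and
  B = m(Py) l(Px). The Hilbert diameter keeps A/B between exp(-\<Delta>) and exp(\<Delta>), so A + B
  is at most 2 cosh(\<Delta>/2) sqrt(AB), and 2 sqrt(AB) is at most the sum of the diagonal terms,
  which carry the factor \<alpha>. Functionals of the dual cone may vanish on images; as all images
  under \<open>P\<close> are comparable, such a functional vanishes on all of them, and only the
  others serve as denominators. The rank-one estimate is used twice: along the orbit of a real
  vector it makes the normalised iterates converge to an eigenvector h; along the orbit of h, where
  the normalisation is a power of the eigenvalue, it gives the spectral projection.\<close>

definition sublinear :: "('a::real_vector \<Rightarrow> real) \<Rightarrow> bool" where
  "sublinear q \<longleftrightarrow> (\<forall>x y. q (x + y) \<le> q x + q y) \<and> (\<forall>r x. 0 \<le> r \<longrightarrow> q (r *\<^sub>R x) = r * q x)"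

lemma sublinearI:
  assumes "\<And>x y. q (x + y) \<le> q x + q y" and "\<And>r x. 0 < r \<Longrightarrow> q (r *\<^sub>R x) \<le> r * q x" and "q 0 = 0"
  shows "sublinear q"
proof -
  have "q (r *\<^sub>R x) = r * q x" if "0 < r" for r x
  proof (rule antisym)
    have "q x \<le> inverse r * q (r *\<^sub>R x)"
      using assms(2)[of "inverse r" "r *\<^sub>R x"] that by simp
    then show "r * q x \<le> q (r *\<^sub>R x)"
      using that by (simp add: field_simps)
  qed (use assms(2) that in auto)
  then have "q (r *\<^sub>R x) = r * q x" if "0 \<le> r" for r x
    using that assms(3) by (cases "r = 0") auto
  then show ?thesis
    using assms(1) by (auto simp: sublinear_def)
qed

lemma sublinear_add: "sublinear q \<Longrightarrow> q (x + y) \<le> q x + q y"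
  and sublinear_scaleR: "sublinear q \<Longrightarrow> 0 \<le> r \<Longrightarrow> q (r *\<^sub>R x) = r * q x"
  by (auto simp: sublinear_def)

lemma sublinear_zero: "sublinear q \<Longrightarrow> q 0 = 0"
  using sublinear_scaleR[of q 0 0] by simp

lemma sublinear_lower: "sublinear q \<Longrightarrow> - q (- x) \<le> q x"
  using sublinear_add[of q x "- x"] sublinear_zero[of q] by simp

text \<open>A sublinear minorant of \<open>q\<close> whose value at \<open>- y\<close> is at most
  \<open>- q y\<close> (take t = 1). A minimal \<open>q\<close> coincides with all of its tilts,
  which makes it additive.\<close>

definition sublinear_tilt :: "('a::real_vector \<Rightarrow> real) \<Rightarrow> 'a \<Rightarrow> 'a \<Rightarrow> real" where
  "sublinear_tilt q y x = (INF t\<in>{0..}. q (x + t *\<^sub>R y) - t * q y)"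

lemma sublinear_tilt_lower:
  assumes "sublinear q" "0 \<le> t"
  shows "sublinear_tilt q y x \<le> q (x + t *\<^sub>R y) - t * q y"
  unfolding sublinear_tilt_def
proof (rule cINF_lower)
  show "bdd_below ((\<lambda>t. q (x + t *\<^sub>R y) - t * q y) ` {0..})"
  proof (rule bdd_belowI2)
    fix t :: real assume "t \<in> {0..}"
    then show "- q (- x) \<le> q (x + t *\<^sub>R y) - t * q y"
      using sublinear_add[OF assms(1), of "x + t *\<^sub>R y" "- x"] sublinear_scaleR[OF assms(1), of t y]
      by simp
  qed
qed (use assms in auto)

lemma sublinear_tilt_greatest:
  assumes "\<And>t. 0 \<le> t \<Longrightarrow> c \<le> q (x + t *\<^sub>R y) - t * q y"
  shows "c \<le> sublinear_tilt q y x"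
  unfolding sublinear_tilt_def by (rule cINF_greatest) (use assms in auto)

lemma sublinear_tilt_le: "sublinear q \<Longrightarrow> sublinear_tilt q y x \<le> q x"
  using sublinear_tilt_lower[of q 0 y x] by simp

lemma sublinear_sublinear_tilt:
  assumes q: "sublinear q"
  shows "sublinear (sublinear_tilt q y)"
proof (rule sublinearI)
  fix a b
  have "sublinear_tilt q y (a + b) - (q (b + s *\<^sub>R y) - s * q y) \<le> q (a + t *\<^sub>R y) - t * q y"
    if "0 \<le> s" "0 \<le> t" for s t
    using sublinear_tilt_lower[OF q, of "s + t" y "a + b"] that
      sublinear_add[OF q, of "a + t *\<^sub>R y" "b + s *\<^sub>R y"] by (simp add: algebra_simps)
  then have "sublinear_tilt q y (a + b) - (q (b + s *\<^sub>R y) - s * q y) \<le> sublinear_tilt q y a"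
    if "0 \<le> s" for s
    using that by (intro sublinear_tilt_greatest) auto
  then have "sublinear_tilt q y (a + b) - sublinear_tilt q y a \<le> q (b + s *\<^sub>R y) - s * q y"
    if "0 \<le> s" for s
    using that by fastforce
  then have "sublinear_tilt q y (a + b) - sublinear_tilt q y a \<le> sublinear_tilt q y b"
    by (intro sublinear_tilt_greatest) auto
  then show "sublinear_tilt q y (a + b) \<le> sublinear_tilt q y a + sublinear_tilt q y b"
    by simp
next
  fix r :: real and x assume r: "0 < r"
  have "sublinear_tilt q y (r *\<^sub>R x) / r \<le> q (x + t *\<^sub>R y) - t * q y" if "0 \<le> t" for t
    using sublinear_tilt_lower[OF q, of "r * t" y "r *\<^sub>R x"] that r
      sublinear_scaleR[OF q, of r "x + t *\<^sub>R y"] by (simp add: field_simps)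
  then have "sublinear_tilt q y (r *\<^sub>R x) / r \<le> sublinear_tilt q y x"
    by (intro sublinear_tilt_greatest) auto
  then show "sublinear_tilt q y (r *\<^sub>R x) \<le> r * sublinear_tilt q y x"
    using r by (simp add: field_simps)
next
  show "sublinear_tilt q y 0 = 0"
  proof (rule antisym)
    show "sublinear_tilt q y 0 \<le> 0"
      using sublinear_tilt_le[OF q, of y 0] sublinear_zero[OF q] by simp
    show "0 \<le> sublinear_tilt q y 0"
      by (rule sublinear_tilt_greatest) (simp add: sublinear_scaleR[OF q])
  qed
qed

lemma minimal_sublinear_linear:
  assumes q: "sublinear q" and min: "\<And>q'. sublinear q' \<Longrightarrow> (\<And>x. q' x \<le> q x) \<Longrightarrow> q' = q"
  shows "linear q"
proof -
  have add: "q (x + y) = q x + q y" for x y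
  proof (rule antisym)
    have "sublinear_tilt q y = q"
      using min sublinear_sublinear_tilt sublinear_tilt_le q by metis
    then show "q x + q y \<le> q (x + y)"
      using sublinear_tilt_lower[OF q, of 1 y x] by simp
  qed (rule sublinear_add[OF q])
  have neg: "q (- x) = - q x" for x
    using add[of x "- x"] sublinear_zero[OF q] by simp
  have "q (r *\<^sub>R x) = r * q x" for r x
    using sublinear_scaleR[OF q, of r x] sublinear_scaleR[OF q, of "- r" x] neg[of "r *\<^sub>R x"]
    by (cases "0 \<le> r") auto
  then show ?thesis
    by (intro linearI) (auto simp: add)
qed

lemma sublinear_chain_Inf:
  assumes "\<C> \<noteq> {}" and sub: "\<And>q. q \<in> \<C> \<Longrightarrow> sublinear q \<and> (\<forall>x. q x \<le> p x)"
    and chain: "\<And>q q'. q \<in> \<C> \<Longrightarrow> q' \<in> \<C> \<Longrightarrow> (\<forall>x. q x \<le> q' x) \<or> (\<forall>x. q' x \<le> q x)"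
  shows "sublinear (\<lambda>x. INF q\<in>\<C>. q x)" and "\<And>q x. q \<in> \<C> \<Longrightarrow> (INF q\<in>\<C>. q x) \<le> q x"
proof -
  show lower: "(INF q\<in>\<C>. q x) \<le> q x" if "q \<in> \<C>" for q x
  proof (rule cINF_lower[OF _ that])
    show "bdd_below ((\<lambda>q. q x) ` \<C>)"
    proof (rule bdd_belowI2)
      fix q assume "q \<in> \<C>"
      then show "- p (- x) \<le> q x"
        using sub[of q] sublinear_lower[of q x] by (smt (verit, best))
    qed
  qed
  show "sublinear (\<lambda>x. INF q\<in>\<C>. q x)"
  proof (rule sublinearI)
    fix x y
    \<comment> \<open>In a chain the smaller of \<open>q\<close> and \<open>q'\<close> serves both
      summands; without comparability an infimum of sublinear functionals need not be
      subadditive.\<close>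
    have *: "(INF q\<in>\<C>. q (x + y)) \<le> q x + q' y" if qq': "q \<in> \<C>" "q' \<in> \<C>" for q q'
      using chain[OF qq']
    proof
      assume "\<forall>x. q x \<le> q' x"
      then have "q x + q y \<le> q x + q' y" by simp
      then show ?thesis
        using lower[OF qq'(1), of "x + y"] sublinear_add[of q x y] sub[OF qq'(1)] by linarith
    next
      assume "\<forall>x. q' x \<le> q x"
      then have "q' x + q' y \<le> q x + q' y" by simp
      then show ?thesis
        using lower[OF qq'(2), of "x + y"] sublinear_add[of q' x y] sub[OF qq'(2)] by linarith
    qed
    have "(INF q\<in>\<C>. q (x + y)) - q' y \<le> (INF q\<in>\<C>. q x)" if "q' \<in> \<C>" for q'
      using *[OF _ that] by (intro cINF_greatest[OF assms(1)]) (simp add: algebra_simps)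
    then have "(INF q\<in>\<C>. q (x + y)) - (INF q\<in>\<C>. q x) \<le> (INF q\<in>\<C>. q y)"
      by (intro cINF_greatest[OF assms(1)]) (simp add: algebra_simps)
    then show "(INF q\<in>\<C>. q (x + y)) \<le> (INF q\<in>\<C>. q x) + (INF q\<in>\<C>. q y)"
      by simp
  next
    fix r :: real and x assume r: "0 < r"
    have "(INF q\<in>\<C>. q (r *\<^sub>R x)) / r \<le> (INF q\<in>\<C>. q x)"
    proof (rule cINF_greatest[OF assms(1)])
      fix q assume q: "q \<in> \<C>"
      then have "(INF q\<in>\<C>. q (r *\<^sub>R x)) \<le> r * q x"
        using lower[OF q, of "r *\<^sub>R x"] sublinear_scaleR[of q r x] sub[OF q] r by simp
      then show "(INF q\<in>\<C>. q (r *\<^sub>R x)) / r \<le> q x"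
        using r by (simp add: field_simps)
    qed
    then show "(INF q\<in>\<C>. q (r *\<^sub>R x)) \<le> r * (INF q\<in>\<C>. q x)"
      using r by (simp add: field_simps)
  next
    have "(INF q\<in>\<C>. q 0) = (INF q\<in>\<C>. 0::real)"
      using sub sublinear_zero by (intro INF_cong) auto
    then show "(INF q\<in>\<C>. q 0) = (0::real)"
      using assms(1) by simp
  qed
qed

text \<open>Zorn's lemma for the reversed pointwise order: \<open>R\<close> points downwards, so the
  maximal element it yields is a minimal sublinear functional below \<open>p\<close>, and minimal
  ones are linear.\<close>

lemma ex_linear_le_sublinear:
  fixes p :: "'a::real_vector \<Rightarrow> real"
  assumes p: "sublinear p"
  obtains f where "linear f" "\<And>x. f x \<le> p x"
proof -
  define A where "A = {q. sublinear q \<and> (\<forall>x. q x \<le> p x)}"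
  define R where "R = (\<lambda>a b :: 'a \<Rightarrow> real. \<forall>x. b x \<le> a x)"
  have "\<exists>m\<in>A. \<forall>a\<in>A. R m a \<longrightarrow> a = m"
  proof (rule predicate_Zorn)
    show "partial_order_on A (relation_of R A)"
      by (auto simp: partial_order_on_def preorder_on_def refl_on_def trans_def antisym_def
          relation_of_def R_def intro: order_trans) (meson antisym ext)
  next
    fix \<C> assume "\<C> \<in> Chains (relation_of R A)"
    then have *: "q \<in> A \<and> q' \<in> A \<and> (R q q' \<or> R q' q)" if "q \<in> \<C>" "q' \<in> \<C>" for q q'
      using that unfolding Chains_def relation_of_def by blast
    show "\<exists>u\<in>A. \<forall>a\<in>\<C>. R a u"
    proof (cases "\<C> = {}")
      case True
      then show ?thesis using p by (auto simp: A_def)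
    next
      case False
      have ch: "\<And>q. q \<in> \<C> \<Longrightarrow> sublinear q \<and> (\<forall>x. q x \<le> p x)"
        "\<And>q q'. q \<in> \<C> \<Longrightarrow> q' \<in> \<C> \<Longrightarrow> (\<forall>x. q x \<le> q' x) \<or> (\<forall>x. q' x \<le> q x)"
        using * by (auto simp: A_def R_def)
      have inf: "sublinear (\<lambda>x. INF q\<in>\<C>. q x)" "\<And>q x. q \<in> \<C> \<Longrightarrow> (INF q\<in>\<C>. q x) \<le> q x"
        using sublinear_chain_Inf[OF False, of p] ch by metis+
      obtain q where q: "q \<in> \<C>" using False by blast
      have "(INF q\<in>\<C>. q x) \<le> p x" for x
        by (rule order_trans[OF inf(2)[OF q]]) (use ch(1)[OF q] in blast)
      then have "(\<lambda>x. INF q\<in>\<C>. q x) \<in> A"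
        using inf(1) by (simp add: A_def)
      moreover have "R a (\<lambda>x. INF q\<in>\<C>. q x)" if "a \<in> \<C>" for a
        using inf(2)[OF that] by (simp add: R_def)
      ultimately show ?thesis by blast
    qed
  qed
  then obtain m where m: "m \<in> A" "\<And>a. a \<in> A \<Longrightarrow> R m a \<Longrightarrow> a = m" by blast
  have "linear m"
  proof (rule minimal_sublinear_linear)
    show "sublinear m" using m(1) by (simp add: A_def)
    fix q assume "sublinear q" "\<And>x. q x \<le> m x"
    then show "q = m"
      using m(1) by (intro m(2)) (auto simp: A_def R_def intro: order_trans)
  qed
  then show ?thesis
    using that[of m] m(1) by (auto simp: A_def)
qed

text \<open>A linear minorant of the tilt at \<open>y\<close>, rather than of \<open>p\<close>
  itself, satisfies f(-y) \<le> -p(y), the missing half of the equality at \<open>y\<close>.\<close>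

theorem hahn_banach_sublinear:
  fixes p :: "'a::real_vector \<Rightarrow> real"
  assumes p: "sublinear p"
  obtains f where "linear f" "\<And>x. f x \<le> p x" "f y = p y"
proof -
  obtain f where f: "linear f" "\<And>x. f x \<le> sublinear_tilt p y x"
    using ex_linear_le_sublinear[OF sublinear_sublinear_tilt[OF p]] by metis
  have le: "f x \<le> p x" for x
    using f(2)[of x] sublinear_tilt_le[OF p, of y x] by linarith
  have "f (- y) \<le> - p y"
    using f(2)[of "- y"] sublinear_tilt_lower[OF p, of 1 y "- y"] sublinear_zero[OF p] by simp
  then have "f y = p y"
    using le[of y] linear_neg[OF f(1), of y] by simp
  then show ?thesis using that f(1) le by blast
qed

section \<open>The distance to a cone as a sublinear functional\<close>

lemma sublinear_infdist_cone:
  fixes C :: "'a::real_normed_vector set"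
  assumes "convex C" "cone C" "C \<noteq> {}"
  shows "sublinear (\<lambda>x. infdist x C)"
proof -
  have C0: "0 \<in> C" using assms cone_contains_0 by blast
  have add: "a + b \<in> C" if "a \<in> C" "b \<in> C" for a b
    using assms(1,2) that convex_cone by blast
  have le: "infdist x C \<le> norm (x - c)" if "c \<in> C" for x c
    using infdist_le[OF that, of x] by (simp add: dist_norm)
  have ex: "\<exists>c\<in>C. norm (x - c) < infdist x C + e" if "0 < e" for e x
  proof -
    have "(INF a\<in>C. dist x a) < infdist x C + e"
      using that assms(3) by (simp add: infdist_def)
    then show ?thesis
      using assms(3) by (subst (asm) cINF_less_iff) (auto simp: dist_norm intro!: bdd_belowI2[of _ 0])
  qed
  show ?thesis
  proof (rule sublinearI)
    fix x y :: 'a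
    show "infdist (x + y) C \<le> infdist x C + infdist y C"
    proof (rule field_le_epsilon)
      fix e :: real assume "0 < e"
      then obtain c d where "c \<in> C" "norm (x - c) < infdist x C + e/2"
        "d \<in> C" "norm (y - d) < infdist y C + e/2"
        using ex[of "e/2"] by (meson half_gt_zero)
      moreover have "norm ((x + y) - (c + d)) \<le> norm (x - c) + norm (y - d)"
        by (metis add_diff_add norm_triangle_ineq)
      ultimately show "infdist (x + y) C \<le> infdist x C + infdist y C + e"
        using le[OF add, of c d "x + y"] by linarith
    qed
  next
    fix r :: real and x :: 'a assume r: "0 < r"
    show "infdist (r *\<^sub>R x) C \<le> r * infdist x C"
    proof (rule field_le_epsilon)
      fix e :: real assume e: "0 < e"
      then obtain c where c: "c \<in> C" "norm (x - c) < infdist x C + e/r"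
        using ex[of "e/r" x] r by auto
      have "r *\<^sub>R c \<in> C" using assms(2) c(1) r by (simp add: cone_def)
      moreover have "norm (r *\<^sub>R x - r *\<^sub>R c) = r * norm (x - c)"
        using r by (metis abs_of_pos norm_scaleR scaleR_diff_right)
      moreover have "r * norm (x - c) \<le> r * infdist x C + e"
        using c(2) r by (simp add: field_simps)
      ultimately show "infdist (r *\<^sub>R x) C \<le> r * infdist x C + e"
        using le[of "r *\<^sub>R c" "r *\<^sub>R x"] by linarith
    qed
  qed (use C0 in simp)
qed

text \<open>Hahn-Banach for the distance to \<open>C\<close>: it vanishes on \<open>C\<close>, is
  positive at \<open>x\<close> because \<open>C\<close> is closed, and is at most the norm because 0
  lies in \<open>C\<close>. The negative of a linear minorant attaining it at \<open>x\<close> is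
  then a bounded member of the dual cone.\<close>

theorem closed_cone_separation:
  fixes C :: "'r::banach set"
  assumes "closed C" "convex C" "cone C" "C \<noteq> {}" "x \<notin> C"
  obtains m where "m \<in> dual_cone C" "blinfun_apply m x < 0"
proof -
  obtain f where f: "linear f" "\<And>v. f v \<le> infdist v C" "f x = infdist x C"
    using hahn_banach_sublinear[OF sublinear_infdist_cone[OF assms(2-4)]] by blast
  have C0: "0 \<in> C" using assms cone_contains_0 by blast
  have b: "f v \<le> norm v" for v
    using f(2)[of v] infdist_le[OF C0, of v] by simp
  have "bounded_linear f"
  proof (rule bounded_linear_intro[where K = 1])
    fix v show "norm (f v) \<le> norm v * 1"
      using b[of v] b[of "- v"] linear_neg[OF f(1), of v] by auto
  qed (use f(1) in \<open>auto simp: linear_add linear_scale\<close>)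
  then have bl: "bounded_linear (\<lambda>v. - f v)"
    by (rule bounded_linear_minus)
  have "f c \<le> 0" if "c \<in> C" for c
    using f(2)[of c] that by simp
  then have "Blinfun (\<lambda>v. - f v) \<in> dual_cone C"
    by (auto simp: dual_cone_def bounded_linear_Blinfun_apply[OF bl])
  moreover have "blinfun_apply (Blinfun (\<lambda>v. - f v)) x < 0"
    using f(3) in_closed_iff_infdist_zero[OF assms(1,4), of x] assms(5) infdist_nonneg[of x C]
    by (simp add: bounded_linear_Blinfun_apply[OF bl])
  ultimately show ?thesis using that by blast
qed

section \<open>Disks, strips and the Riemann sphere\<close>

lemma artanh_real_mono:
  fixes x y :: real
  assumes "0 \<le> x" "x \<le> y" "y < 1"
  shows "artanh x \<le> artanh y"
proof -
  have "(1 + x) / (1 - x) \<le> (1 + y) / (1 - y)" "0 < (1 + x) / (1 - x)"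
    using assms by (auto intro!: frac_le)
  then have "ln ((1 + x) / (1 - x)) \<le> ln ((1 + y) / (1 - y))"
    by (meson ln_mono)
  then show ?thesis by (simp add: artanh_def)
qed

text \<open>The pseudo-hyperbolic distance of \<open>k\<close> and \<open>- k\<close> in the unit disk.\<close>

definition schwarz_factor :: "real \<Rightarrow> real" where
  "schwarz_factor k = 2 * k / (1 + k\<^sup>2)"

lemma schwarz_factor_bounds:
  assumes "0 < k" "k < 1"
  shows "0 < schwarz_factor k" "schwarz_factor k < 1"
proof -
  have "0 < (1 - k)\<^sup>2" using assms by simp
  then have "2 * k < 1 + k\<^sup>2" by (simp add: power2_eq_square algebra_simps)
  then show "0 < schwarz_factor k" "schwarz_factor k < 1"
    using assms by (auto simp: schwarz_factor_def add_pos_pos)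
qed

text \<open>Schwarz's lemma after the Moebius map that sends 0 to -k; it sends
  \<open>schwarz_factor k\<close> to k. The bound \<open>b\<close> is kept as a factor so that the
  gain can be iterated.\<close>

lemma schwarz_two_points:
  assumes hol: "f holomorphic_on ball 0 1" and bound: "\<And>z. norm z < 1 \<Longrightarrow> norm (f z) \<le> b"
    and k: "0 < k" "k < (1::real)" and zero: "f (- of_real k) = 0"
  shows "norm (f (of_real k)) \<le> b * schwarz_factor k"
proof (rule field_le_mult_one_interval)
  \<comment> \<open>Schwarz's lemma wants values of modulus strictly below 1, so f/b is shrunk by an
    arbitrary t < 1.\<close>
  fix t :: real assume t: "0 < t" "t < 1"
  have b: "0 \<le> b" using bound[of 0] norm_ge_zero[of "f 0"] by (smt (verit) norm_zero)
  show "t * norm (f (of_real k)) \<le> b * schwarz_factor k"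
  proof (cases "b = 0")
    case True
    then show ?thesis using bound[of "of_real k"] k by simp
  next
    case False
    define \<psi> where "\<psi> = Moebius_function 0 (of_real k)"
    have \<psi>: "norm (\<psi> z) < 1" if "norm z < 1" for z
      unfolding \<psi>_def using Moebius_function_norm_lt_1[of "of_real k" z] that k by simp
    define g where "g = (\<lambda>z. of_real (t / b) * f (\<psi> z))"
    have "\<psi> holomorphic_on ball 0 1"
      unfolding \<psi>_def using k by (intro Moebius_function_holomorphic) simp
    then have "f \<circ> \<psi> holomorphic_on ball 0 1"
      by (rule holomorphic_on_compose_gen[OF _ hol]) (use \<psi> in auto)
    then have g: "g holomorphic_on ball 0 1"
      unfolding g_def by (intro holomorphic_intros) (simp add: o_def)
    have g0: "g 0 = 0" by (simp add: g_def \<psi>_def Moebius_function_simple zero)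
    have tb: "norm (of_real (t / b) :: complex) = t / b"
      using t b by (simp only: norm_of_real) simp
    have g1: "norm (g z) < 1" if "norm z < 1" for z
    proof -
      have "norm (g z) \<le> t / b * b"
        unfolding g_def norm_mult tb using bound[OF \<psi>[OF that]] t b by (intro mult_left_mono) auto
      then show ?thesis using t False by simp
    qed
    define c where "c = schwarz_factor k"
    have c: "0 < c" "c < 1" using schwarz_factor_bounds[OF k] by (auto simp: c_def)
    have k2: "1 + k\<^sup>2 \<noteq> 0" by (metis add_nonneg_eq_0_iff zero_le_one zero_le_power2 zero_neq_one)
    have "(c - k) = k * (1 - k * c)"
      using k2 by (simp add: c_def schwarz_factor_def field_simps power2_eq_square)
    then have "of_real (c - k) = of_real k * (1 - of_real k * (of_real c :: complex))"
      by (metis of_real_1 of_real_diff of_real_mult)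
    moreover have "k * c < 1" using k c mult_strict_mono'[of k 1 c 1] by simp
    then have "1 - of_real k * (of_real c :: complex) \<noteq> 0"
      by (metis eq_iff_diff_eq_0 less_irrefl of_real_1 of_real_eq_iff of_real_mult)
    ultimately have "\<psi> (of_real c) = of_real k"
      by (simp add: \<psi>_def Moebius_function_simple)
    then have "t / b * norm (f (of_real k)) = norm (g (of_real c))"
      by (simp only: g_def norm_mult tb)
    also have "\<dots> \<le> c"
      using Schwarz_Lemma(1)[OF g g0 g1, of "of_real c"] c by simp
    finally show ?thesis using b False by (simp add: c_def field_simps)
  qed
qed

text \<open>The Cayley transform centred at w(-k) carries the right half-plane to the disk and
  vanishes at -k. A known bound \<open>e\<close> on it is improved by one Schwarz factor; this is
  the inductive step for the decay of ratios.\<close>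

lemma halfplane_contraction:
  assumes hol: "w holomorphic_on ball 0 1" and pos: "\<And>z. norm z < 1 \<Longrightarrow> 0 < Re (w z)"
    and le: "\<And>z. norm z < 1 \<Longrightarrow> norm (w z - w (- of_real k)) \<le> e * norm (w z + cnj (w (- of_real k)))"
    and k: "0 < k" "k < (1::real)"
  shows "norm (w (of_real k) - w (- of_real k))
    \<le> e * schwarz_factor k * norm (w (of_real k) + cnj (w (- of_real k)))"
proof -
  define f where "f = (\<lambda>z. (w z - w (- of_real k)) / (w z + cnj (w (- of_real k))))"
  have nz: "w z + cnj (w (- of_real k)) \<noteq> 0" if "norm z < 1" for z
    using pos[OF that] pos[of "- of_real k"] k by (auto simp: complex_eq_iff)
  have "f holomorphic_on ball 0 1"
    unfolding f_def using nz by (intro holomorphic_intros hol) auto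
  moreover have "norm (f z) \<le> e" if "norm z < 1" for z
    using le[OF that] nz[OF that] by (simp add: f_def norm_divide divide_le_eq)
  ultimately have "norm (f (of_real k)) \<le> e * schwarz_factor k"
    by (rule schwarz_two_points) (use k in \<open>auto simp: f_def\<close>)
  then show ?thesis
    using nz[of "of_real k"] k by (simp add: f_def norm_divide divide_le_eq)
qed

lemma schwarz_pick_disk_dist:
  assumes hol: "h holomorphic_on ball 0 1" and h: "\<And>z. norm z < 1 \<Longrightarrow> norm (h z) < 1"
    and k: "0 < k" "k < (1::real)"
  shows "disk_dist (h (- of_real k)) (h (of_real k)) \<le> 2 * artanh (schwarz_factor k)"
proof -
  define q where "q = h (- of_real k)"
  have q: "norm q < 1" unfolding q_def using k by (intro h) auto
  define f where "f = Moebius_function 0 q \<circ> h"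
  have "f holomorphic_on ball 0 1"
    unfolding f_def
    by (rule holomorphic_on_compose_gen[OF hol Moebius_function_holomorphic[OF q]]) (use h in auto)
  moreover have "norm (f z) \<le> 1" if "norm z < 1" for z
    using Moebius_function_norm_lt_1[OF q h[OF that]] by (simp add: f_def less_imp_le)
  ultimately have le: "norm (f (of_real k)) \<le> 1 * schwarz_factor k"
    by (rule schwarz_two_points) (use k in \<open>auto simp: f_def q_def Moebius_function_simple\<close>)
  have "norm ((q - h (of_real k)) / (1 - cnj q * h (of_real k))) = norm (f (of_real k))"
    by (simp add: f_def Moebius_function_simple norm_divide norm_minus_commute)
  moreover have "artanh (norm (f (of_real k))) \<le> artanh (schwarz_factor k)"
    using le schwarz_factor_bounds[OF k] by (intro artanh_real_mono) auto
  ultimately show ?thesis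
    by (simp add: disk_dist_def q_def)
qed

text \<open>A scaled logarithm of (1 + rz)/(1 - rz) maps the disk into a thin rectangle around
  [-1, 1]: the argument of the quotient stays below pi/2, and r < 1 bounds its modulus from both
  sides.\<close>

lemma strip_map:
  fixes \<kappa> :: real
  assumes \<kappa>: "0 < \<kappa>"
  obtains k :: real and F where "0 < k" "k < 1" "F holomorphic_on ball 0 1"
    "F (of_real k) = 1" "F (- of_real k) = -1"
    "\<And>z. norm z < 1 \<Longrightarrow> \<exists>\<tau>\<in>{-1..1::real}. norm (F z - of_real \<tau>) \<le> \<kappa>"
proof -
  \<comment> \<open>The factor 1/4 turns an argument below pi/2 < 2 into an imaginary part of at
    most \<kappa>/2. \<open>E\<close> is chosen so that real parts are at most 1 + \<kappa>/2, and
    \<open>E1\<close> is the value of the quotient at which \<open>F\<close> equals 1.\<close>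
  define c where "c = \<kappa> / 4"
  have c: "0 < c" using \<kappa> by (simp add: c_def)
  define E where "E = exp ((1 + \<kappa> / 2) / c)"
  define E1 where "E1 = exp (1 / c)"
  have E1: "1 < E1" "E1 < E" using c \<kappa> by (auto simp: E_def E1_def divide_strict_right_mono)
  define r where "r = (E - 1) / (E + 1)"
  define r1 where "r1 = (E1 - 1) / (E1 + 1)"
  have r: "0 < r1" "r1 < r" "r < 1" using E1 by (auto simp: r_def r1_def field_simps)
  have rE: "(1 + r) / (1 - r) = E" "(1 + r1) / (1 - r1) = E1"
    using E1 by (auto simp: r_def r1_def field_simps)
  define k where "k = r1 / r"
  have k: "0 < k" "k < 1" "r * k = r1" using r by (auto simp: k_def)
  define W where "W = (\<lambda>z::complex. (1 + of_real r * z) / (1 - of_real r * z))"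
  have rz: "norm (of_real r * z) \<le> r" "norm (of_real r * z) < 1" if "norm z < 1" for z :: complex
  proof -
    have "r * norm z \<le> r" using r that by (simp add: mult_left_le)
    moreover have "r * norm z < 1" using calculation r by linarith
    ultimately show "norm (of_real r * z) \<le> r" "norm (of_real r * z) < 1"
      using r by (auto simp: norm_mult)
  qed
  have nz: "1 - of_real r * z \<noteq> 0" "1 + of_real r * z \<noteq> 0" if "norm z < 1" for z :: complex
    using rz(2)[OF that] by (auto simp: add_eq_0_iff)
  have ReW: "0 < Re (W z)" if z: "norm z < 1" for z
  proof -
    define u where "u = of_real r * z"
    have "Re ((1 + u) * cnj (1 - u)) = 1 - (norm u)\<^sup>2"
      unfolding cmod_power2 by (simp add: algebra_simps power2_eq_square)
    moreover have "(norm u)\<^sup>2 < 1" using rz(2)[OF z] by (simp add: u_def abs_square_less_1)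
    moreover have "Re (W z) = Re ((1 + u) * cnj (1 - u)) / (norm (1 - u))\<^sup>2"
      unfolding W_def u_def by (simp add: complex_div_cnj[of "1 + of_real r * z"] del: complex_cnj_diff flip: of_real_power)
    ultimately show ?thesis using nz[OF z] by (simp add: u_def)
  qed
  define F where "F = (\<lambda>z. of_real c * Ln (W z))"
  have "W z \<notin> \<real>\<^sub>\<le>\<^sub>0" if "norm z < 1" for z
    using ReW[OF that] by (auto simp: complex_nonpos_Reals_iff)
  moreover have "W holomorphic_on ball 0 1"
    unfolding W_def using nz by (intro holomorphic_intros) auto
  ultimately have hol: "F holomorphic_on ball 0 1"
    unfolding F_def by (intro holomorphic_intros) auto
  have W: "W (of_real k) = of_real E1" "W (- of_real k) = of_real (1 / E1)"
  proof -
    have "of_real r * of_real k = (of_real r1 :: complex)" using k(3) by (metis of_real_mult)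
    then have "W (of_real k) = of_real ((1 + r1) / (1 - r1))"
      "W (- of_real k) = of_real ((1 - r1) / (1 + r1))"
      by (simp_all add: W_def)
    moreover have "(1 - r1) / (1 + r1) = 1 / E1" unfolding rE(2)[symmetric] by simp
    ultimately show "W (of_real k) = of_real E1" "W (- of_real k) = of_real (1 / E1)"
      using rE(2) by simp_all
  qed
  have "F (of_real k) = of_real (c * ln E1)" "F (- of_real k) = of_real (c * ln (1 / E1))"
    unfolding F_def W of_real_mult using E1 by (subst Ln_of_real; simp)+
  then have Fk: "F (of_real k) = 1" "F (- of_real k) = - 1"
    using c by (simp_all add: E1_def ln_div)
  have "\<exists>\<tau>\<in>{-1..1::real}. norm (F z - of_real \<tau>) \<le> \<kappa>" if z: "norm z < 1" for z
  proof -
    have Wz: "W z \<noteq> 0" using ReW[OF z] by auto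
    have "\<bar>Im (Ln (W z))\<bar> < pi / 2" using Re_Ln_pos_lt[OF Wz] ReW[OF z] by simp
    then have "c * \<bar>Im (Ln (W z))\<bar> \<le> c * 2"
      using c pi_less_4 by (intro mult_left_mono) auto
    then have im: "\<bar>Im (F z)\<bar> \<le> \<kappa> / 2"
      using c by (simp add: F_def abs_mult c_def)
    have up: "norm (1 + s * of_real r * z) \<le> 1 + r" "1 - r \<le> norm (1 + s * of_real r * z)"
      if "norm s = 1" for s :: complex
    proof -
      have *: "norm (s * of_real r * z) \<le> r" using rz(1)[OF z] that by (simp add: norm_mult)
      show "norm (1 + s * of_real r * z) \<le> 1 + r"
        using norm_triangle_ineq[of 1 "s * of_real r * z"] * by simp
      show "1 - r \<le> norm (1 + s * of_real r * z)"
        using norm_diff_ineq[of 1 "s * of_real r * z"] * by simp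
    qed
    have up1: "norm (1 + of_real r * z) \<le> 1 + r" "1 - r \<le> norm (1 + of_real r * z)"
      "norm (1 - of_real r * z) \<le> 1 + r" "1 - r \<le> norm (1 - of_real r * z)"
      using up[of 1] up[of "-1"] by auto
    have "norm (W z) \<le> (1 + r) / (1 - r)"
      unfolding W_def norm_divide using up1 r by (intro frac_le) auto
    moreover have "(1 - r) / (1 + r) \<le> norm (W z)"
      unfolding W_def norm_divide using up1 r nz[OF z] by (intro frac_le) auto
    moreover have "(1 - r) / (1 + r) = 1 / E" unfolding rE(1)[symmetric] by simp
    ultimately have "norm (W z) \<le> E" "1 / E \<le> norm (W z)" using rE(1) by auto
    moreover have "0 < E" by (simp add: E_def)
    ultimately have "ln (norm (W z)) \<le> ln E" "ln (1 / E) \<le> ln (norm (W z))"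
      using Wz by (subst ln_le_cancel_iff; force)+
    then have "\<bar>ln (norm (W z))\<bar> \<le> (1 + \<kappa> / 2) / c"
      by (simp add: E_def ln_div)
    moreover have "Re (F z) = c * ln (norm (W z))"
      using Wz by (simp add: F_def)
    ultimately have re: "\<bar>Re (F z)\<bar> \<le> 1 + \<kappa> / 2"
      using c by (simp add: abs_mult field_simps)
    \<comment> \<open>Clipping the real part to [-1, 1] moves it by at most \<kappa>/2.\<close>
    define \<tau> where "\<tau> = max (-1) (min 1 (Re (F z)))"
    have "norm (F z - of_real \<tau>) \<le> \<bar>Re (F z - of_real \<tau>)\<bar> + \<bar>Im (F z - of_real \<tau>)\<bar>"
      by (rule cmod_le)
    also have "\<dots> \<le> \<kappa> / 2 + \<kappa> / 2"
      using im re by (intro add_mono) (auto simp: \<tau>_def max_def min_def)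
    finally show ?thesis
      by (intro bexI[of _ \<tau>]) (auto simp: \<tau>_def)
  qed
  with k hol Fk show ?thesis using that by blast
qed


text \<open>The coordinate \<open>1 / (\<lambda> - p)\<close> of the sphere sends \<open>p\<close> to infinity; this is its inverse.\<close>

definition sphere_chart :: "complex \<Rightarrow> complex \<Rightarrow> sphere" where
  "sphere_chart p z = (if z = 0 then Infty else Fin (p + 1 / z))"

lemma open_sphere_iff:
  "open (S :: sphere set) \<longleftrightarrow> open {z. Fin z \<in> S} \<and> (Infty \<in> S \<longrightarrow> compact {z. Fin z \<notin> S})"
  by (simp add: open_sphere_def)

lemma inj_sphere_chart: "inj_on (sphere_chart p) A"
  by (auto simp: inj_on_def sphere_chart_def split: if_splits)

lemma Fin_in_sphere_chart_image:
  "Fin l \<in> sphere_chart p ` A \<longleftrightarrow> l \<noteq> p \<and> 1 / (l - p) \<in> A"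
proof
  assume "l \<noteq> p \<and> 1 / (l - p) \<in> A"
  then show "Fin l \<in> sphere_chart p ` A"
    by (intro image_eqI[of _ _ "1 / (l - p)"]) (auto simp: sphere_chart_def)
qed (auto simp: sphere_chart_def split: if_splits)

lemma Infty_in_sphere_chart_image: "Infty \<in> sphere_chart p ` A \<longleftrightarrow> 0 \<in> A"
  by (auto simp: sphere_chart_def image_iff split: if_splits)

lemma open_sphere_chart_image:
  assumes "open A"
  shows "open (sphere_chart p ` A)"
proof -
  have cont: "continuous_on (- {p}) (\<lambda>l. 1 / (l - p))"
    by (intro continuous_intros) auto
  have eq: "{l. Fin l \<in> sphere_chart p ` A} = (- {p}) \<inter> (\<lambda>l. 1 / (l - p)) -` A"
    by (auto simp: Fin_in_sphere_chart_image)
  have o: "open {l. Fin l \<in> sphere_chart p ` A}"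
    unfolding eq by (rule continuous_open_preimage[OF cont _ assms]) auto
  have "compact {l. Fin l \<notin> sphere_chart p ` A}" if A0: "0 \<in> A"
  proof -
    obtain e where e: "0 < e" "ball 0 e \<subseteq> A"
      using A0 assms[unfolded open_contains_ball] by meson
    have "norm (l - p) \<le> 1 / e" if l: "Fin l \<notin> sphere_chart p ` A" for l
    proof (rule ccontr)
      assume "\<not> norm (l - p) \<le> 1 / e"
      then have *: "1 / e < norm (l - p)" by simp
      then have "1 < norm (l - p) * e" using e(1) by (simp add: divide_less_eq)
      moreover from this have "l \<noteq> p" by auto
      ultimately have "norm (1 / (l - p)) < e" "l \<noteq> p"
        by (simp_all add: norm_divide divide_less_eq mult.commute)
      then show False using l e(2) by (auto simp: Fin_in_sphere_chart_image)
    qed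
    then have "{l. Fin l \<notin> sphere_chart p ` A} \<subseteq> cball p (1 / e)"
      by (auto simp: dist_norm norm_minus_commute)
    then have "bounded {l. Fin l \<notin> sphere_chart p ` A}"
      using bounded_cball bounded_subset by blast
    moreover have "closed {l. Fin l \<notin> sphere_chart p ` A}"
      using o by (simp add: closed_def Compl_eq)
    ultimately show ?thesis by (simp add: compact_eq_bounded_closed)
  qed
  then show ?thesis
    using o by (auto simp: open_sphere_iff Infty_in_sphere_chart_image)
qed

lemma open_sphere_chart_vimage:
  assumes S: "open S"
  shows "open (sphere_chart p -` S)"
proof -
  have cont: "continuous_on (- {0}) (\<lambda>z. p + 1 / z)"
    by (intro continuous_intros) auto
  have o: "open {l. Fin l \<in> S}" using S by (simp add: open_sphere_iff)
  have "open ((- {0}) \<inter> (\<lambda>z. p + 1 / z) -` {l. Fin l \<in> S})"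
    by (rule continuous_open_preimage[OF cont _ o]) auto
  moreover have "\<exists>e>0. ball 0 e \<subseteq> sphere_chart p -` S" if "Infty \<in> S"
  proof -
    have "bounded {l. Fin l \<notin> S}"
      using S that by (simp add: open_sphere_iff compact_imp_bounded)
    then obtain B where B: "0 < B" "\<And>l. Fin l \<notin> S \<Longrightarrow> norm l \<le> B"
      unfolding bounded_pos by blast
    have pos: "0 < B + norm p + 1" using B(1) by (simp add: add_pos_nonneg)
    have "sphere_chart p z \<in> S" if "norm z < 1 / (B + norm p + 1)" for z
    proof (rule ccontr)
      assume *: "sphere_chart p z \<notin> S"
      then have z: "z \<noteq> 0" "Fin (p + 1 / z) \<notin> S"
        using \<open>Infty \<in> S\<close> by (auto simp: sphere_chart_def split: if_splits)
      have "norm (1 / z) \<le> norm (p + 1 / z) + norm p"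
        using norm_triangle_ineq4[of "p + 1 / z" p] by simp
      also have "\<dots> \<le> B + norm p" using B(2)[OF z(2)] by simp
      finally have "1 \<le> (B + norm p) * norm z"
        using z(1) by (simp add: norm_divide divide_le_eq)
      moreover have "norm z * (B + norm p + 1) < 1"
        using that pos by (simp add: field_simps)
      ultimately show False using norm_ge_zero[of z] by (simp add: algebra_simps)
    qed
    then show ?thesis
      using pos by (intro exI[of _ "1 / (B + norm p + 1)"]) (auto simp: dist_norm)
  qed
  ultimately have *: "\<exists>e>0. ball z e \<subseteq> sphere_chart p -` S" if "z \<in> sphere_chart p -` S" for z
  proof (cases "z = 0")
    case False
    let ?A = "(- {0}) \<inter> (\<lambda>z. p + 1 / z) -` {l. Fin l \<in> S}"
    have "z \<in> ?A" using that False by (auto simp: sphere_chart_def)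
    then obtain e where "e > 0" "ball z e \<subseteq> ?A"
      using \<open>open ?A\<close> open_contains_ball by blast
    moreover have "?A \<subseteq> sphere_chart p -` S" by (auto simp: sphere_chart_def)
    ultimately show ?thesis by blast
  qed (use that in \<open>auto simp: sphere_chart_def\<close>)
  then show ?thesis by (simp add: open_contains_ball)
qed

lemma homeomorphism_sphere_chart:
  obtains g where "homeomorphism UNIV (range (sphere_chart p)) (sphere_chart p) g"
proof (rule homeomorphism_injective_open_map[of UNIV "sphere_chart p" "range (sphere_chart p)"])
  show "continuous_on UNIV (sphere_chart p)"
    by (simp add: continuous_on_open_vimage open_sphere_chart_vimage)
  show "openin (top_of_set (range (sphere_chart p))) (sphere_chart p ` U)"
    if "openin (top_of_set UNIV) U" for U
    using that open_sphere_chart_image[of U p] by (auto simp: openin_open)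
qed (auto simp: inj_sphere_chart)

lemma interior_sphere_chart_image:
  "interior (sphere_chart p ` A) = sphere_chart p ` interior A"
proof
  show "sphere_chart p ` interior A \<subseteq> interior (sphere_chart p ` A)"
    by (intro interior_maximal image_mono interior_subset open_sphere_chart_image open_interior)
  have "sphere_chart p -` interior (sphere_chart p ` A) \<subseteq> interior A"
  proof (rule interior_maximal)
    have "sphere_chart p -` sphere_chart p ` A = A"
      by (simp add: inj_vimage_image_eq inj_sphere_chart)
    then show "sphere_chart p -` interior (sphere_chart p ` A) \<subseteq> A"
      using interior_subset[of "sphere_chart p ` A"] by blast
  qed (simp add: open_sphere_chart_vimage)
  moreover have "interior (sphere_chart p ` A) \<subseteq> range (sphere_chart p)"
    using interior_subset by blast
  ultimately show "interior (sphere_chart p ` A) \<subseteq> sphere_chart p ` interior A"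
    by blast
qed

lemma sphere_holomorphic_chart:
  assumes hol: "g holomorphic_on S" and S: "open S"
  shows "sphere_holomorphic_on (sphere_chart p \<circ> g) S"
  unfolding sphere_holomorphic_on_def
proof
  fix z assume z: "z \<in> S"
  have cont: "continuous_on S g" using hol by (rule holomorphic_on_imp_continuous_on)
  show "\<exists>r>0. \<exists>h. h holomorphic_on ball z r \<and>
        ((\<forall>w\<in>ball z r. (sphere_chart p \<circ> g) w = Fin (h w)) \<or>
         (\<forall>w\<in>ball z r. (sphere_chart p \<circ> g) w = sphere_inverse (Fin (h w))))"
  proof (cases "g z = 0")
    case False
    have "open (S \<inter> g -` (- {0}))" by (rule continuous_open_preimage[OF cont S]) auto
    then obtain r where r: "r > 0" "ball z r \<subseteq> S \<inter> g -` (- {0})"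
      using z False open_contains_ball by (metis ComplI Int_iff singletonD vimageI2)
    have "g holomorphic_on ball z r" using hol r(2) holomorphic_on_subset by blast
    then have "(\<lambda>w. p + 1 / g w) holomorphic_on ball z r"
      using r(2) by (intro holomorphic_intros) auto
    moreover have "\<forall>w\<in>ball z r. (sphere_chart p \<circ> g) w = Fin (p + 1 / g w)"
      using r(2) by (auto simp: sphere_chart_def)
    ultimately show ?thesis using r(1) by blast
  next
    \<comment> \<open>At a zero of \<open>g\<close> the chart takes the value \<open>Infty\<close>,
      so the reciprocal g/(1 + pg) is the holomorphic representative; the ball is shrunk until its
      denominator has no zero.\<close>
    case True
    have "open (S \<inter> (\<lambda>w. 1 + p * g w) -` (- {0}))"
      by (intro continuous_open_preimage[OF _ S] continuous_intros cont)
    moreover have "z \<in> S \<inter> (\<lambda>w. 1 + p * g w) -` (- {0})" using z True by simp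
    ultimately obtain r where r: "r > 0" "ball z r \<subseteq> S \<inter> (\<lambda>w. 1 + p * g w) -` (- {0})"
      using open_contains_ball by meson
    have "g holomorphic_on ball z r" using hol r(2) holomorphic_on_subset by blast
    then have "(\<lambda>w. g w / (1 + p * g w)) holomorphic_on ball z r"
      using r(2) by (intro holomorphic_intros) auto
    moreover have "\<forall>w\<in>ball z r. (sphere_chart p \<circ> g) w = sphere_inverse (Fin (g w / (1 + p * g w)))"
    proof
      fix w assume "w \<in> ball z r"
      then have "1 + p * g w \<noteq> 0" using r(2) by auto
      then show "(sphere_chart p \<circ> g) w = sphere_inverse (Fin (g w / (1 + p * g w)))"
        by (auto simp: sphere_chart_def field_simps)
    qed
    ultimately show ?thesis using r(1) by blast
  qed
qed

text \<open>Every outer point reaches the exterior of a large disk, so the complement of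
  \<open>\<Omega>\<close> is connected; so is its closure, the complement of the interior, and then
  the complement of a single component. A bounded plane domain with connected complement is simply
  connected.\<close>

lemma simply_connected_component_interior:
  fixes \<Omega> :: "complex set"
  assumes bd: "bounded \<Omega>"
    and out: "\<And>z. z \<notin> \<Omega> \<Longrightarrow> \<exists>S. connected S \<and> z \<in> S \<and> S \<inter> \<Omega> = {} \<and> \<not> bounded S"
    and U: "U \<in> components (interior \<Omega>)"
  shows "simply_connected U"
proof -
  obtain R where R: "\<Omega> \<subseteq> cball 0 R"
    using bd[unfolded bounded_iff] by (metis mem_cball_0 subsetI)
  have far: "connected (- cball (0::complex) R)"
    by (intro connected_complement_bounded_convex) simp_all
  have "connected_component (- \<Omega>) z (of_real (\<bar>R\<bar> + 1))" if z: "z \<notin> \<Omega>" for z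
  proof -
    obtain S where S: "connected S" "z \<in> S" "S \<inter> \<Omega> = {}" "\<not> bounded S" using out[OF z] by blast
    then obtain w where w: "w \<in> S" "w \<notin> cball 0 R"
      using bounded_cball bounded_subset by blast
    have "connected_component (- \<Omega>) z w"
      unfolding connected_component_def using S w by (intro exI[of _ S]) auto
    moreover have "connected_component (- \<Omega>) w (of_real (\<bar>R\<bar> + 1))"
      unfolding connected_component_def using far R w(2) by (intro exI[of _ "- cball 0 R"]) auto
    ultimately show ?thesis by (rule connected_component_trans)
  qed
  then have "connected (- \<Omega>)"
    unfolding connected_iff_connected_component
    by (meson ComplD connected_component_sym connected_component_trans)
  then have "connected (- interior \<Omega>)"
    unfolding closure_complement[symmetric] by (rule connected_imp_connected_closure)
  then have conn: "connected (- U)"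
    using component_complement_connected[of "- interior \<Omega>" U] U
    by simp
  have sub: "U \<subseteq> \<Omega>" using U in_components_subset interior_subset by blast
  have "open U" using U open_components open_interior by blast
  moreover have "connected U" using U in_components_connected by blast
  moreover have "\<not> bounded K" if "K \<in> components (- U)" for K
  proof -
    have "K = - U" using that conn in_components_nonempty
      by (metis components_eq_sing_iff components_empty empty_iff singletonD)
    moreover have "\<not> bounded (- U)"
      using bd bounded_subset[OF bd sub] bounded_Un[of U "- U"] not_bounded_UNIV[where 'a=complex] by simp
    ultimately show ?thesis by simp
  qed
  ultimately show ?thesis by (simp add: simply_connected_eq_unbounded_complement_components)
qed

text \<open>A Riemann map of the component \<open>V\<close> is a homeomorphism, hence already a
  covering by the disk and admissible in the infimum that defines \<open>hyperbolic_dist\<close>.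
  Schwarz-Pick for \<open>f \<circ> H\<close> bounds the distance of the two preimages.\<close>

proposition hyperbolic_dist_chart_le:
  fixes \<Omega> :: "complex set"
  assumes bd: "bounded \<Omega>"
    and out: "\<And>z. z \<notin> \<Omega> \<Longrightarrow> \<exists>S. connected S \<and> z \<in> S \<and> S \<inter> \<Omega> = {} \<and> \<not> bounded S"
    and H: "H holomorphic_on ball 0 1" "H ` ball 0 1 \<subseteq> interior \<Omega>"
    and k: "0 < k" "k < (1::real)"
    and ab: "a = sphere_chart p (H (- of_real k))" "b = sphere_chart p (H (of_real k))"
  defines "U \<equiv> connected_component_set (interior (sphere_chart p ` \<Omega>)) a"
  shows "b \<in> U" and "hyperbolic_dist U a b \<le> ereal (2 * artanh (schwarz_factor k))"
proof -
  let ?T = "sphere_chart p" and ?z = "H (- of_real k)"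
  obtain T' where T': "homeomorphism UNIV (range ?T) ?T T'"
    using homeomorphism_sphere_chart by blast
  define V where "V = connected_component_set (interior \<Omega>) ?z"
  have kb: "- of_real k \<in> ball (0::complex) 1" "of_real k \<in> ball (0::complex) 1" using k by auto
  have z: "?z \<in> interior \<Omega>" using H(2) kb by blast
  have VU: "?T ` V = U"
    unfolding U_def V_def interior_sphere_chart_image ab
    by (rule connected_component_set_homeomorphism[symmetric, OF homeomorphism_of_subsets[OF T']])
      (use z in auto)
  have Vcomp: "V \<in> components (interior \<Omega>)"
    unfolding V_def components_def using z by blast
  have "connected (H ` ball 0 1)"
    by (intro connected_continuous_image holomorphic_on_imp_continuous_on H(1) connected_ball)
  then have HV: "H ` ball 0 1 \<subseteq> V"
    unfolding V_def using H(2) kb by (intro connected_component_maximal) auto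
  show "b \<in> U" unfolding VU[symmetric] ab using HV kb by blast
  have "open V" using Vcomp open_components open_interior by blast
  moreover have "simply_connected V" by (rule simply_connected_component_interior[OF bd out Vcomp])
  moreover have "V \<noteq> {}" using HV kb by blast
  moreover have "V \<noteq> UNIV"
    using bd Vcomp in_components_subset interior_subset bounded_subset not_bounded_UNIV by metis
  ultimately obtain f g where fg: "f holomorphic_on V" "g holomorphic_on ball 0 1"
    "\<And>z. z \<in> V \<Longrightarrow> f z \<in> ball 0 1 \<and> g (f z) = z" "\<And>z. z \<in> ball 0 1 \<Longrightarrow> g z \<in> V \<and> f (g z) = z"
    using Riemann_mapping_theorem[of V] by blast
  have "homeomorphism (ball 0 1) V g f"
  proof (rule homeomorphismI)
    show "continuous_on (ball 0 1) g" "continuous_on V f"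
      using fg(1,2) by (simp_all add: holomorphic_on_imp_continuous_on)
  qed (use fg(3,4) in auto)
  moreover have "homeomorphism V U ?T T'"
    by (rule homeomorphism_of_subsets[OF T']) (auto simp: VU)
  ultimately have cover: "covering_space (ball 0 1) (?T \<circ> g) U"
    using homeomorphism_compose homeomorphism_imp_covering_space by blast
  have hol: "sphere_holomorphic_on (?T \<circ> g) (ball 0 1)"
    by (rule sphere_holomorphic_chart[OF fg(2)]) auto
  have "f \<circ> H holomorphic_on ball 0 1"
    by (rule holomorphic_on_compose_gen[OF H(1) fg(1) HV])
  then have "disk_dist ((f \<circ> H) (- of_real k)) ((f \<circ> H) (of_real k)) \<le> 2 * artanh (schwarz_factor k)"
    by (rule schwarz_pick_disk_dist) (use HV fg(3) k in \<open>auto simp: image_subset_iff\<close>)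
  moreover have "hyperbolic_dist U a b \<le> ereal (disk_dist ((f \<circ> H) (- of_real k)) ((f \<circ> H) (of_real k)))"
    unfolding hyperbolic_dist_def
  proof (rule Inf_lower, safe intro!: exI)
    show "sphere_holomorphic_on (?T \<circ> g) (ball 0 1)" "covering_space (ball 0 1) (?T \<circ> g) U"
      by (fact hol cover)+
  qed (use HV kb fg(3) in \<open>auto simp: ab image_subset_iff\<close>)
  ultimately show "hyperbolic_dist U a b \<le> ereal (2 * artanh (schwarz_factor k))"
    using order_trans by fastforce
qed

section \<open>Complexifications and their cones\<close>

lemma scaleC_zero_left [simp]: "0 *\<^sub>C u = 0"
  using scaleC_of_real[of 0 u] by simp

lemma scaleC_one [simp]: "1 *\<^sub>C u = u"
  using scaleC_of_real[of 1 u] by simp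

lemma scaleC_zero_right [simp]: "c *\<^sub>C (0 :: 'c::complex_banach) = 0"
  using norm_scaleC[of c "0::'c"] by simp

lemma scaleC_minus_left [simp]: "(- c) *\<^sub>C u = - (c *\<^sub>C u)"
  using scaleC_add_left[of c "- c" u] by (simp add: eq_neg_iff_add_eq_0 add.commute)

lemma scaleC_minus_right [simp]: "c *\<^sub>C (- u) = - (c *\<^sub>C u)"
  using scaleC_add_right[of c u "- u"] by (simp add: eq_neg_iff_add_eq_0 add.commute)

lemma scaleC_diff_left: "(c - d) *\<^sub>C u = c *\<^sub>C u - d *\<^sub>C u"
  using scaleC_add_left[of c "- d" u] by simp

lemma scaleC_diff_right: "c *\<^sub>C (u - v) = c *\<^sub>C u - c *\<^sub>C v"
  using scaleC_add_right[of c u "- v"] by simp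

lemma scaleC_eq_0_iff [simp]: "c *\<^sub>C u = 0 \<longleftrightarrow> c = 0 \<or> u = 0"
  using norm_scaleC[of c u] by (metis norm_eq_zero mult_eq_0_iff)

lemma scaleC_scaleC_real: "c *\<^sub>C r *\<^sub>R u = (c * of_real r) *\<^sub>C u" "r *\<^sub>R c *\<^sub>C u = (of_real r * c) *\<^sub>C u"
  by (simp_all add: scaleC_scaleC flip: scaleC_of_real)

lemma bounded_clinear_add: "bounded_clinear T \<Longrightarrow> T (u + v) = T u + T v"
  and bounded_clinear_diff: "bounded_clinear T \<Longrightarrow> T (u - v) = T u - T v"
  and bounded_clinear_scaleC: "bounded_clinear T \<Longrightarrow> T (c *\<^sub>C u) = c *\<^sub>C T u"
  and bounded_clinear_scaleR: "bounded_clinear T \<Longrightarrow> T (r *\<^sub>R u) = r *\<^sub>R T u"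
  and bounded_clinear_0: "bounded_clinear T \<Longrightarrow> T 0 = 0"
  and bounded_clinear_bounded: "bounded_clinear T \<Longrightarrow> bounded_linear T"
  by (auto simp: bounded_clinear_def bounded_linear.linear linear_add linear_diff linear_scale linear_0)

text \<open>By compactness the closed set of directions of \<open>K\<close> contains a most
  clockwise one. Every other direction is at most a right angle counterclockwise of it, so dividing
  by it rotates \<open>K\<close> into the first quadrant.\<close>

lemma quarter_plane:
  fixes K :: "complex set"
  assumes acute: "\<And>z w. z \<in> K \<Longrightarrow> w \<in> K \<Longrightarrow> 0 \<le> Re (z * cnj w)"
  obtains c where "norm c = 1" "\<And>z. z \<in> K \<Longrightarrow> 0 \<le> Re (c * z) \<and> 0 \<le> Im (c * z)"
proof (cases "K \<subseteq> {0}")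
  case True
  then show ?thesis using that[of 1] by force
next
  case False
  define S0 where "S0 = sgn ` (K - {0})"
  define S where "S = closure S0"
  have S0: "norm z = 1" if "z \<in> S0" for z
    using that by (auto simp: S0_def norm_sgn split: if_splits)
  then have "bounded S0" by (intro boundedI[of _ 1]) auto
  then have "compact S" by (simp add: S_def compact_closure)
  have S1: "norm z = 1" if "z \<in> S" for z
  proof -
    have "closure S0 \<subseteq> sphere 0 1"
      by (rule closure_minimal) (use S0 in auto)
    then show ?thesis using that by (auto simp: S_def)
  qed
  have Re0: "0 \<le> Re (z * cnj w)" if zw: "z \<in> S0" "w \<in> S0" for z w
  proof -
    obtain a b where ab: "a \<in> K" "b \<in> K" "z = sgn a" "w = sgn b"
      using zw unfolding S0_def by blast
    have "z * cnj w = (a * cnj b) /\<^sub>R (norm a * norm b)"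
      by (simp add: ab(3,4) sgn_eq scaleR_conv_of_real field_simps)
    then show ?thesis using acute[OF ab(1,2)] by simp
  qed
  have Re1: "0 \<le> Re (z * cnj w)" if "z \<in> S" "w \<in> S0" for z w
  proof -
    have "closed {z. 0 \<le> Re (z * cnj w)}"
      by (intro closed_Collect_le continuous_intros)
    then have "closure S0 \<subseteq> {z. 0 \<le> Re (z * cnj w)}"
      by (rule closure_minimal[rotated]) (use Re0 that in auto)
    then show ?thesis using that by (auto simp: S_def)
  qed
  have Re2: "0 \<le> Re (z * cnj w)" if "z \<in> S" "w \<in> S" for z w
  proof -
    have "closed {w. 0 \<le> Re (z * cnj w)}"
      by (intro closed_Collect_le continuous_intros)
    then have "closure S0 \<subseteq> {w. 0 \<le> Re (z * cnj w)}"
      by (rule closure_minimal[rotated]) (use Re1 that in auto)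
    then show ?thesis using that by (auto simp: S_def)
  qed
  obtain z0 where "z0 \<in> K - {0}" using False by blast
  define u where "u = sgn z0"
  have sgn_S: "sgn z \<in> S" if "z \<in> K - {0}" for z
    using that closure_subset[of S0] unfolding S_def S0_def by blast
  then have "u \<in> S" using \<open>z0 \<in> K - {0}\<close> by (simp add: u_def)
  \<comment> \<open>Relative to \<open>u\<close> all directions have nonnegative real part, so the
    imaginary part orders them by angle.\<close>
  have "continuous_on S (\<lambda>z. Im (z * cnj u))" by (intro continuous_intros)
  then obtain z1 where z1: "z1 \<in> S" "\<And>z. z \<in> S \<Longrightarrow> Im (z1 * cnj u) \<le> Im (z * cnj u)"
    using continuous_attains_inf[OF \<open>compact S\<close>] \<open>u \<in> S\<close> by blast
  have uu: "u * cnj u = 1" using S1[OF \<open>u \<in> S\<close>] by (simp add: complex_norm_square[symmetric])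
  have Im1: "0 \<le> Im (z * cnj z1)" if z: "z \<in> S" for z
  proof -
    define p where "p = z * cnj u"
    define q where "q = z1 * cnj u"
    have "p * cnj q = (z * cnj z1) * (u * cnj u)" by (simp add: p_def q_def algebra_simps)
    then have "z * cnj z1 = p * cnj q" by (simp only: uu mult_1_right)
    then have "Im (z * cnj z1) = Im (p * cnj q)" by (rule arg_cong)
    also have "\<dots> = Im p * Re q - Re p * Im q" by simp
    finally have pq: "Im (z * cnj z1) = Im p * Re q - Re p * Im q" .
    have Re: "0 \<le> Re p" "0 \<le> Re q"
      unfolding p_def q_def using Re2 z z1(1) \<open>u \<in> S\<close> by blast+
    have Im: "Im q \<le> Im p" "Im q \<le> 0"
      unfolding p_def q_def using z1(2)[OF z] z1(2)[OF \<open>u \<in> S\<close>] uu by auto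
    have "norm p = 1" "norm q = 1"
      using S1[OF z] S1[OF z1(1)] S1[OF \<open>u \<in> S\<close>] by (auto simp: p_def q_def norm_mult)
    then have one: "(Re p)\<^sup>2 + (Im p)\<^sup>2 = 1" "(Re q)\<^sup>2 + (Im q)\<^sup>2 = 1"
      by (auto simp flip: cmod_power2)
    show ?thesis
    proof (cases "0 \<le> Im p")
      case True
      then have "0 \<le> Im p * Re q" "Re p * Im q \<le> 0"
        using Re Im by (auto simp: mult_nonneg_nonpos)
      then show ?thesis using pq by simp
    next
      case False
      then have "(- Im p)\<^sup>2 \<le> (- Im q)\<^sup>2" using Im by (intro power_mono) auto
      then have "(Re q)\<^sup>2 \<le> (Re p)\<^sup>2" using one by simp
      then have "Re q \<le> Re p" using Re by (simp add: power_mono_iff)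
      then have "(- Im p) * Re q \<le> (- Im q) * Re p"
        using False Re Im by (intro mult_mono) auto
      then show ?thesis using pq by (simp add: mult.commute)
    qed
  qed
  have "0 \<le> Re (cnj z1 * z) \<and> 0 \<le> Im (cnj z1 * z)" if "z \<in> K" for z
  proof (cases "z = 0")
    case False
    then have "sgn z \<in> S" using that sgn_S by simp
    moreover have "cnj z1 * z = norm z *\<^sub>R (sgn z * cnj z1)"
      using False by (simp add: sgn_eq scaleR_conv_of_real)
    ultimately show ?thesis
      using Im1[of "sgn z"] Re2[OF _ z1(1), of "sgn z"] by (simp add: zero_le_mult_iff)
  qed simp
  then show ?thesis using that[of "cnj z1"] S1[OF z1(1)] by simp
qed

section \<open>Real and imaginary components and the complex-linear pairing\<close>

locale complexified =
  fixes \<iota> :: "'r::banach \<Rightarrow> 'c::complex_banach" and J :: "'c \<Rightarrow> 'c"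
  assumes complexification: "complexification \<iota> J"
begin

lemma bounded_linear_J: "bounded_linear J"
  and J_scaleC: "J (c *\<^sub>C u) = cnj c *\<^sub>C J u"
  and J_J [simp]: "J (J u) = u"
  and linear_iota: "linear \<iota>"
  and norm_iota [simp]: "norm (\<iota> x) = norm x"
  and range_iota: "range \<iota> = range (\<lambda>u. (1/2) *\<^sub>R (u + J u))"
  using complexification by (auto simp: complexification_def)

lemmas J_add = linear_add[OF bounded_linear.linear[OF bounded_linear_J]]
  and J_scaleR = linear_scale[OF bounded_linear.linear[OF bounded_linear_J]]
  and J_minus = linear_neg[OF bounded_linear.linear[OF bounded_linear_J]]

lemmas iota_add = linear_add[OF linear_iota]
  and iota_diff = linear_diff[OF linear_iota]
  and iota_scaleR = linear_scale[OF linear_iota]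
  and iota_0 = linear_0[OF linear_iota]

lemma inj_iota: "inj \<iota>"
proof (rule injI)
  fix x y assume "\<iota> x = \<iota> y"
  then have "norm (\<iota> (x - y)) = 0" by (simp add: iota_diff)
  then show "x = y" by simp
qed

lemma J_iota [simp]: "J (\<iota> x) = \<iota> x"
proof -
  obtain u where "\<iota> x = (1/2) *\<^sub>R (u + J u)"
    using range_iota by blast
  then show ?thesis by (simp add: J_add J_scaleR add.commute)
qed

lemma iota_re_part: "\<iota> (re_part \<iota> J u) = (1/2) *\<^sub>R (u + J u)"
  unfolding re_part_def by (rule f_inv_into_f) (use range_iota in auto)

lemma iota_im_part: "\<iota> (im_part \<iota> J u) = (1 / (2 * \<i>)) *\<^sub>C (u - J u)"
proof -
  have "(1 / (2 * \<i>)) *\<^sub>C (u - J u) = (1/2) *\<^sub>R ((1 / \<i>) *\<^sub>C u + J ((1 / \<i>) *\<^sub>C u))"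
    by (simp add: J_scaleC J_minus scaleC_diff_right scaleR_diff_right scaleC_scaleC_real)
  then show ?thesis
    unfolding im_part_def by (intro f_inv_into_f) (metis range_iota rangeI)
qed

lemma re_im_part: "u = \<iota> (re_part \<iota> J u) + \<i> *\<^sub>C \<iota> (im_part \<iota> J u)"
proof -
  have "\<i> *\<^sub>C \<iota> (im_part \<iota> J u) = (1/2) *\<^sub>R (u - J u)"
    by (simp add: iota_im_part scaleC_scaleC flip: scaleC_of_real)
  then show ?thesis
    by (simp add: iota_re_part flip: scaleR_add_right)
qed

lemma re_im_part_eq:
  assumes "u = \<iota> x + \<i> *\<^sub>C \<iota> y"
  shows "re_part \<iota> J u = x" "im_part \<iota> J u = y"
proof -
  have Ju: "J u = \<iota> x - \<i> *\<^sub>C \<iota> y" by (simp add: assms J_add J_scaleC)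
  have "u + J u = 2 *\<^sub>R \<iota> x" by (subst Ju) (simp add: assms scaleR_2)
  then have "\<iota> (re_part \<iota> J u) = \<iota> x"
    by (simp add: iota_re_part)
  then show "re_part \<iota> J u = x" using inj_iota by (simp add: inj_eq)
  have "u - J u = 2 *\<^sub>R \<i> *\<^sub>C \<iota> y" by (subst Ju) (simp add: assms scaleR_2)
  then have "\<iota> (im_part \<iota> J u) = \<iota> y"
    by (simp add: iota_im_part scaleC_scaleC_real scaleC_scaleC)
  then show "im_part \<iota> J u = y" using inj_iota by (simp add: inj_eq)
qed

abbreviation cp :: "('r \<Rightarrow>\<^sub>L real) \<Rightarrow> 'c \<Rightarrow> complex" where "cp \<equiv> cpair \<iota> J"

lemma cpair_eq: "cp l (\<iota> x + \<i> *\<^sub>C \<iota> y) = Complex (l x) (l y)"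
  by (simp add: cpair_def re_im_part_eq[OF refl])

lemma cpair_iota [simp]: "cp l (\<iota> x) = of_real (l x)"
  using cpair_eq[of l x 0] by (simp add: iota_0 complex_of_real_def)

lemma cpair_0 [simp]: "cp l 0 = 0"
  using cpair_iota[of l 0] by (simp add: iota_0)

lemma cpair_add [simp]: "cp l (u + v) = cp l u + cp l v"
proof -
  have "u + v = \<iota> (re_part \<iota> J u + re_part \<iota> J v) + \<i> *\<^sub>C \<iota> (im_part \<iota> J u + im_part \<iota> J v)"
    using re_im_part[of u] re_im_part[of v]
    by (simp add: iota_add scaleC_add_right) (metis add.assoc add.left_commute)
  then show ?thesis
    using cpair_eq by (simp add: cpair_def blinfun.add_right complex_eq_iff)
qed

lemma cpair_scaleC [simp]: "cp l (c *\<^sub>C u) = c * cp l u"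
proof -
  define x y where "x = re_part \<iota> J u" and "y = im_part \<iota> J u"
  have u: "u = \<iota> x + \<i> *\<^sub>C \<iota> y" unfolding x_def y_def by (rule re_im_part)
  have "c *\<^sub>C u = (of_real (Re c) + \<i> * of_real (Im c)) *\<^sub>C (\<iota> x + \<i> *\<^sub>C \<iota> y)"
    using u complex_eq[of c] by simp
  also have "\<dots> = \<iota> (Re c *\<^sub>R x - Im c *\<^sub>R y) + \<i> *\<^sub>C \<iota> (Re c *\<^sub>R y + Im c *\<^sub>R x)"
    by (simp add: scaleC_add_left scaleC_add_right scaleC_scaleC iota_add iota_diff iota_scaleR
        scaleC_diff_left scaleC_diff_right algebra_simps flip: scaleC_of_real)
  finally have "cp l (c *\<^sub>C u) = Complex (l (Re c *\<^sub>R x - Im c *\<^sub>R y)) (l (Re c *\<^sub>R y + Im c *\<^sub>R x))"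
    by (simp only: cpair_eq)
  moreover have "cp l u = Complex (l x) (l y)" by (subst u) (rule cpair_eq)
  ultimately show ?thesis
    by (simp add: complex_eq_iff blinfun.bilinear_simps)
qed

lemma cpair_minus [simp]: "cp l (- u) = - cp l u"
  using cpair_scaleC[of l "-1" u] by simp

lemma cpair_diff [simp]: "cp l (u - v) = cp l u - cp l v"
  using cpair_add[of l u "- v"] by simp

lemma cpair_scaleR [simp]: "cp l (r *\<^sub>R u) = of_real r * cp l u"
  using cpair_scaleC[of l "of_real r" u] by (simp add: scaleC_of_real)

lemma cpair_add_left [simp]: "cp (l + m) u = cp l u + cp m u"
  and cpair_scaleR_left [simp]: "cp (r *\<^sub>R l) u = of_real r * cp l u"
  by (simp_all add: cpair_def blinfun.bilinear_simps complex_eq_iff)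

lemma cpair_J: "cp l (J u) = cnj (cp l u)"
proof -
  define x y where "x = re_part \<iota> J u" and "y = im_part \<iota> J u"
  have u: "u = \<iota> x + \<i> *\<^sub>C \<iota> y" unfolding x_def y_def by (rule re_im_part)
  have "J u = \<iota> x + \<i> *\<^sub>C \<iota> (- y)"
    by (subst u) (simp add: J_add J_scaleC linear_neg[OF linear_iota])
  then have "cp l (J u) = Complex (l x) (l (- y))" using cpair_eq by metis
  moreover have "cp l u = Complex (l x) (l y)" by (subst u) (rule cpair_eq)
  ultimately show ?thesis by (simp add: complex_eq_iff blinfun.minus_right)
qed

text \<open>Rewrites the domination inequalities, which are stated with the conjugate operator, in
  terms of the sesquilinear form that defines \<open>canonical_complexification\<close>.\<close>

lemma cpair_conj_op: "cp l (conj_op J M (\<iota> x)) = cnj (cp l (M (\<iota> x)))"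
  by (simp add: conj_op_def cpair_J)

lemma bounded_parts:
  obtains B where "0 < B" "\<And>u. norm (re_part \<iota> J u) \<le> B * norm u" "\<And>u. norm (im_part \<iota> J u) \<le> B * norm u"
proof -
  obtain B where B: "0 < B" "\<And>u. norm (J u) \<le> norm u * B"
    using bounded_linear.pos_bounded[OF bounded_linear_J] by blast
  have "norm (re_part \<iota> J u) \<le> (1 + B) * norm u" for u
  proof -
    have "norm (re_part \<iota> J u) = norm (u + J u) / 2"
      using iota_re_part[of u] norm_iota[of "re_part \<iota> J u"] by simp
    also have "\<dots> \<le> norm (u + J u)" by simp
    also have "\<dots> \<le> (1 + B) * norm u"
      using norm_triangle_ineq[of u "J u"] B(2)[of u] by (simp add: algebra_simps)
    finally show ?thesis .
  qed
  moreover have "norm (im_part \<iota> J u) \<le> (1 + B) * norm u" for u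
  proof -
    have "norm (im_part \<iota> J u) = norm (u - J u) / 2"
      using iota_im_part[of u] norm_iota[of "im_part \<iota> J u"] by (simp add: norm_scaleC norm_divide norm_mult)
    also have "\<dots> \<le> norm (u - J u)" by simp
    also have "\<dots> \<le> (1 + B) * norm u"
      using norm_triangle_ineq4[of u "J u"] B(2)[of u] by (simp add: algebra_simps)
    finally show ?thesis .
  qed
  ultimately show ?thesis using that[of "1 + B"] B(1) by auto
qed

lemma norm_le_parts: "norm u \<le> norm (re_part \<iota> J u) + norm (im_part \<iota> J u)"
proof -
  have "norm u = norm (\<iota> (re_part \<iota> J u) + \<i> *\<^sub>C \<iota> (im_part \<iota> J u))"
    using re_im_part[of u] by simp
  also have "\<dots> \<le> norm (\<iota> (re_part \<iota> J u)) + norm (\<i> *\<^sub>C \<iota> (im_part \<iota> J u))"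
    by (rule norm_triangle_ineq)
  finally show ?thesis by (simp add: norm_scaleC)
qed

lemma norm_cpair_le:
  obtains B where "0 < B" "\<And>u. norm (cp l u) \<le> B * norm u"
proof -
  obtain B where B: "0 < B" "\<And>u. norm (re_part \<iota> J u) \<le> B * norm u"
    "\<And>u. norm (im_part \<iota> J u) \<le> B * norm u" using bounded_parts by blast
  have "norm (cp l u) \<le> (2 * (norm l + 1) * B) * norm u" for u
  proof -
    have "norm (cp l u) \<le> \<bar>l (re_part \<iota> J u)\<bar> + \<bar>l (im_part \<iota> J u)\<bar>"
      using cmod_le[of "cp l u"] by (simp add: cpair_def)
    moreover have "\<bar>l v\<bar> \<le> (norm l + 1) * (B * norm u)" if "norm v \<le> B * norm u" for v
    proof -
      have "\<bar>l v\<bar> \<le> norm l * norm v" using norm_blinfun[of l v] by simp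
      also have "\<dots> \<le> (norm l + 1) * (B * norm u)" using that by (intro mult_mono) auto
      finally show ?thesis .
    qed
    ultimately have "norm (cp l u) \<le> (norm l + 1) * (B * norm u) + (norm l + 1) * (B * norm u)"
      using B by (smt (verit, best))
    then show ?thesis by (simp add: algebra_simps)
  qed
  moreover have "0 < 2 * (norm l + 1) * B" using B(1) by (simp add: add_nonneg_pos)
  ultimately show ?thesis using that by blast
qed

lemma tendsto_cpair: "(f \<longlongrightarrow> u) F \<Longrightarrow> ((\<lambda>n. cp l (f n)) \<longlongrightarrow> cp l u) F"
proof -
  obtain B where B: "0 < B" "\<And>u. norm (cp l u) \<le> B * norm u" using norm_cpair_le by blast
  have "bounded_linear (cp l)"
    by (rule bounded_linear_intro[where K = B])
      (use B in \<open>auto simp: scaleR_conv_of_real mult.commute\<close>)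
  then show "(f \<longlongrightarrow> u) F \<Longrightarrow> ((\<lambda>n. cp l (f n)) \<longlongrightarrow> cp l u) F"
    by (rule bounded_linear.tendsto)
qed

end

section \<open>Duality, margins and order bounds for the cone and its complexification\<close>

locale complexified_cone = complexified \<iota> J
  for \<iota> :: "'r::banach \<Rightarrow> 'c::complex_banach" and J :: "'c \<Rightarrow> 'c" +
  fixes C :: "'r set"
  assumes real_cone: "real_cone C"
begin

abbreviation CC :: "'c set" where "CC \<equiv> canonical_complexification \<iota> J C"

lemma convex_C: "convex C" and cone_C: "cone C"
  using real_cone by (simp_all only: real_cone_def)

lemma cone_zero [simp]: "0 \<in> C"
proof -
  have "C \<inter> uminus ` C = {0}" using real_cone by (simp only: real_cone_def)
  then show ?thesis by blast
qed

lemma cone_add: "x \<in> C \<Longrightarrow> y \<in> C \<Longrightarrow> x + y \<in> C"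
  using convex_cone[of C] convex_C cone_C by simp

lemma cone_scaleR: "x \<in> C \<Longrightarrow> 0 \<le> r \<Longrightarrow> r *\<^sub>R x \<in> C"
  using cone_C by (simp add: cone_def)

lemma cone_pointed: "x \<in> C \<Longrightarrow> - x \<in> C \<Longrightarrow> x = 0"
proof -
  assume "x \<in> C" "- x \<in> C"
  then have "x \<in> C \<inter> uminus ` C" by (auto intro: image_eqI[of _ _ "- x"])
  moreover have "C \<inter> uminus ` C = {0}" using real_cone by (simp only: real_cone_def)
  ultimately show "x = 0" by blast
qed

lemma cone_nontrivial: "\<exists>x. x \<in> C - {0}"
proof -
  have "C \<noteq> {0}" using real_cone unfolding real_cone_def by blast
  then show ?thesis using cone_zero by blast
qed

lemma dual_cone_nonneg: "l \<in> dual_cone C \<Longrightarrow> x \<in> C \<Longrightarrow> 0 \<le> l x"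
  by (simp add: dual_cone_def)

lemma dual_cone_add: "l \<in> dual_cone C \<Longrightarrow> m \<in> dual_cone C \<Longrightarrow> l + m \<in> dual_cone C"
  and dual_cone_scaleR: "l \<in> dual_cone C \<Longrightarrow> 0 \<le> r \<Longrightarrow> r *\<^sub>R l \<in> dual_cone C"
  by (auto simp: dual_cone_def blinfun.bilinear_simps)

text \<open>Separation gives a negative functional at every point outside the closed cone, so order
  relations can be verified functional by functional.\<close>

lemma bipolar: "(\<And>l. l \<in> dual_cone C \<Longrightarrow> 0 \<le> l x) \<Longrightarrow> x \<in> C"
proof (rule ccontr)
  assume pos: "\<And>l. l \<in> dual_cone C \<Longrightarrow> 0 \<le> blinfun_apply l x" and "x \<notin> C"
  then obtain m where "m \<in> dual_cone C" "blinfun_apply m x < 0"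
    using closed_cone_separation[of C x] real_cone cone_zero unfolding real_cone_def by blast
  then show False using pos[of m] by simp
qed

lemma dual_cone_separates: "(\<And>l. l \<in> dual_cone C \<Longrightarrow> l x = 0) \<Longrightarrow> x = 0"
proof (rule cone_pointed)
  assume *: "\<And>l. l \<in> dual_cone C \<Longrightarrow> blinfun_apply l x = 0"
  show "x \<in> C" by (rule bipolar) (simp add: *)
  show "- x \<in> C" by (rule bipolar) (simp add: * blinfun.minus_right)
qed

lemma dual_cone_pos: "x \<in> C - {0} \<Longrightarrow> \<exists>l\<in>dual_cone C. 0 < l x"
proof (rule ccontr)
  assume x: "x \<in> C - {0}" and "\<not> (\<exists>l\<in>dual_cone C. 0 < blinfun_apply l x)"
  then have "l x = 0" if "l \<in> dual_cone C" for l
    using dual_cone_nonneg[OF that, of x] that by (force simp: not_less)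
  then show False using dual_cone_separates x by blast
qed

lemma cpair_separates: "(\<And>l. l \<in> dual_cone C \<Longrightarrow> cp l u = 0) \<Longrightarrow> u = 0"
proof -
  assume *: "\<And>l. l \<in> dual_cone C \<Longrightarrow> cp l u = 0"
  have "re_part \<iota> J u = 0" "im_part \<iota> J u = 0"
    using * by (auto intro!: dual_cone_separates simp: cpair_def complex_eq_iff)
  then show "u = 0" using re_im_part[of u] by (simp add: iota_0)
qed

lemma CC_D: "u \<in> CC \<Longrightarrow> m \<in> dual_cone C \<Longrightarrow> l \<in> dual_cone C \<Longrightarrow> 0 \<le> Re (cp m u * cnj (cp l u))"
  by (simp add: canonical_complexification_def)

lemma CC_I: "(\<And>m l. m \<in> dual_cone C \<Longrightarrow> l \<in> dual_cone C \<Longrightarrow> 0 \<le> Re (cp m u * cnj (cp l u))) \<Longrightarrow> u \<in> CC"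
  by (simp add: canonical_complexification_def)

lemma Re_complex_of_real_mult: "Re (of_real r * z) = r * Re z"
  by simp

lemma scaled_mult_cnj: "(c * a) * cnj (c * b) = of_real ((norm c)\<^sup>2) * (a * cnj b)"
proof -
  have "(c * a) * cnj (c * b) = (c * cnj c) * (a * cnj b)" by simp
  then show ?thesis by (simp only: complex_norm_square)
qed

lemma CC_scaleC: "u \<in> CC \<Longrightarrow> c *\<^sub>C u \<in> CC"
proof (rule CC_I)
  fix m l assume "u \<in> CC" "m \<in> dual_cone C" "l \<in> dual_cone C"
  then have "0 \<le> (norm c)\<^sup>2 * Re (cp m u * cnj (cp l u))"
    by (intro mult_nonneg_nonneg CC_D) auto
  then show "0 \<le> Re (cp m (c *\<^sub>C u) * cnj (cp l (c *\<^sub>C u)))"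
    by (simp only: cpair_scaleC scaled_mult_cnj Re_complex_of_real_mult)
qed

lemma CC_scaleC_iff: "c \<noteq> 0 \<Longrightarrow> c *\<^sub>C u \<in> CC \<longleftrightarrow> u \<in> CC"
  using CC_scaleC[of u c] CC_scaleC[of "c *\<^sub>C u" "1 / c"] 
  by (simp add: scaleC_scaleC) blast

lemma CC_sequentially_closed:
  assumes "f \<longlonglongrightarrow> u" "\<And>n. f n \<in> CC"
  shows "u \<in> CC"
proof (rule CC_I)
  fix m l assume ml: "m \<in> dual_cone C" "l \<in> dual_cone C"
  have "(\<lambda>n. Re (cp m (f n) * cnj (cp l (f n)))) \<longlonglongrightarrow> Re (cp m u * cnj (cp l u))"
    by (intro tendsto_intros tendsto_cpair assms(1))
  then show "0 \<le> Re (cp m u * cnj (cp l u))"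
    by (rule LIMSEQ_le_const) (use CC_D[OF assms(2)] ml in auto)
qed

text \<open>The real vector x + y is recorded next to x + iy because it bounds all pairings of the
  latter, and its image under \<open>P\<close> is the unit in which margins are measured.\<close>

definition quadrant :: "'r \<Rightarrow> 'c \<Rightarrow> bool" where
  "quadrant w q \<longleftrightarrow> (\<exists>x\<in>C. \<exists>y\<in>C. w = x + y \<and> q = \<iota> x + \<i> *\<^sub>C \<iota> y)"

lemma quadrant_add: "quadrant w q \<Longrightarrow> quadrant w' q' \<Longrightarrow> quadrant (w + w') (q + q')"
proof -
  assume "quadrant w q" "quadrant w' q'"
  then obtain x y x' y' where *: "x \<in> C" "y \<in> C" "w = x + y" "q = \<iota> x + \<i> *\<^sub>C \<iota> y"
    "x' \<in> C" "y' \<in> C" "w' = x' + y'" "q' = \<iota> x' + \<i> *\<^sub>C \<iota> y'"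
    unfolding quadrant_def by metis
  show ?thesis
    unfolding quadrant_def
    by (intro bexI[of _ "x + x'"] bexI[of _ "y + y'"])
      (use * in \<open>auto simp: cone_add iota_add scaleC_add_right\<close>)
qed

lemma quadrant_scaleR: "quadrant w q \<Longrightarrow> 0 \<le> r \<Longrightarrow> quadrant (r *\<^sub>R w) (r *\<^sub>R q)"
proof -
  assume "quadrant w q" and r: "0 \<le> r"
  then obtain x y where *: "x \<in> C" "y \<in> C" "w = x + y" "q = \<iota> x + \<i> *\<^sub>C \<iota> y"
    unfolding quadrant_def by metis
  show ?thesis
    unfolding quadrant_def
    by (intro bexI[of _ "r *\<^sub>R x"] bexI[of _ "r *\<^sub>R y"])
      (use * r in \<open>auto simp: cone_scaleR iota_scaleR scaleR_add_right scaleC_scaleC_real mult.commute\<close>)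
qed

lemma quadrant_cone: "quadrant w q \<Longrightarrow> w \<in> C"
  by (auto simp: quadrant_def cone_add)

lemma norm_cpair_quadrant_le: "quadrant w q \<Longrightarrow> l \<in> dual_cone C \<Longrightarrow> norm (cp l q) \<le> l w"
proof -
  assume "quadrant w q" and l: "l \<in> dual_cone C"
  then obtain x y where *: "x \<in> C" "y \<in> C" "w = x + y" "q = \<iota> x + \<i> *\<^sub>C \<iota> y"
    unfolding quadrant_def by metis
  show ?thesis
    using cmod_le[of "cp l q"] dual_cone_nonneg[OF l *(1)] dual_cone_nonneg[OF l *(2)]
    by (simp only: *(3,4) cpair_eq blinfun.add_right complex.sel)
qed

lemma quadrant_nonzero: "quadrant w q \<Longrightarrow> q \<noteq> 0 \<Longrightarrow> w \<noteq> 0"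
proof
  assume q: "quadrant w q" "q \<noteq> 0" and "w = 0"
  then have "cp l q = 0" if "l \<in> dual_cone C" for l
    using norm_cpair_quadrant_le[OF q(1) that] by simp
  then show False using cpair_separates q(2) by blast
qed

text \<open>The condition defining \<open>CC\<close> says that the values of the dual cone at
  \<open>u\<close> pairwise enclose at most right angles, so one phase moves all of them into the
  first quadrant; by \<open>bipolar\<close> both real components then lie in
  \<open>C\<close>.\<close>

lemma CC_quadrant:
  assumes "u \<in> CC"
  obtains c w q where "norm c = 1" "u = c *\<^sub>C q" "quadrant w q"
proof -
  obtain c where c: "norm c = 1"
    "\<And>z. z \<in> (\<lambda>l. cp l u) ` dual_cone C \<Longrightarrow> 0 \<le> Re (c * z) \<and> 0 \<le> Im (c * z)"
    using quarter_plane[of "(\<lambda>l. cp l u) ` dual_cone C"] CC_D[OF assms] by blast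
  define q where "q = c *\<^sub>C u"
  have "c \<noteq> 0" using c(1) by auto
  have "0 \<le> l (re_part \<iota> J q)" "0 \<le> l (im_part \<iota> J q)" if "l \<in> dual_cone C" for l
  proof -
    have "cp l q = c * cp l u" by (simp add: q_def)
    then have "0 \<le> Re (cp l q)" "0 \<le> Im (cp l q)" using c(2)[of "cp l u"] that by auto
    then show "0 \<le> l (re_part \<iota> J q)" "0 \<le> l (im_part \<iota> J q)" by (simp_all add: cpair_def)
  qed
  then have "quadrant (re_part \<iota> J q + im_part \<iota> J q) q"
    unfolding quadrant_def using re_im_part[of q] by (blast intro: bipolar)
  moreover have "u = inverse c *\<^sub>C q" using \<open>c \<noteq> 0\<close> by (simp add: q_def scaleC_scaleC)
  ultimately show ?thesis using that[of "inverse c"] c(1) by (simp add: norm_inverse)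
qed

lemma iota_CC: "x \<in> C \<Longrightarrow> \<iota> x \<in> CC"
  by (rule CC_I) (simp add: dual_cone_nonneg)

lemma order_interval_cone:
  assumes x: "\<And>l. l \<in> dual_cone C \<Longrightarrow> \<bar>blinfun_apply l x\<bar> \<le> b * l e"
  shows "b *\<^sub>R e + x \<in> C" "b *\<^sub>R e - x \<in> C"
  using x by (auto intro!: bipolar simp: blinfun.bilinear_simps) (smt (verit, best))+

text \<open>The condition defining \<open>CC\<close> with a margin in units of \<open>e\<close>. The
  margin scales quadratically with \<open>u\<close>, whereas the bound in \<open>bounded_by\<close>
  scales linearly.\<close>

definition inside :: "'r \<Rightarrow> real \<Rightarrow> 'c \<Rightarrow> bool" where
  "inside e d u \<longleftrightarrow> (\<forall>m\<in>dual_cone C. \<forall>l\<in>dual_cone C. d * blinfun_apply m e * blinfun_apply l e \<le> Re (cp m u * cnj (cp l u)))"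

text \<open>The order-unit seminorm of \<open>e\<close>, carried over to complex vectors through the
  pairing.\<close>

definition bounded_by :: "'r \<Rightarrow> real \<Rightarrow> 'c \<Rightarrow> bool" where
  "bounded_by e b u \<longleftrightarrow> (\<forall>l\<in>dual_cone C. norm (cp l u) \<le> b * blinfun_apply l e)"

lemma bounded_by_parts:
  assumes "bounded_by e b u" "l \<in> dual_cone C"
  shows "\<bar>l (re_part \<iota> J u)\<bar> \<le> b * l e" "\<bar>l (im_part \<iota> J u)\<bar> \<le> b * l e"
  using assms abs_Re_le_cmod[of "cp l u"] abs_Im_le_cmod[of "cp l u"]
  unfolding bounded_by_def by (force simp: cpair_def intro: order_trans)+

lemma inside_scaleC: "inside e d u \<Longrightarrow> inside e ((norm c)\<^sup>2 * d) (c *\<^sub>C u)"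
  unfolding inside_def cpair_scaleC scaled_mult_cnj Re_complex_of_real_mult
  by (simp add: mult.assoc mult_left_mono)

lemma bounded_by_scaleC: "bounded_by e b u \<Longrightarrow> bounded_by e (norm c * b) (c *\<^sub>C u)"
  by (simp add: bounded_by_def norm_mult mult.assoc mult_left_mono)

lemma bounded_by_add: "bounded_by e b u \<Longrightarrow> bounded_by e b' v \<Longrightarrow> bounded_by e (b + b') (u + v)"
  unfolding bounded_by_def
proof
  fix l assume *: "\<forall>l\<in>dual_cone C. norm (cp l u) \<le> b * blinfun_apply l e"
    "\<forall>l\<in>dual_cone C. norm (cp l v) \<le> b' * blinfun_apply l e" and l: "l \<in> dual_cone C"
  have "norm (cp l (u + v)) \<le> norm (cp l u) + norm (cp l v)"
    by (simp add: norm_triangle_ineq)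
  also have "\<dots> \<le> b * l e + b' * l e" using * l by (intro add_mono) auto
  finally show "norm (cp l (u + v)) \<le> (b + b') * l e" by (simp add: algebra_simps)
qed

lemma bounded_by_minus: "bounded_by e b u \<Longrightarrow> bounded_by e b (- u)"
  by (simp add: bounded_by_def)

lemma inside_CC: "inside e d u \<Longrightarrow> 0 \<le> d \<Longrightarrow> e \<in> C \<Longrightarrow> u \<in> CC"
proof (rule CC_I)
  fix m l assume u: "inside e d u" "0 \<le> d" "e \<in> C" and ml: "m \<in> dual_cone C" "l \<in> dual_cone C"
  then have "0 \<le> d * m e * l e" by (simp add: dual_cone_nonneg)
  also have "\<dots> \<le> Re (cp m u * cnj (cp l u))" using u ml by (simp add: inside_def)
  finally show "0 \<le> Re (cp m u * cnj (cp l u))" .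
qed

lemma inside_norm:
  assumes "inside e d u" "l \<in> dual_cone C" "0 \<le> d"
  shows "sqrt d * l e \<le> norm (cp l u)"
proof -
  have "d * l e * l e \<le> Re (cp l u * cnj (cp l u))" using assms by (simp add: inside_def)
  also have "Re (cp l u * cnj (cp l u)) = (norm (cp l u))\<^sup>2"
    by (simp only: complex_norm_square[symmetric] Re_complex_of_real)
  also have "d * l e * l e = (sqrt d * l e)\<^sup>2"
    using assms(3) by (simp add: power_mult_distrib power2_eq_square[of "l e"])
  finally have "(sqrt d * l e)\<^sup>2 \<le> (norm (cp l u))\<^sup>2" .
  then show ?thesis by (rule power2_le_imp_le) simp
qed

lemma inside_nonzero: "inside e d u \<Longrightarrow> l \<in> dual_cone C \<Longrightarrow> 0 < d \<Longrightarrow> 0 < l e \<Longrightarrow> cp l u \<noteq> 0"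
proof
  assume *: "inside e d u" "l \<in> dual_cone C" "0 < d" "0 < blinfun_apply l e" and "cp l u = 0"
  then have "sqrt d * l e \<le> 0" using inside_norm[of e d u l] by simp
  then show False using * by (simp add: mult_le_0_iff)
qed

lemma small_perturbation:
  fixes b d :: real
  assumes "0 \<le> b" "0 < d"
  obtains \<epsilon> where "0 < \<epsilon>" "0 \<le> d - 2 * b * \<epsilon> - \<epsilon>\<^sup>2"
proof -
  define \<epsilon> where "\<epsilon> = min 1 (d / (2 * b + 1))"
  have "0 < d / (2 * b + 1)" using assms by (intro divide_pos_pos) auto
  then have \<epsilon>: "0 < \<epsilon>" "\<epsilon> \<le> 1" "\<epsilon> \<le> d / (2 * b + 1)" by (auto simp: \<epsilon>_def)
  have "\<epsilon> * (2 * b + 1) \<le> d" using \<epsilon>(3) assms by (simp add: pos_le_divide_eq)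
  moreover have "\<epsilon>\<^sup>2 \<le> \<epsilon>" using \<epsilon> by (simp add: power2_eq_square mult_left_le)
  ultimately have "0 \<le> d - 2 * b * \<epsilon> - \<epsilon>\<^sup>2" by (simp add: algebra_simps)
  then show ?thesis using that \<epsilon>(1) by blast
qed

text \<open>When the form is expanded at u + v, each mixed term costs at most b\<epsilon> and the
  last one \<epsilon>^2, in units of m(e) l(e).\<close>

lemma inside_perturb:
  assumes u: "inside e d u" "bounded_by e b u" and v: "bounded_by e \<epsilon> v"
    and e: "e \<in> C" and d': "d' \<le> d - 2 * b * \<epsilon> - \<epsilon>\<^sup>2"
  shows "inside e d' (u + v)"
  unfolding inside_def
proof (intro ballI)
  fix m l assume ml: "m \<in> dual_cone C" "l \<in> dual_cone C"
  have bound: "- (s * t * (m e * l e)) \<le> Re (a * cnj b)"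
    if "norm a \<le> s * m e" "norm b \<le> t * l e" for a b s t
  proof -
    have "norm (a * cnj b) \<le> (s * m e) * (t * l e)"
      unfolding norm_mult complex_mod_cnj
      by (intro mult_mono that) (use order_trans[OF norm_ge_zero that(1)] in auto)
    then show ?thesis
      using abs_Re_le_cmod[of "a * cnj b"] by (simp add: algebra_simps)
  qed
  have "- (b * \<epsilon> * (m e * l e)) \<le> Re (cp m u * cnj (cp l v))"
    "- (\<epsilon> * b * (m e * l e)) \<le> Re (cp m v * cnj (cp l u))"
    "- (\<epsilon> * \<epsilon> * (m e * l e)) \<le> Re (cp m v * cnj (cp l v))"
    by (rule bound; use u(2) v ml in \<open>simp add: bounded_by_def\<close>)+
  moreover have "d * m e * l e \<le> Re (cp m u * cnj (cp l u))"
    using u(1) ml by (simp add: inside_def)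
  moreover have "d' * (m e * l e) \<le> (d - 2 * b * \<epsilon> - \<epsilon>\<^sup>2) * (m e * l e)"
    by (intro mult_right_mono d' mult_nonneg_nonneg dual_cone_nonneg ml e)
  moreover have "(d - 2 * b * \<epsilon> - \<epsilon>\<^sup>2) * (m e * l e) =
    d * m e * l e + - (b * \<epsilon> * (m e * l e)) + - (\<epsilon> * b * (m e * l e)) + - (\<epsilon> * \<epsilon> * (m e * l e))"
    by (simp add: algebra_simps power2_eq_square)
  moreover have "Re (cp m (u + v) * cnj (cp l (u + v))) = Re (cp m u * cnj (cp l u)) +
    Re (cp m u * cnj (cp l v)) + Re (cp m v * cnj (cp l u)) + Re (cp m v * cnj (cp l v))"
    by (simp add: algebra_simps)
  ultimately have "d' * (m e * l e) \<le> Re (cp m (u + v) * cnj (cp l (u + v)))"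
    by linarith
  then show "d' * m e * l e \<le> Re (cp m (u + v) * cnj (cp l (u + v)))"
    by (simp only: mult.assoc)
qed

lemma inside_weaken:
  assumes u: "inside e d u" and le: "\<And>l. l \<in> dual_cone C \<Longrightarrow> s * l e' \<le> l e"
    and "0 \<le> d" "0 \<le> s" "e' \<in> C"
  shows "inside e' (d * s\<^sup>2) u"
  unfolding inside_def
proof (intro ballI)
  fix m l assume ml: "m \<in> dual_cone C" "l \<in> dual_cone C"
  have "(s * m e') * (s * l e') \<le> m e * l e"
  proof (intro mult_mono le ml)
    have "0 \<le> s * m e'" using ml assms by (simp add: dual_cone_nonneg)
    then show "0 \<le> m e" using le[OF ml(1)] by linarith
    show "0 \<le> s * l e'" using ml assms by (simp add: dual_cone_nonneg)
  qed
  then have "d * ((s * m e') * (s * l e')) \<le> d * (m e * l e)"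
    using \<open>0 \<le> d\<close> by (rule mult_left_mono)
  also have "\<dots> \<le> Re (cp m u * cnj (cp l u))"
    using u ml by (simp add: inside_def mult.assoc)
  finally show "d * s\<^sup>2 * m e' * l e' \<le> Re (cp m u * cnj (cp l u))"
    by (simp add: power2_eq_square algebra_simps)
qed

text \<open>A finite Hilbert distance gives y \<le> ax and x \<le> by in the order of
  \<open>C\<close> with ab \<le> exp r. Only the product is controlled, so the two inequalities,
  tested on l and m, are multiplied; the result bounds a cross ratio.\<close>

lemma cone_comparable:
  assumes xy: "x \<in> C - {0}" "y \<in> C - {0}" and d: "hilbert_dist C x y \<le> ereal r"
    and ml: "m \<in> dual_cone C" "l \<in> dual_cone C"
  shows "m x * l y \<le> exp r * (m y * l x)"
proof -
  have beta: "\<exists>b. hilbert_beta C x y = b \<and> 0 < b \<and> (b \<noteq> \<infinity> \<longrightarrow> (\<forall>m\<in>dual_cone C. m y \<le> real_of_ereal b * m x))"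
    if x: "x \<in> C - {0}" and y: "y \<in> C - {0}" for x y
  proof -
    let ?A = "{t. 0 < t \<and> t *\<^sub>R x - y \<in> C}"
    obtain k where k: "k \<in> dual_cone C" "0 < k y" using dual_cone_pos[OF y] by blast
    have le: "m y \<le> t * m x" if "t \<in> ?A" "m \<in> dual_cone C" for t m
      using dual_cone_nonneg[OF that(2), of "t *\<^sub>R x - y"] that(1)
      by (simp add: blinfun.bilinear_simps)
    have kx: "0 < k x" if "t \<in> ?A" for t
    proof -
      have "0 < t * k x" using le[OF that k(1)] k(2) by simp
      then show ?thesis using that by (simp add: zero_less_mult_iff)
    qed
    \<comment> \<open>Positivity matters because 0 times \<infinity> is 0 in \<open>ereal\<close>:
      without it, a bound on the product would not make both factors finite.\<close>
    have "0 < hilbert_beta C x y"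
    proof (cases "?A = {}")
      case True
      then show ?thesis unfolding hilbert_beta_def by (simp only: True image_empty) (simp add: top_ereal_def)
    next
      case False
      then have pos: "0 < k x" using kx by blast
      have "ereal (k y / k x) \<le> hilbert_beta C x y"
        unfolding hilbert_beta_def
        by (rule Inf_greatest) (use le k(1) pos in \<open>auto simp: pos_divide_le_eq\<close>)
      moreover have "0 < ereal (k y / k x)" using k(2) pos by simp
      ultimately show ?thesis by (rule less_le_trans[rotated])
    qed
    moreover have "m y \<le> real_of_ereal (hilbert_beta C x y) * m x"
      if fin: "hilbert_beta C x y \<noteq> \<infinity>" and m: "m \<in> dual_cone C" for m
    proof -
      have "?A \<noteq> {}"
      proof
        assume "?A = {}"
        then show False
          using fin unfolding hilbert_beta_def by (simp only: image_empty Inf_empty top_ereal_def)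
      qed
      \<comment> \<open>Where m(x) = 0 no quotient can be formed, but a single admissible t already
        forces m(y) \<le> 0.\<close>
      show ?thesis
      proof (cases "m x = 0")
        case True
        then show ?thesis using le[OF _ m] \<open>?A \<noteq> {}\<close> by fastforce
      next
        case False
        then have mx: "0 < m x" using dual_cone_nonneg[OF m, of x] x by simp
        have "ereal (m y / m x) \<le> hilbert_beta C x y"
          unfolding hilbert_beta_def
          by (rule Inf_greatest) (use le m mx in \<open>auto simp: pos_divide_le_eq\<close>)
        then have "m y / m x \<le> real_of_ereal (hilbert_beta C x y)"
          using fin by (cases "hilbert_beta C x y") auto
        then show ?thesis using mx by (simp add: pos_divide_le_eq)
      qed
    qed
    ultimately show ?thesis by blast
  qed
  obtain a where a: "hilbert_beta C x y = a" "0 < a"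
    "a \<noteq> \<infinity> \<longrightarrow> (\<forall>m\<in>dual_cone C. m y \<le> real_of_ereal a * m x)"
    using beta[OF xy] by blast
  obtain b where b: "hilbert_beta C y x = b" "0 < b"
    "b \<noteq> \<infinity> \<longrightarrow> (\<forall>m\<in>dual_cone C. m x \<le> real_of_ereal b * m y)"
    using beta[OF xy(2,1)] by blast
  have log: "log_ereal (a * b) \<le> ereal r" using d a(1) b(1) by (simp add: hilbert_dist_def)
  have "a \<noteq> \<infinity>" "b \<noteq> \<infinity>"
    using log a(2) b(2) by (auto simp: log_ereal_def)
  then obtain a' b' where ab: "a = ereal a'" "b = ereal b'" "0 < a'" "0 < b'"
    using a(2) b(2) by (cases a; cases b) auto
  have "ln (a' * b') \<le> r" using log ab by (simp add: log_ereal_def)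
  then have "a' * b' \<le> exp r" using ab by (metis exp_le_cancel_iff exp_ln mult_pos_pos)
  have nn: "0 \<le> m x" "0 \<le> m y" "0 \<le> l x" "0 \<le> l y" using dual_cone_nonneg ml xy by auto
  have "m x \<le> b' * m y" "l y \<le> a' * l x" using a(3) b(3) ml ab by auto
  then have "m x * l y \<le> (b' * m y) * (a' * l x)" using nn ab by (intro mult_mono) auto
  also have "\<dots> = (a' * b') * (m y * l x)" by simp
  also have "\<dots> \<le> exp r * (m y * l x)" using \<open>a' * b' \<le> exp r\<close> nn by (intro mult_right_mono) auto
  finally show ?thesis .
qed

end

section \<open>Dominated operators\<close>

locale dominated_operator = complexified_cone \<iota> J C
  for \<iota> :: "'r::banach \<Rightarrow> 'c::complex_banach" and J :: "'c \<Rightarrow> 'c" and C :: "'r set" +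
  fixes P :: "'r \<Rightarrow> 'r" and M :: "'c \<Rightarrow> 'c" and \<alpha> \<beta> \<gamma> \<Delta> :: real
  assumes P_linear: "linear P" and P_cone: "P ` (C - {0}) \<subseteq> C - {0}"
    and P_diam: "\<And>x y. x \<in> C - {0} \<Longrightarrow> y \<in> C - {0} \<Longrightarrow> hilbert_dist C (P x) (P y) \<le> ereal \<Delta>"
    and M_clinear: "bounded_clinear M"
    and dominated: "dominated \<iota> J C M P \<gamma> \<alpha> \<beta>"
    and gap: "\<gamma> * cosh (\<Delta> / 2) < \<alpha>"
begin

lemmas P_add = linear_add[OF P_linear] and P_scaleR = linear_scale[OF P_linear]
  and P_0 = linear_0[OF P_linear] and P_diff = linear_diff[OF P_linear]
  and M_add = bounded_clinear_add[OF M_clinear] and M_diff = bounded_clinear_diff[OF M_clinear]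
  and M_scaleC = bounded_clinear_scaleC[OF M_clinear] and M_scaleR = bounded_clinear_scaleR[OF M_clinear]
  and M_0 = bounded_clinear_0[OF M_clinear]

lemma P_nonzero: "x \<in> C - {0} \<Longrightarrow> P x \<in> C - {0}"
  using P_cone by blast

lemma P_in: "x \<in> C \<Longrightarrow> P x \<in> C"
  using P_nonzero[of x] P_0 by (cases "x = 0") auto

lemma constants: "0 \<le> \<gamma>" "\<gamma> < \<alpha>" "\<alpha> \<le> \<beta>" "0 < \<alpha>" "0 < \<beta>"
  using dominated by (auto simp: dominated_def)

lemma domination_facts:
  "\<forall>l1\<in>dual_cone C. \<forall>l2\<in>dual_cone C. \<forall>x\<in>C. Re (cp l1 (M (\<iota> x)) * cnj (cp l2 (M (\<iota> x))))
    \<ge> \<alpha> * blinfun_apply l1 (P x) * blinfun_apply l2 (P x)"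
  "\<forall>l\<in>dual_cone C. \<forall>x\<in>C. Re (cp l (M (\<iota> x)) * cnj (cp l (M (\<iota> x))))
    \<le> \<beta> * blinfun_apply l (P x) * blinfun_apply l (P x)"
  "\<forall>l1\<in>dual_cone C. \<forall>l2\<in>dual_cone C. \<forall>x1\<in>C. \<forall>x2\<in>C.
    \<bar>Im (cp l1 (M (\<iota> x1)) * cnj (cp l2 (M (\<iota> x2))))\<bar>
      \<le> \<gamma> * blinfun_apply l1 (P x1) * blinfun_apply l2 (P x2)"
  using dominated unfolding dominated_def cpair_conj_op by - (elim conjE, assumption)+

lemma domination_lower:
  "l1 \<in> dual_cone C \<Longrightarrow> l2 \<in> dual_cone C \<Longrightarrow> x \<in> C \<Longrightarrow>
    \<alpha> * l1 (P x) * l2 (P x) \<le> Re (cp l1 (M (\<iota> x)) * cnj (cp l2 (M (\<iota> x))))"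
  using domination_facts(1) by simp

lemma domination_upper:
  assumes "l \<in> dual_cone C" "x \<in> C"
  shows "norm (cp l (M (\<iota> x))) \<le> sqrt \<beta> * l (P x)"
proof (rule power2_le_imp_le)
  have "Re (cp l (M (\<iota> x)) * cnj (cp l (M (\<iota> x)))) \<le> \<beta> * l (P x) * l (P x)"
    using domination_facts(2) assms by simp
  then have "(norm (cp l (M (\<iota> x))))\<^sup>2 \<le> \<beta> * l (P x) * l (P x)"
    by (simp only: complex_norm_square[symmetric] Re_complex_of_real)
  also have "\<dots> = (sqrt \<beta> * l (P x))\<^sup>2"
    using constants by (simp add: power_mult_distrib power2_eq_square[of "l (P x)"])
  finally show "(norm (cp l (M (\<iota> x))))\<^sup>2 \<le> (sqrt \<beta> * l (P x))\<^sup>2" .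
qed (use constants assms in \<open>simp add: dual_cone_nonneg P_in\<close>)

lemma domination_imaginary:
  "l1 \<in> dual_cone C \<Longrightarrow> l2 \<in> dual_cone C \<Longrightarrow> x1 \<in> C \<Longrightarrow> x2 \<in> C \<Longrightarrow>
    \<bar>Im (cp l1 (M (\<iota> x1)) * cnj (cp l2 (M (\<iota> x2))))\<bar> \<le> \<gamma> * l1 (P x1) * l2 (P x2)"
  using domination_facts(3) by simp

definition D :: real where "D = exp \<Delta>"

lemma cross_ratio:
  assumes "x \<in> C" "y \<in> C" "m \<in> dual_cone C" "l \<in> dual_cone C"
  shows "m (P x) * l (P y) \<le> D * (m (P y) * l (P x))"
proof (cases "x = 0 \<or> y = 0")
  case True
  then show ?thesis by (auto simp: P_0)
next
  case False
  then show ?thesis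
    unfolding D_def using assms
    by (intro cone_comparable P_nonzero P_diam) auto
qed

lemma D_pos: "0 < D" by (simp add: D_def)

text \<open>If l vanished at P(y), the cross-ratio bound against a functional that is positive at
  P(y) would make l vanish at P(x) too.\<close>

lemma dual_pos_everywhere:
  assumes "l \<in> dual_cone C" "x \<in> C" "0 < l (P x)" "y \<in> C - {0}"
  shows "0 < l (P y)"
proof (rule ccontr)
  assume "\<not> 0 < l (P y)"
  then have l0: "l (P y) = 0" using dual_cone_nonneg[OF assms(1) P_in[of y]] assms(4) by simp
  obtain m where m: "m \<in> dual_cone C" "0 < m (P y)" using dual_cone_pos[OF P_nonzero[OF assms(4)]] by blast
  have "l (P x) * m (P y) \<le> 0"
    using cross_ratio[of x y l m] assms m l0 by simp
  then show False using assms(3) m(2) by (simp add: mult_le_0_iff)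
qed

text \<open>With S = ac + bd and T = ad + bc \<le> cosh(\<Delta>/2) S, this constant gives \<alpha>S
  - \<gamma>T \<ge> \<delta>(S + T), and S + T = (a + b)(c + d) is the product of the two
  functionals at P(x + y).\<close>

definition \<delta> :: real where "\<delta> = (\<alpha> - \<gamma> * cosh (\<Delta> / 2)) / (1 + cosh (\<Delta> / 2))"

lemma delta_pos: "0 < \<delta>"
  using gap by (simp add: \<delta>_def add_pos_pos)

text \<open>For A = ad and B = bc the ratio A/B lies between 1/D and D, so A + B is at most 2
  cosh(\<Delta>/2) sqrt(AB). The arithmetic-geometric mean inequality for ac and bd, whose product
  is again AB, finishes. Working with squares avoids roots and division by zero.\<close>

lemma four_point_bound:
  fixes a b c d :: real
  assumes nn: "0 \<le> a" "0 \<le> b" "0 \<le> c" "0 \<le> d"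
    and ratio: "a * d \<le> D * (b * c)" "b * c \<le> D * (a * d)"
  shows "a * d + b * c \<le> cosh (\<Delta> / 2) * (a * c + b * d)"
proof -
  define A B where "A = a * d" and "B = b * c"
  have AB: "0 \<le> A" "0 \<le> B" "A \<le> D * B" "B \<le> D * A" using assms by (auto simp: A_def B_def)
  have cosh: "4 * (cosh (\<Delta> / 2))\<^sup>2 * D = D\<^sup>2 + 2 * D + 1"
  proof -
    define s where "s = exp (\<Delta> / 2)"
    have s: "s \<noteq> 0" "D = s\<^sup>2" by (simp_all add: s_def D_def power2_eq_square flip: exp_add)
    have "cosh (\<Delta> / 2) = (s + 1 / s) / 2" by (simp add: cosh_def s_def exp_minus inverse_eq_divide)
    then have "2 * cosh (\<Delta> / 2) * s = s\<^sup>2 + 1" using s(1) by (simp add: field_simps power2_eq_square)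
    then have "(2 * cosh (\<Delta> / 2) * s)\<^sup>2 = (s\<^sup>2 + 1)\<^sup>2" by simp
    then show ?thesis by (simp add: s(2) power_mult_distrib power2_sum)
  qed
  \<comment> \<open>The two ratio conditions in one inequality: D(A^2 + B^2) \<le> (D^2 +
    1)AB.\<close>
  have "(A - D * B) * (D * A - B) \<le> 0" using AB by (simp add: mult_nonpos_nonneg)
  then have "D * (A + B)\<^sup>2 \<le> (D\<^sup>2 + 2 * D + 1) * (A * B)"
    by (simp add: power2_eq_square algebra_simps)
  also have "\<dots> = D * (4 * (cosh (\<Delta> / 2))\<^sup>2 * (A * B))" using cosh by (simp add: algebra_simps)
  finally have "(A + B)\<^sup>2 \<le> (cosh (\<Delta> / 2))\<^sup>2 * (4 * (A * B))" using D_pos by (simp add: algebra_simps)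
  also have "4 * (A * B) \<le> (a * c + b * d)\<^sup>2"
    using zero_le_power2[of "a * c - b * d"] by (simp add: A_def B_def power2_eq_square algebra_simps)
  finally have "(A + B)\<^sup>2 \<le> (cosh (\<Delta> / 2) * (a * c + b * d))\<^sup>2"
    by (simp add: power_mult_distrib)
  then have "A + B \<le> cosh (\<Delta> / 2) * (a * c + b * d)"
    by (rule power2_le_imp_le) (use nn in simp)
  then show ?thesis by (simp add: A_def B_def)
qed

lemma M_quadrant:
  assumes q: "quadrant w q"
  shows "inside (P w) \<delta> (M q)" and "bounded_by (P w) (sqrt \<beta>) (M q)"
proof -
  obtain x y where xy: "x \<in> C" "y \<in> C" "w = x + y" "q = \<iota> x + \<i> *\<^sub>C \<iota> y"
    using q unfolding quadrant_def by blast
  have Mq: "cp l (M q) = cp l (M (\<iota> x)) + \<i> * cp l (M (\<iota> y))" for l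
    by (simp add: xy(4) M_add M_scaleC)
  show "inside (P w) \<delta> (M q)"
    unfolding inside_def
  proof (intro ballI)
    fix m l assume ml: "m \<in> dual_cone C" "l \<in> dual_cone C"
    define a b c d where "a = m (P x)" and "b = m (P y)" and "c = l (P x)" and "d = l (P y)"
    have nn: "0 \<le> a" "0 \<le> b" "0 \<le> c" "0 \<le> d"
      using ml xy by (auto simp: a_def b_def c_def d_def dual_cone_nonneg P_in)
    have four: "a * d + b * c \<le> cosh (\<Delta> / 2) * (a * c + b * d)"
      using cross_ratio[of x y m l] cross_ratio[of y x m l] ml xy nn
      by (intro four_point_bound) (auto simp: a_def b_def c_def d_def)
    \<comment> \<open>The factor i turns the cross terms into imaginary parts, which the third
      domination inequality controls.\<close>
    have "Re (cp m (M q) * cnj (cp l (M q))) =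
        Re (cp m (M (\<iota> x)) * cnj (cp l (M (\<iota> x)))) + Re (cp m (M (\<iota> y)) * cnj (cp l (M (\<iota> y))))
        + Im (cp m (M (\<iota> x)) * cnj (cp l (M (\<iota> y)))) - Im (cp m (M (\<iota> y)) * cnj (cp l (M (\<iota> x))))"
      by (simp add: Mq algebra_simps)
    moreover have "\<alpha> * a * c \<le> Re (cp m (M (\<iota> x)) * cnj (cp l (M (\<iota> x))))"
      "\<alpha> * b * d \<le> Re (cp m (M (\<iota> y)) * cnj (cp l (M (\<iota> y))))"
      using domination_lower ml xy by (auto simp: a_def b_def c_def d_def)
    moreover have "\<bar>Im (cp m (M (\<iota> x)) * cnj (cp l (M (\<iota> y))))\<bar> \<le> \<gamma> * a * d"
      "\<bar>Im (cp m (M (\<iota> y)) * cnj (cp l (M (\<iota> x))))\<bar> \<le> \<gamma> * b * c"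
      using domination_imaginary ml xy unfolding a_def b_def c_def d_def by blast+
    ultimately have "\<alpha> * a * c + \<alpha> * b * d - \<gamma> * a * d - \<gamma> * b * c \<le> Re (cp m (M q) * cnj (cp l (M q)))"
      by linarith
    moreover have "\<gamma> * (a * d + b * c) \<le> \<gamma> * (cosh (\<Delta> / 2) * (a * c + b * d))"
      using four constants by (intro mult_left_mono) auto
    moreover have "\<alpha> * (a * c + b * d) - \<gamma> * (cosh (\<Delta> / 2) * (a * c + b * d))
        = \<delta> * ((1 + cosh (\<Delta> / 2)) * (a * c + b * d))"
    proof -
      have "1 + cosh (\<Delta> / 2) \<noteq> 0" by (smt (verit) cosh_real_pos)
      then have "\<delta> * (1 + cosh (\<Delta> / 2)) = \<alpha> - \<gamma> * cosh (\<Delta> / 2)" by (simp add: \<delta>_def)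
      then show ?thesis by (metis (no_types, opaque_lifting) left_diff_distrib mult.assoc)
    qed
    moreover have "\<delta> * ((a + b) * (c + d)) \<le> \<delta> * ((1 + cosh (\<Delta> / 2)) * (a * c + b * d))"
      using four delta_pos by (intro mult_left_mono) (auto simp: algebra_simps)
    ultimately have "\<delta> * ((a + b) * (c + d)) \<le> Re (cp m (M q) * cnj (cp l (M q)))"
      by (simp add: algebra_simps)
    then show "\<delta> * m (P w) * l (P w) \<le> Re (cp m (M q) * cnj (cp l (M q)))"
      by (simp add: xy(3) P_add blinfun.add_right a_def b_def c_def d_def mult.assoc)
  qed
  show "bounded_by (P w) (sqrt \<beta>) (M q)"
    unfolding bounded_by_def
  proof
    fix l assume l: "l \<in> dual_cone C"
    have "norm (cp l (M q)) \<le> norm (cp l (M (\<iota> x))) + norm (cp l (M (\<iota> y)))"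
      unfolding Mq using norm_triangle_ineq[of "cp l (M (\<iota> x))" "\<i> * cp l (M (\<iota> y))"] by (simp add: norm_mult)
    also have "\<dots> \<le> sqrt \<beta> * l (P x) + sqrt \<beta> * l (P y)"
      using l xy by (intro add_mono domination_upper)
    finally show "norm (cp l (M q)) \<le> sqrt \<beta> * l (P w)"
      by (simp add: xy(3) P_add blinfun.add_right algebra_simps)
  qed
qed

lemma M_CC:
  assumes u: "u \<in> CC - {0}"
  obtains w where "w \<in> C - {0}" "\<And>l. l \<in> dual_cone C \<Longrightarrow> norm (cp l u) \<le> l w"
    "inside (P w) \<delta> (M u)" "bounded_by (P w) (sqrt \<beta>) (M u)"
proof -
  obtain c w q where q: "norm c = 1" "u = c *\<^sub>C q" "quadrant w q"
    using CC_quadrant u by (metis DiffD1)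
  have "w \<in> C - {0}" using quadrant_cone[OF q(3)] quadrant_nonzero[OF q(3)] u q(2) by auto
  moreover have "norm (cp l u) \<le> l w" if "l \<in> dual_cone C" for l
    using norm_cpair_quadrant_le[OF q(3) that] q(1) by (simp add: q(2) norm_mult)
  moreover have "inside (P w) \<delta> (M u)" "bounded_by (P w) (sqrt \<beta>) (M u)"
    using inside_scaleC[OF M_quadrant(1)[OF q(3)], of c] bounded_by_scaleC[OF M_quadrant(2)[OF q(3)], of c] q(1)
    by (simp_all add: q(2) M_scaleC)
  ultimately show ?thesis using that by blast
qed

text \<open>These functionals have no zero on the image of \<open>CC - {0}\<close> under
  \<open>M\<close>, so they may be divided by; all other members of the dual cone vanish identically
  on the image of \<open>CC\<close>.\<close>

definition relevant :: "('r \<Rightarrow>\<^sub>L real) \<Rightarrow> bool" where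
  "relevant l \<longleftrightarrow> l \<in> dual_cone C \<and> (\<forall>x\<in>C - {0}. 0 < blinfun_apply l (P x))"

lemma relevant_dual: "relevant l \<Longrightarrow> l \<in> dual_cone C"
  by (simp add: relevant_def)

lemma ex_relevant: "\<exists>l. relevant l"
proof -
  obtain x where x: "x \<in> C - {0}" using cone_nontrivial by blast
  obtain l where l: "l \<in> dual_cone C" "0 < l (P x)" using dual_cone_pos[OF P_nonzero[OF x]] by blast
  then show ?thesis using dual_pos_everywhere x unfolding relevant_def by blast
qed

lemma relevant_M_nonzero:
  assumes "relevant l" "u \<in> CC - {0}"
  shows "cp l (M u) \<noteq> 0"
proof -
  obtain w where w: "w \<in> C - {0}" "inside (P w) \<delta> (M u)" using M_CC[OF assms(2)] by metis
  show ?thesis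
    using inside_nonzero[OF w(2) _ delta_pos, of l] assms(1) w(1) by (simp add: relevant_def)
qed

lemma irrelevant_M_zero:
  assumes "l \<in> dual_cone C" "\<not> relevant l" "u \<in> CC"
  shows "cp l (M u) = 0"
proof (cases "u = 0")
  case False
  then obtain w where w: "w \<in> C - {0}" "bounded_by (P w) (sqrt \<beta>) (M u)"
    using M_CC[of u] assms(3) by (metis DiffI singletonD)
  have "\<not> 0 < l (P w)"
    using assms(1,2) dual_pos_everywhere[OF assms(1), of w] w(1) by (auto simp: relevant_def)
  then have "l (P w) = 0" using dual_cone_nonneg[OF assms(1) P_in[of w]] w(1) by simp
  then show ?thesis using w(2) assms(1) by (force simp: bounded_by_def)
qed (simp add: M_0)

lemma M_invariant:
  assumes u: "u \<in> CC - {0}"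
  shows "M u \<in> CC - {0}"
proof -
  obtain w where w: "w \<in> C - {0}" "inside (P w) \<delta> (M u)" using M_CC[OF u] by metis
  have "M u \<in> CC" using inside_CC[OF w(2)] delta_pos P_in w(1) by simp
  moreover obtain l where "relevant l" using ex_relevant by blast
  then have "M u \<noteq> 0" using relevant_M_nonzero[OF _ u] cpair_0 by metis
  ultimately show ?thesis by simp
qed

lemma M_power_invariant: "u \<in> CC - {0} \<Longrightarrow> (M ^^ n) u \<in> CC - {0}"
  by (induction n) (use M_invariant in auto)

text \<open>Any two points of the image of the cone are joined, up to scaling, by a holomorphic disk in the
  cone on which they sit at a hyperbolic distance that does not depend on them.\<close>

definition disk_through :: "real \<Rightarrow> 'c \<Rightarrow> 'c \<Rightarrow> (complex \<Rightarrow> complex) \<Rightarrow> (complex \<Rightarrow> complex) \<Rightarrow> bool" where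
  "disk_through k X Y a b \<longleftrightarrow>
     a holomorphic_on ball 0 1 \<and> b holomorphic_on ball 0 1 \<and>
     a (of_real k) \<noteq> 0 \<and> b (of_real k) = 0 \<and> a (- of_real k) = 0 \<and> b (- of_real k) \<noteq> 0 \<and>
     (\<exists>e\<in>C - {0}. \<exists>d>0. (\<exists>s. bounded_by (P e) s X) \<and> (\<exists>s. bounded_by (P e) s Y) \<and>
       (\<forall>z. norm z < 1 \<longrightarrow> inside (P e) d (a z *\<^sub>C X + b z *\<^sub>C Y)))"

text \<open>At z = \<tau> the combination is the image of a quadrant element and has margin
  \<delta>; moving z off the segment perturbs it by a multiple of M(q1 - q2), which uses up at most
  half of that margin.\<close>

lemma inside_near_segment:
  assumes q: "quadrant w1 q1" "quadrant w2 q2"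
    and ratio: "\<And>l. l \<in> dual_cone C \<Longrightarrow> l (P w1) \<le> D * l (P w2)" "\<And>l. l \<in> dual_cone C \<Longrightarrow> l (P w2) \<le> D * l (P w1)"
    and \<epsilon>: "0 \<le> \<epsilon>" "2 * sqrt \<beta> * \<epsilon> + \<epsilon>\<^sup>2 \<le> \<delta> / 2"
    and \<tau>: "\<tau> \<in> {-1..1}" "norm (z - of_real \<tau>) * (sqrt \<beta> * (1 + D)) \<le> 2 * \<epsilon>"
  shows "inside (P (w1 + w2)) (\<delta> / 2 * (2 / (1 + D))\<^sup>2) ((1 + z) *\<^sub>C M q1 + (1 - z) *\<^sub>C M q2)"
proof -
  define w where "w = (1 + \<tau>) *\<^sub>R w1 + (1 - \<tau>) *\<^sub>R w2"
  define q where "q = (1 + \<tau>) *\<^sub>R q1 + (1 - \<tau>) *\<^sub>R q2"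
  have wq: "quadrant w q"
    unfolding w_def q_def using \<tau>(1) by (intro quadrant_add quadrant_scaleR q) auto
  have w12: "w1 \<in> C" "w2 \<in> C" using q quadrant_cone by auto
  \<comment> \<open>Replaces the unit P(w), which moves with \<tau>, by the fixed unit P(w1 + w2).
    The worst case is an endpoint, where one of the two comparable vectors is absent.\<close>
  have le: "2 / (1 + D) * l (P (w1 + w2)) \<le> l (P w)" if l: "l \<in> dual_cone C" for l
  proof -
    have "(1 + \<tau>) * (l (P w1) + l (P w2)) \<le> (1 + \<tau>) * (l (P w1) + D * l (P w1))"
      "(1 - \<tau>) * (l (P w1) + l (P w2)) \<le> (1 - \<tau>) * (D * l (P w2) + l (P w2))"
      using \<tau>(1) ratio[OF l] by (auto intro!: mult_left_mono)
    then have "2 * (l (P w1) + l (P w2)) \<le> (1 + D) * ((1 + \<tau>) * l (P w1) + (1 - \<tau>) * l (P w2))"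
      by (simp add: algebra_simps)
    moreover have "l (P w) = (1 + \<tau>) * l (P w1) + (1 - \<tau>) * l (P w2)"
      by (simp only: w_def P_add P_scaleR blinfun.add_right blinfun.scaleR_right real_scaleR_def)
    ultimately show ?thesis
      using D_pos by (simp add: P_add blinfun.add_right pos_divide_le_eq mult.commute)
  qed
  have "bounded_by (P w) \<epsilon> ((z - of_real \<tau>) *\<^sub>C (M q1 - M q2))"
    unfolding bounded_by_def
  proof
    fix l assume l: "l \<in> dual_cone C"
    have "norm (cp l (M q1 - M q2)) \<le> sqrt \<beta> * l (P w1) + sqrt \<beta> * l (P w2)"
      using M_quadrant(2)[OF q(1)] M_quadrant(2)[OF q(2)] l norm_triangle_ineq4[of "cp l (M q1)" "cp l (M q2)"]
      unfolding bounded_by_def by (smt (verit, best) cpair_diff)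
    then have "norm (cp l ((z - of_real \<tau>) *\<^sub>C (M q1 - M q2))) \<le>
        norm (z - of_real \<tau>) * (sqrt \<beta> * l (P w1) + sqrt \<beta> * l (P w2))"
      unfolding cpair_scaleC norm_mult by (intro mult_left_mono) auto
    also have "\<dots> = (norm (z - of_real \<tau>) * (sqrt \<beta> * (1 + D))) * (l (P (w1 + w2)) / (1 + D))"
      using D_pos by (simp add: P_add blinfun.bilinear_simps field_simps)
    also have "\<dots> \<le> (2 * \<epsilon>) * (l (P (w1 + w2)) / (1 + D))"
      using \<tau>(2) D_pos dual_cone_nonneg[OF l P_in[OF cone_add[OF w12]]] by (intro mult_right_mono) auto
    also have "\<dots> = \<epsilon> * (2 / (1 + D) * l (P (w1 + w2)))" by simp
    also have "\<dots> \<le> \<epsilon> * l (P w)" using le[OF l] \<epsilon>(1) by (rule mult_left_mono)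
    finally show "norm (cp l ((z - of_real \<tau>) *\<^sub>C (M q1 - M q2))) \<le> \<epsilon> * l (P w)" .
  qed
  then have "inside (P w) (\<delta> / 2) (M q + (z - of_real \<tau>) *\<^sub>C (M q1 - M q2))"
    by (rule inside_perturb[OF M_quadrant[OF wq]]) (use \<epsilon>(2) P_in quadrant_cone[OF wq] in auto)
  moreover have "M q + (z - of_real \<tau>) *\<^sub>C (M q1 - M q2) = (1 + z) *\<^sub>C M q1 + (1 - z) *\<^sub>C M q2"
    by (simp add: q_def M_add M_diff M_scaleR scaleC_diff_left scaleC_diff_right scaleC_add_left scaleC_of_real
        scaleR_add_left scaleR_diff_left)
  ultimately have "inside (P w) (\<delta> / 2) ((1 + z) *\<^sub>C M q1 + (1 - z) *\<^sub>C M q2)" by simp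
  then show ?thesis
    by (rule inside_weaken[OF _ le]) (use delta_pos D_pos P_in cone_add[OF w12] in auto)
qed

text \<open>The disk follows the combinations with coefficients 1 + F and 1 - F of the two images,
  freed of their phases. Its \<open>k\<close> comes from \<open>strip_map\<close> with a width
  depending only on \<delta>, \<beta> and D, hence is common to all pairs.\<close>

lemma ex_disk_through:
  obtains k where "0 < k" "k < 1"
    "\<And>u v. u \<in> CC - {0} \<Longrightarrow> v \<in> CC - {0} \<Longrightarrow> \<exists>a b. disk_through k (M u) (M v) a b"
proof -
  have \<beta>: "0 < sqrt \<beta>" using constants by simp
  obtain \<epsilon> where \<epsilon>: "0 < \<epsilon>" and "0 \<le> \<delta> / 2 - 2 * sqrt \<beta> * \<epsilon> - \<epsilon>\<^sup>2"
    using small_perturbation[of "sqrt \<beta>" "\<delta> / 2"] \<beta> delta_pos by auto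
  then have \<epsilon>': "2 * sqrt \<beta> * \<epsilon> + \<epsilon>\<^sup>2 \<le> \<delta> / 2" by simp
  \<comment> \<open>Solves the smallness condition of \<open>inside_near_segment\<close> with
    equality.\<close>
  define \<kappa> where "\<kappa> = 2 * \<epsilon> / (sqrt \<beta> * (1 + D))"
  have \<kappa>: "0 < \<kappa>" using \<epsilon> \<beta> D_pos by (simp add: \<kappa>_def)
  obtain k F where k: "0 < k" "k < 1" and F: "F holomorphic_on ball 0 1"
    "F (of_real k) = 1" "F (- of_real k) = -1"
    "\<And>z. norm z < 1 \<Longrightarrow> \<exists>\<tau>\<in>{-1..1::real}. norm (F z - of_real \<tau>) \<le> \<kappa>"
    using strip_map[OF \<kappa>] by metis
  obtain L where L: "relevant L" using ex_relevant by blast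
  have "\<exists>a b. disk_through k (M u) (M v) a b" if uv: "u \<in> CC - {0}" "v \<in> CC - {0}" for u v
  proof -
    obtain c1 w1 q1 where 1: "norm c1 = 1" "u = c1 *\<^sub>C q1" "quadrant w1 q1"
      using CC_quadrant uv(1) by (metis DiffD1)
    obtain c2 w2 q2 where 2: "norm c2 = 1" "v = c2 *\<^sub>C q2" "quadrant w2 q2"
      using CC_quadrant uv(2) by (metis DiffD1)
    have w: "w1 \<in> C - {0}" "w2 \<in> C - {0}"
      using quadrant_cone[OF 1(3)] quadrant_nonzero[OF 1(3)] quadrant_cone[OF 2(3)] quadrant_nonzero[OF 2(3)]
        uv 1(2) 2(2) by auto
    \<comment> \<open>This normalisation by \<open>L\<close> turns the cross-ratio bound, with
      \<open>L\<close> as second functional, into a two-sided comparison of P(s1 w1) and P(s2 w2)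
      with constant D.\<close>
    define s1 s2 where "s1 = 1 / L (P w1)" and "s2 = 1 / L (P w2)"
    have s: "0 < s1" "0 < s2" using L w by (auto simp: s1_def s2_def relevant_def)
    have c: "c1 \<noteq> 0" "c2 \<noteq> 0" using 1(1) 2(1) by auto
    define a where "a = (\<lambda>z. (1 + F z) * (of_real s1 / c1))"
    define b where "b = (\<lambda>z. (1 - F z) * (of_real s2 / c2))"
    define e where "e = s1 *\<^sub>R w1 + s2 *\<^sub>R w2"
    have Mu: "M u = c1 *\<^sub>C M q1" "M v = c2 *\<^sub>C M q2" by (simp_all add: 1(2) 2(2) M_scaleC)
    have ab: "a z *\<^sub>C M u + b z *\<^sub>C M v = (1 + F z) *\<^sub>C M (s1 *\<^sub>R q1) + (1 - F z) *\<^sub>C M (s2 *\<^sub>R q2)" for z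
      using c by (simp add: a_def b_def Mu scaleC_scaleC M_scaleR scaleC_scaleC_real)
    have LP: "L (P w1) \<noteq> 0" "L (P w2) \<noteq> 0" using s by (auto simp: s1_def s2_def)
    have ratio: "l (P (s1 *\<^sub>R w1)) \<le> D * l (P (s2 *\<^sub>R w2))" "l (P (s2 *\<^sub>R w2)) \<le> D * l (P (s1 *\<^sub>R w1))"
      if l: "l \<in> dual_cone C" for l
    proof -
      have pos: "0 < L (P w1)" "0 < L (P w2)" using L w by (auto simp: relevant_def)
      show "l (P (s1 *\<^sub>R w1)) \<le> D * l (P (s2 *\<^sub>R w2))" "l (P (s2 *\<^sub>R w2)) \<le> D * l (P (s1 *\<^sub>R w1))"
        using cross_ratio[of w1 w2 l L] cross_ratio[of w2 w1 l L] w l relevant_dual[OF L] pos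
        by (auto simp: P_scaleR blinfun.scaleR_right s1_def s2_def field_simps)
    qed
    have "inside (P e) (\<delta> / 2 * (2 / (1 + D))\<^sup>2) (a z *\<^sub>C M u + b z *\<^sub>C M v)" if z: "norm z < 1" for z
    proof -
      obtain \<tau> where \<tau>: "\<tau> \<in> {-1..1}" "norm (F z - of_real \<tau>) \<le> \<kappa>" using F(4)[OF z] by blast
      have "norm (F z - of_real \<tau>) * (sqrt \<beta> * (1 + D)) \<le> \<kappa> * (sqrt \<beta> * (1 + D))"
        using \<tau>(2) \<beta> D_pos by (intro mult_right_mono) auto
      also have "\<dots> = 2 * \<epsilon>" using \<beta> D_pos by (simp add: \<kappa>_def)
      finally show ?thesis
        unfolding ab e_def
        by (intro inside_near_segment[OF _ _ ratio _ \<epsilon>' \<tau>(1)] quadrant_scaleR 1 2) (use s \<epsilon> in auto)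
    qed
    moreover have "bounded_by (P e) (sqrt \<beta> / s1) (M u)" "bounded_by (P e) (sqrt \<beta> / s2) (M v)"
    proof -
      have *: "bounded_by (P e) (sqrt \<beta> / s) (c *\<^sub>C M q)"
        if "norm c = 1" "quadrant w q" "0 < s" "\<And>l. l \<in> dual_cone C \<Longrightarrow> s * l (P w) \<le> l (P e)" for c w q s
        unfolding bounded_by_def
      proof
        fix l assume l: "l \<in> dual_cone C"
        have "norm (cp l (c *\<^sub>C M q)) \<le> sqrt \<beta> * l (P w)"
          using M_quadrant(2)[OF that(2)] l that(1) by (simp add: bounded_by_def norm_mult)
        also have "\<dots> \<le> sqrt \<beta> * (l (P e) / s)"
          using that(4)[OF l] that(3) \<beta> by (intro mult_left_mono) (auto simp: field_simps)
        finally show "norm (cp l (c *\<^sub>C M q)) \<le> sqrt \<beta> / s * l (P e)" by simp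
      qed
      have nn: "0 \<le> l (P w1)" "0 \<le> l (P w2)" if "l \<in> dual_cone C" for l
        using that w by (auto simp: dual_cone_nonneg P_in)
      have Pe: "l (P e) = s1 * l (P w1) + s2 * l (P w2)" for l :: "'r \<Rightarrow>\<^sub>L real"
        by (simp add: e_def P_add P_scaleR blinfun.bilinear_simps)
      show "bounded_by (P e) (sqrt \<beta> / s1) (M u)"
        unfolding Mu by (rule *[OF 1(1,3) s(1)]) (simp add: Pe nn less_imp_le[OF s(1)] less_imp_le[OF s(2)])
      show "bounded_by (P e) (sqrt \<beta> / s2) (M v)"
        unfolding Mu by (rule *[OF 2(1,3) s(2)]) (simp add: Pe nn less_imp_le[OF s(1)] less_imp_le[OF s(2)])
    qed
    moreover have "e \<in> C - {0}"
    proof -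
      have eC: "e \<in> C" unfolding e_def using w s by (intro cone_add cone_scaleR) auto
      have "L (P e) = 2" using LP by (simp add: e_def P_add P_scaleR blinfun.bilinear_simps s1_def s2_def)
      then have "e \<noteq> 0" by (auto simp: P_0)
      then show ?thesis using eC by simp
    qed
    moreover have "0 < \<delta> / 2 * (2 / (1 + D))\<^sup>2"
      using delta_pos D_pos by (intro mult_pos_pos zero_less_power divide_pos_pos) auto
    moreover have "a holomorphic_on ball 0 1" "b holomorphic_on ball 0 1"
      unfolding a_def b_def using c by (intro holomorphic_intros F(1); simp)+
    moreover have "a (of_real k) \<noteq> 0" "b (of_real k) = 0" "a (- of_real k) = 0" "b (- of_real k) \<noteq> 0"
      using F(2,3) s c by (auto simp: a_def b_def)
    ultimately show ?thesis unfolding disk_through_def by blast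
  qed
  then show ?thesis using that k by blast
qed

end

section \<open>The gauge of the image of the cone\<close>

context complexified_cone
begin

lemma bounded_by_mono: "bounded_by e b u \<Longrightarrow> b \<le> b' \<Longrightarrow> e \<in> C \<Longrightarrow> bounded_by e b' u"
  unfolding bounded_by_def
proof
  fix l assume *: "\<forall>l\<in>dual_cone C. norm (cp l u) \<le> b * blinfun_apply l e" "b \<le> b'" "e \<in> C"
    and l: "l \<in> dual_cone C"
  have "norm (cp l u) \<le> b * l e" using * l by simp
  also have "\<dots> \<le> b' * l e" using *(2) dual_cone_nonneg[OF l *(3)] by (rule mult_right_mono)
  finally show "norm (cp l u) \<le> b' * l e" .
qed

text \<open>The margin at z absorbs the perturbation (w - z)B for all w near z.\<close>

lemma interior_affine_section:
  assumes v: "inside e d (z *\<^sub>C B + A)" "0 < d" and e: "e \<in> C"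
    and bd: "bounded_by e s B" "bounded_by e t A"
  shows "z \<in> interior {z. z *\<^sub>C B + A \<in> CC}"
proof -
  define s' where "s' = \<bar>s\<bar> + 1"
  define b where "b = norm z * s' + \<bar>t\<bar>"
  have s': "0 < s'" "bounded_by e s' B" using bounded_by_mono[OF bd(1) _ e] by (auto simp: s'_def)
  have "0 \<le> b" using s' by (simp add: b_def)
  have vb: "bounded_by e b (z *\<^sub>C B + A)"
    unfolding b_def using bounded_by_mono[OF bd(2) _ e]
    by (intro bounded_by_add bounded_by_scaleC s') auto
  obtain \<epsilon> where \<epsilon>: "0 < \<epsilon>" and d': "0 \<le> d - 2 * b * \<epsilon> - \<epsilon>\<^sup>2"
    using small_perturbation[OF \<open>0 \<le> b\<close> v(2)] by auto
  have "w *\<^sub>C B + A \<in> CC" if w: "w \<in> ball z (\<epsilon> / s')" for w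
  proof -
    have "norm (w - z) * s' \<le> \<epsilon>"
      using w s'(1) by (simp add: dist_norm norm_minus_commute field_simps)
    then have "bounded_by e \<epsilon> ((w - z) *\<^sub>C B)"
      using bounded_by_mono[OF bounded_by_scaleC[OF s'(2)] _ e] by blast
    then have "inside e 0 ((z *\<^sub>C B + A) + (w - z) *\<^sub>C B)"
      by (rule inside_perturb[OF v(1) vb _ e d'])
    moreover have "(z *\<^sub>C B + A) + (w - z) *\<^sub>C B = w *\<^sub>C B + A"
      by (simp add: scaleC_diff_left)
    ultimately show ?thesis using inside_CC[of e 0] e by simp
  qed
  then show ?thesis
    unfolding mem_interior using \<epsilon> s'(1) by (intro exI[of _ "\<epsilon> / s'"]) auto
qed

text \<open>Along an unbounded sequence of z in the section, division by z leaves B + A/z in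
  \<open>CC\<close>, and closedness would put B there.\<close>

lemma bounded_affine_section:
  assumes "B \<notin> CC"
  shows "bounded {z. z *\<^sub>C B + A \<in> CC}"
proof (rule ccontr)
  assume "\<not> bounded {z. z *\<^sub>C B + A \<in> CC}"
  then have "\<exists>z. z *\<^sub>C B + A \<in> CC \<and> real n < norm z" for n
    unfolding bounded_iff by (auto simp: not_le)
  then obtain f where f: "\<And>n. f n *\<^sub>C B + A \<in> CC" "\<And>n. real n < norm (f n)" by metis
  have f0: "f n \<noteq> 0" for n using f(2)[of n] by auto
  have "(\<lambda>n. (1 / f n) *\<^sub>C A) \<longlonglongrightarrow> 0"
  proof (rule Lim_null_comparison)
    show "\<forall>\<^sub>F n in sequentially. norm ((1 / f n) *\<^sub>C A) \<le> norm A * inverse (real n)"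
      using eventually_gt_at_top[of 0]
    proof eventually_elim
      fix n :: nat assume "0 < n"
      then have "1 / norm (f n) \<le> inverse (real n)"
        using f(2)[of n] by (simp add: inverse_eq_divide frac_le)
      then show "norm ((1 / f n) *\<^sub>C A) \<le> norm A * inverse (real n)"
        using mult_left_mono[of "1 / norm (f n)" "inverse (real n)" "norm A"]
        by (simp add: norm_scaleC norm_divide)
    qed
    show "(\<lambda>n. norm A * inverse (real n)) \<longlonglongrightarrow> 0"
      using tendsto_mult[OF tendsto_const[of "norm A"] lim_inverse_n] by simp
  qed
  then have "(\<lambda>n. B + (1 / f n) *\<^sub>C A) \<longlonglongrightarrow> B + 0" by (intro tendsto_intros)
  moreover have "B + (1 / f n) *\<^sub>C A \<in> CC" for n
    using CC_scaleC[OF f(1)[of n], of "1 / f n"] f0[of n] by (simp add: scaleC_add_right scaleC_scaleC)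
  ultimately have "B + 0 \<in> CC" by (rule CC_sequentially_closed)
  then show False using assms by simp
qed

text \<open>The section is the intersection of the generalised disks \<open>Re (m \<cdot> cnj l) \<ge> 0\<close>.  The complementary
  generalised disk of a pair \<open>m, l\<close> contains the zero of \<open>m + l\<close>, and the zeros of the functionals on a
  segment of the dual cone avoid the section; here infinity is itself the zero of a functional \<open>n\<close>.\<close>

lemma affine_section_complement:
  assumes n: "n \<in> dual_cone C" "cp n B = 0" "cp n A \<noteq> 0"
    and z: "z *\<^sub>C B + A \<notin> CC"
  shows "\<exists>S. connected S \<and> z \<in> S \<and> S \<inter> {z. z *\<^sub>C B + A \<in> CC} = {} \<and> \<not> bounded S"
proof -
  let ?v = "\<lambda>z. z *\<^sub>C B + A"
  obtain m l where ml: "m \<in> dual_cone C" "l \<in> dual_cone C" and neg: "Re (cp m (?v z) * cnj (cp l (?v z))) < 0"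
    using z CC_I[of "?v z"] by (meson not_le)
  define Q where "Q = (\<lambda>z. Re (cp m (?v z) * cnj (cp l (?v z))))"
  have out: "?v w \<notin> CC" if "Q w < 0" for w
    using CC_D[OF _ ml, of "?v w"] that by (auto simp: Q_def)
  define a b c d where "a = cp m B" and "b = cp m A" and "c = cp l B" and "d = cp l A"
  have Q: "Q w = Re ((w * a + b) * cnj (w * c + d))" for w by (simp add: Q_def a_def b_def c_def d_def)
  have Qz: "Q z < 0" using neg by (simp add: Q_def)
  have ray: "connected ((\<lambda>r. w + of_real r * f) ` {0..})" for w f :: complex
    by (intro connected_continuous_image continuous_intros) auto
  have ray_unbounded: "\<not> bounded ((\<lambda>r. w + of_real r * f) ` {0..})" if "f \<noteq> 0" for w f :: complex
  proof
    assume "bounded ((\<lambda>r. w + of_real r * f) ` {0..})"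
    then obtain K where K: "\<And>r. 0 \<le> r \<Longrightarrow> norm (w + of_real r * f) \<le> K"
      unfolding bounded_iff by auto
    define r where "r = (K + norm w + 1) / norm f"
    have "0 \<le> K" using K[of 0] norm_ge_zero order_trans by blast
    then have r: "0 \<le> r" "r * norm f = K + norm w + 1" using that by (auto simp: r_def)
    have "norm (of_real r * f) \<le> norm (w + of_real r * f) + norm w"
      using norm_triangle_ineq4[of "w + of_real r * f" w] by simp
    then show False using K[OF r(1)] r by (simp add: norm_mult)
  qed
  show ?thesis
  proof (cases "Re (a * cnj c) \<le> 0")
    case True
    \<comment> \<open>\<open>\<theta>\<close> is the derivative of \<open>Q\<close> in the real
      direction. As \<open>Q\<close> is concave along real lines in this case, it stays negative on
      the half-line with nonpositive initial slope.\<close>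
    define \<theta> where "\<theta> = Re (a * cnj (z * c + d) + (z * a + b) * cnj c)"
    define f :: real where "f = (if \<theta> \<le> 0 then 1 else -1)"
    have "Q (z + of_real r * of_real f) < 0" if "0 \<le> r" for r
    proof -
      have "Q (z + of_real r * of_real f) = Q z + r * (f * \<theta>) + (r * f)\<^sup>2 * Re (a * cnj c)"
        unfolding Q \<theta>_def by (simp add: algebra_simps power2_eq_square)
      moreover have "f * \<theta> \<le> 0" by (simp add: f_def)
      then have "r * (f * \<theta>) \<le> 0" using that by (rule mult_nonneg_nonpos[rotated])
      moreover have "(r * f)\<^sup>2 * Re (a * cnj c) \<le> 0" using True by (intro mult_nonneg_nonpos) auto
      ultimately show ?thesis using Qz by linarith
    qed
    then have disj: "(\<lambda>r. z + of_real r * of_real f) ` {0..} \<inter> {z. ?v z \<in> CC} = {}"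
      using out by fastforce
    have zin: "z \<in> (\<lambda>r. z + of_real r * of_real f) ` {0..}"
      by (rule image_eqI[of _ _ 0]) auto
    have "\<not> bounded ((\<lambda>r. z + of_real r * of_real f) ` {0..})"
      by (rule ray_unbounded) (simp add: f_def)
    then show ?thesis using ray disj zin by blast
  next
    case False
    then have A: "0 < Re (a * cnj c)" by simp
    have ac: "a + c \<noteq> 0"
    proof
      assume "a + c = 0"
      then have "a = - c" by (simp add: add_eq_0_iff)
      then have "Re (a * cnj c) = - (Re c * Re c + Im c * Im c)" by simp
      moreover have "0 \<le> Re c * Re c + Im c * Im c" by simp
      ultimately show False using A by linarith
    qed
    \<comment> \<open>At the zero of m + l the values of m and l are opposite, so \<open>Q\<close>
      is negative there. In this case \<open>Q\<close> is convex, so it is negative on the whole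
      segment from z to y.\<close>
    define y where "y = - (b + d) / (a + c)"
    have y: "y * (a + c) = - (b + d)" using ac by (simp add: y_def)
    have "(y * a + b) + (y * c + d) = y * (a + c) + (b + d)" by (simp add: algebra_simps)
    then have "(y * a + b) + (y * c + d) = 0" unfolding y by simp
    then have sum0: "y * a + b = - (y * c + d)" by (simp only: eq_neg_iff_add_eq_0)
    have nz: "y * c + d \<noteq> 0"
    proof
      assume 0: "y * c + d = 0"
      then have 1: "y * a + b = 0" using sum0 by simp
      have "z * a + b = (z - y) * a" "z * c + d = (z - y) * c"
        using 0 1 by (auto simp: algebra_simps add_eq_0_iff)
      then have "Q z = (norm (z - y))\<^sup>2 * Re (a * cnj c)"
        unfolding Q by (simp only: scaled_mult_cnj Re_complex_of_real_mult)
      then show False using Qz A by (simp add: mult_less_0_iff not_less)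
    qed
    have "(- w) * cnj w = of_real (- ((norm w)\<^sup>2))" for w
      unfolding of_real_minus complex_norm_square by simp
    then have "Q y = - (norm (y * c + d))\<^sup>2"
      unfolding Q sum0 by (simp only: Re_complex_of_real)
    then have Qy: "Q y < 0" using nz by simp
    have seg: "Q w < 0" if w: "w \<in> closed_segment z y" for w
    proof -
      obtain s where s: "0 \<le> s" "s \<le> 1" "w = (1 - s) *\<^sub>R z + s *\<^sub>R y"
        using w by (auto simp: in_segment)
      have "Q w = (1 - s) * Q z + s * Q y - s * (1 - s) * ((norm (z - y))\<^sup>2 * Re (a * cnj c))"
        unfolding Q s(3) cmod_power2 by (simp add: algebra_simps power2_eq_square)
      moreover have "0 \<le> s * (1 - s) * ((norm (z - y))\<^sup>2 * Re (a * cnj c))"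
        using s A by simp
      moreover have "(1 - s) * Q z + s * Q y < 0"
        using convex_bound_lt[OF Qz Qy, of "1 - s" s] s by simp
      ultimately show ?thesis by linarith
    qed
    \<comment> \<open>On the affine line \<open>n\<close> has the constant value
      \<open>cp n A\<close>, so y + rf is the zero of m + l + rn; it runs to infinity with
      r.\<close>
    define f where "f = - cp n A / (a + c)"
    have f: "f \<noteq> 0" using n(3) ac by (simp add: f_def)
    have "?v w \<notin> CC" if w: "w \<in> (\<lambda>r. y + of_real r * f) ` {0..}" for w
    proof -
      obtain r where r: "0 \<le> r" "w = y + of_real r * f" using w by auto
      show ?thesis
      proof (cases "r = 0")
        case True
        then show ?thesis using r(2) out[OF Qy] by simp
      next
        case False
        have "cp (m + l) (?v w) = w * (a + c) + (b + d)"
          by (simp add: a_def b_def c_def d_def algebra_simps)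
        also have "\<dots> = of_real r * (f * (a + c))" using y by (simp add: r(2) algebra_simps)
        also have "f * (a + c) = - cp n A" using ac by (simp add: f_def)
        finally have "cp (m + l) (?v w) * cnj (cp n (?v w)) = of_real (- r) * (cp n A * cnj (cp n A))"
          using n(2) by simp
        then have "Re (cp (m + l) (?v w) * cnj (cp n (?v w))) = - r * (norm (cp n A))\<^sup>2"
          by (simp only: complex_norm_square[symmetric] Re_complex_of_real_mult Re_complex_of_real)
        also have "\<dots> < 0" using r(1) False n(3) by simp
        finally show ?thesis using CC_D[OF _ dual_cone_add[OF ml] n(1)] by (metis not_le)
      qed
    qed
    then have disj: "(closed_segment z y \<union> (\<lambda>r. y + of_real r * f) ` {0..}) \<inter> {z. ?v z \<in> CC} = {}"
      using seg out by blast
    have "y \<in> (\<lambda>r. y + of_real r * f) ` {0..}" by (rule image_eqI[of _ _ 0]) auto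
    then have conn: "connected (closed_segment z y \<union> (\<lambda>r. y + of_real r * f) ` {0..})"
      by (intro connected_Un ray connected_segment) auto
    have "\<not> bounded (closed_segment z y \<union> (\<lambda>r. y + of_real r * f) ` {0..})"
      using ray_unbounded[OF f] by (simp add: bounded_Un)
    then show ?thesis using disj conn by (metis Un_iff ends_in_segment(1))
  qed
qed

end

context dominated_operator
begin

text \<open>If all these determinants vanished, l(Y)X - l(X)Y would be killed by the dual cone and
  hence be zero, for an l with l(X) nonzero.\<close>

lemma independent_functionals:
  assumes "\<not> complex_collinear X Y"
  obtains m l where "m \<in> dual_cone C" "l \<in> dual_cone C" "cp m X * cp l Y \<noteq> cp m Y * cp l X"
proof (rule ccontr)
  assume "\<not> thesis"
  then have eq: "cp m X * cp l Y = cp m Y * cp l X" if "m \<in> dual_cone C" "l \<in> dual_cone C" for m l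
    using that by (meson \<open>\<And>m l. \<lbrakk>m \<in> dual_cone C; l \<in> dual_cone C; cp m X * cp l Y \<noteq> cp m Y * cp l X\<rbrakk> \<Longrightarrow> thesis\<close>)
  have "X \<noteq> 0"
    using assms unfolding complex_collinear_def by (metis add.right_neutral prod.inject scaleC_one scaleC_zero_left zero_neq_one)
  then obtain l where l: "l \<in> dual_cone C" "cp l X \<noteq> 0" using cpair_separates by blast
  have "cp l Y *\<^sub>C X + (- cp l X) *\<^sub>C Y = 0"
    by (rule cpair_separates) (use eq[OF _ l(1)] in \<open>simp add: mult.commute\<close>)
  then show False using assms l(2) unfolding complex_collinear_def by (metis neg_equal_0_iff_equal prod.inject)
qed

text \<open>The complex line through X and Y is read in the chart that sends the zero p of a
  functional n of the dual cone to infinity. There the section is bounded, its outer points are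
  joined to infinity by \<open>affine_section_complement\<close>, and the given disk becomes a
  holomorphic map \<open>H\<close>.\<close>

lemma gauge_dist_le:
  assumes disk: "disk_through k X Y a b" and k: "0 < k" "k < 1"
  shows "gauge_dist CC X Y \<le> ereal (2 * artanh (schwarz_factor k))"
proof (cases "complex_collinear X Y")
  case True
  have "0 \<le> artanh (schwarz_factor k)"
    using artanh_real_mono[of 0 "schwarz_factor k"] schwarz_factor_bounds[OF k] by simp
  then show ?thesis using True by (simp add: gauge_dist_def)
next
  case False
  obtain m l where ml: "m \<in> dual_cone C" "l \<in> dual_cone C" "cp m X * cp l Y \<noteq> cp m Y * cp l X"
    using independent_functionals[OF False] by blast
  define A where "A = X - Y"
  \<comment> \<open>One of t = 1 and t = 2 works because m(A) and l(A) do not both vanish. With n(A)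
    nonzero the zero p of n is a finite parameter.\<close>
  obtain t :: real where t: "0 < t" "cp m A + of_real t * cp l A \<noteq> 0"
  proof (cases "cp m A + cp l A = 0")
    case True
    then have mA: "cp m A = - cp l A" by (simp add: eq_neg_iff_add_eq_0)
    have "cp l A \<noteq> 0"
    proof
      assume "cp l A = 0"
      then have "cp l X = cp l Y" "cp m X = cp m Y" using mA by (simp_all add: A_def)
      then show False using ml(3) by simp
    qed
    then have "cp m A + of_real 2 * cp l A \<noteq> 0" using mA by simp
    then show ?thesis using that[of 2] by simp
  qed (use that[of 1] in simp)
  define n where "n = m + t *\<^sub>R l"
  have n: "n \<in> dual_cone C" using ml t(1) by (simp add: n_def dual_cone_add dual_cone_scaleR)
  have nA: "cp n A \<noteq> 0" using t(2) by (simp add: n_def)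
  define p where "p = - cp n (X + Y) / cp n A"
  define B where "B = (X + Y) + p *\<^sub>C A"
  have nB: "cp n B = 0" using nA by (simp add: B_def p_def)
  have det: "s = 0 \<and> r = 0" if "cp m (s *\<^sub>C X + r *\<^sub>C Y) = 0" "cp l (s *\<^sub>C X + r *\<^sub>C Y) = 0" for s r
  proof -
    have e: "s * cp m X + r * cp m Y = 0" "s * cp l X + r * cp l Y = 0" using that by simp_all
    have "s * (cp m X * cp l Y - cp m Y * cp l X) = (s * cp m X + r * cp m Y) * cp l Y - cp m Y * (s * cp l X + r * cp l Y)"
      "r * (cp m X * cp l Y - cp m Y * cp l X) = cp m X * (s * cp l X + r * cp l Y) - (s * cp m X + r * cp m Y) * cp l X"
      by (simp_all add: algebra_simps)
    then have "s * (cp m X * cp l Y - cp m Y * cp l X) = 0" "r * (cp m X * cp l Y - cp m Y * cp l X) = 0"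
      unfolding e by simp_all
    then show ?thesis using ml(3) by simp
  qed
  have BXY: "B = (1 + p) *\<^sub>C X + (1 - p) *\<^sub>C Y"
    by (simp add: B_def A_def scaleC_add_left scaleC_diff_left scaleC_diff_right)
  have mB: "cp m B = - of_real t * cp l B" using nB by (simp add: n_def add_eq_0_iff)
  have lB: "cp l B \<noteq> 0"
  proof
    assume "cp l B = 0"
    moreover from this have "cp m B = 0" using mB by simp
    ultimately have "1 + p = 0 \<and> 1 - p = 0" unfolding BXY by (intro det)
    then have "(1 + p) + (1 - p) = 0" by (simp only: add_0_right)
    then show False by simp
  qed
  \<comment> \<open>At B the values of m and l have the negative ratio -t, so this pair excludes B
    from \<open>CC\<close>: the parameter p lies outside the gauge set, as a bounded section
    requires.\<close>
  have BCC: "B \<notin> CC"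
  proof
    assume "B \<in> CC"
    then have "0 \<le> Re (cp m B * cnj (cp l B))" using ml CC_D by blast
    moreover have "cp m B * cnj (cp l B) = of_real (- t) * (cp l B * cnj (cp l B))" by (simp add: mB)
    ultimately have "0 \<le> - t * (norm (cp l B))\<^sup>2"
      by (simp only: complex_norm_square[symmetric] Re_complex_of_real_mult Re_complex_of_real)
    then show False using t(1) lB by (simp add: mult_le_0_iff)
  qed
  define \<Omega> where "\<Omega> = {z. z *\<^sub>C B + A \<in> CC}"
  have G: "gauge_set CC X Y = sphere_chart p ` \<Omega>"
  proof -
    have "(1 + w) *\<^sub>C X + (1 - w) *\<^sub>C Y \<in> CC \<longleftrightarrow> w \<noteq> p \<and> 1 / (w - p) \<in> \<Omega>" for w
    proof -
      have eq: "(1 + w) *\<^sub>C X + (1 - w) *\<^sub>C Y = B + (w - p) *\<^sub>C A"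
        by (simp add: B_def A_def scaleC_add_left scaleC_diff_left scaleC_diff_right)
      show ?thesis
      proof (cases "w = p")
        case False
        then have "B + (w - p) *\<^sub>C A = (w - p) *\<^sub>C ((1 / (w - p)) *\<^sub>C B + A)"
          by (simp add: scaleC_add_right scaleC_scaleC)
        then show ?thesis using False CC_scaleC_iff[of "w - p"] by (simp add: eq \<Omega>_def)
      next
        case True
        then show ?thesis using BCC BXY by simp
      qed
    qed
    then have "Fin w \<in> gauge_set CC X Y \<longleftrightarrow> Fin w \<in> sphere_chart p ` \<Omega>" for w
      by (simp add: gauge_set_def Fin_in_sphere_chart_image)
    moreover have "Infty \<in> gauge_set CC X Y \<longleftrightarrow> Infty \<in> sphere_chart p ` \<Omega>"
      by (auto simp: gauge_set_def Infty_in_sphere_chart_image \<Omega>_def A_def)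
    ultimately show ?thesis by (intro set_eqI) (metis sphere.exhaust)
  qed
  from disk obtain e d s1 s2 where hol: "a holomorphic_on ball 0 1" "b holomorphic_on ball 0 1"
    and ends: "a (of_real k) \<noteq> 0" "b (of_real k) = 0" "a (- of_real k) = 0" "b (- of_real k) \<noteq> 0"
    and e: "e \<in> C - {0}" "0 < d" "bounded_by (P e) s1 X" "bounded_by (P e) s2 Y"
    and ins: "\<And>z. norm z < 1 \<Longrightarrow> inside (P e) d (a z *\<^sub>C X + b z *\<^sub>C Y)"
    unfolding disk_through_def by blast
  define u where "u = (\<lambda>z. a z *\<^sub>C X + b z *\<^sub>C Y)"
  \<comment> \<open>Here the bounds on X and Y in \<open>disk_through\<close> enter: if n vanished
    at P(e), it would vanish at X and Y, hence at A. So n has no zero on the disk.\<close>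
  have "0 < n (P e)"
  proof (rule ccontr)
    assume "\<not> 0 < n (P e)"
    then have "n (P e) = 0" using dual_cone_nonneg[OF n P_in[of e]] e(1) by simp
    then have "cp n X = 0" "cp n Y = 0" using e(3,4) n by (force simp: bounded_by_def)+
    then show False using nA by (simp add: A_def)
  qed
  then have nu: "cp n (u z) \<noteq> 0" if "norm z < 1" for z
    using inside_nonzero[OF ins[OF that] n e(2)] by (simp add: u_def)
  \<comment> \<open>Solves HB + A = \<kappa>u: the functional \<open>n\<close>, which kills B,
    determines \<kappa>, and \<open>l\<close> then determines H.\<close>
  define H where "H = (\<lambda>z. (cp n A * cp l (u z) / cp n (u z) - cp l A) / cp l B)"
  have "H holomorphic_on ball 0 1"
    unfolding H_def using nu lB
    by (intro holomorphic_intros) (auto simp: u_def intro!: holomorphic_intros hol)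
  define \<kappa> where "\<kappa> = (\<lambda>z. cp n A / cp n (u z))"
  have \<kappa>0: "\<kappa> z \<noteq> 0" if "norm z < 1" for z using nA nu[OF that] by (simp add: \<kappa>_def)
  have H: "H z * (1 + p) + 1 = \<kappa> z * a z" "H z * (1 - p) - 1 = \<kappa> z * b z" if z: "norm z < 1" for z
  proof -
    define s r where "s = H z * (1 + p) + 1 - \<kappa> z * a z" and "r = H z * (1 - p) - 1 - \<kappa> z * b z"
    have W: "s *\<^sub>C X + r *\<^sub>C Y = H z *\<^sub>C B + A - \<kappa> z *\<^sub>C u z"
      by (simp add: s_def r_def BXY A_def u_def scaleC_add_left scaleC_diff_left scaleC_add_right
          scaleC_diff_right scaleC_scaleC distrib_left right_diff_distrib)
    have "cp l (s *\<^sub>C X + r *\<^sub>C Y) = 0"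
      unfolding W using lB by (simp add: H_def \<kappa>_def)
    moreover have "cp n (s *\<^sub>C X + r *\<^sub>C Y) = 0"
      unfolding W using nB nu[OF z] by (simp add: \<kappa>_def)
    ultimately have "cp m (s *\<^sub>C X + r *\<^sub>C Y) = 0"
      unfolding n_def cpair_add_left cpair_scaleR_left by simp
    then have "s = 0" "r = 0" using det \<open>cp l (s *\<^sub>C X + r *\<^sub>C Y) = 0\<close> by blast+
    then show "H z * (1 + p) + 1 = \<kappa> z * a z" "H z * (1 - p) - 1 = \<kappa> z * b z"
      by (simp_all add: s_def r_def)
  qed
  have vH: "H z *\<^sub>C B + A = \<kappa> z *\<^sub>C u z" if z: "norm z < 1" for z
  proof -
    have "H z *\<^sub>C B + A = (H z * (1 + p) + 1) *\<^sub>C X + (H z * (1 - p) - 1) *\<^sub>C Y"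
      by (simp add: BXY A_def scaleC_add_left scaleC_diff_left scaleC_add_right
          scaleC_diff_right scaleC_scaleC distrib_left right_diff_distrib)
    then show ?thesis by (simp add: H[OF z] u_def scaleC_add_right scaleC_scaleC)
  qed
  have Hsub: "H ` ball 0 1 \<subseteq> interior \<Omega>"
  proof safe
    fix z :: complex assume "z \<in> ball 0 1"
    then have z: "norm z < 1" by simp
    show "H z \<in> interior \<Omega>"
      unfolding \<Omega>_def
    proof (rule interior_affine_section)
      show "inside (P e) ((norm (\<kappa> z))\<^sup>2 * d) (H z *\<^sub>C B + A)"
        unfolding vH[OF z] by (rule inside_scaleC) (use ins[OF z] in \<open>simp add: u_def\<close>)
      show "bounded_by (P e) (norm (1 + p) * s1 + norm (1 - p) * s2) B"
        unfolding BXY by (intro bounded_by_add bounded_by_scaleC e)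
      have "A = X + (- Y)" by (simp add: A_def)
      then show "bounded_by (P e) (s1 + s2) A"
        by (simp only:) (intro bounded_by_add bounded_by_minus e)
    qed (use \<kappa>0[OF z] e P_in in auto)
  qed
  have left: "Fin (-1) = sphere_chart p (H (- of_real k))"
  proof -
    have "H (- of_real k) * (1 + p) + 1 = 0" using H(1)[of "- of_real k"] k ends by simp
    then have h: "H (- of_real k) * (1 + p) = -1" by (simp only: eq_neg_iff_add_eq_0)
    then have h': "H (- of_real k) * (- (1 + p)) = 1" by (simp only: mult_minus_right minus_minus)
    then have "H (- of_real k) \<noteq> 0" by auto
    moreover from this h' have "1 / H (- of_real k) = - (1 + p)" by (metis nonzero_mult_div_cancel_left)
    ultimately show ?thesis by (simp add: sphere_chart_def)
  qed
  have right: "Fin 1 = sphere_chart p (H (of_real k))"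
  proof -
    have h: "H (of_real k) * (1 - p) = 1" using H(2)[of "of_real k"] k ends by simp
    then have "H (of_real k) \<noteq> 0" by auto
    moreover from this h have "1 / H (of_real k) = 1 - p" by (metis nonzero_mult_div_cancel_left)
    ultimately show ?thesis by (simp add: sphere_chart_def)
  qed
  have bd: "bounded \<Omega>" unfolding \<Omega>_def by (rule bounded_affine_section[OF BCC])
  have out: "\<exists>S. connected S \<and> z \<in> S \<and> S \<inter> \<Omega> = {} \<and> \<not> bounded S" if "z \<notin> \<Omega>" for z
    using affine_section_complement[OF n nB nA, of z] that by (simp add: \<Omega>_def)
  note dist = hyperbolic_dist_chart_le[OF bd out \<open>H holomorphic_on ball 0 1\<close> Hsub k left right]
  show ?thesis
    unfolding gauge_dist_def G Let_def using False dist by simp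
qed

theorem gauge_diam_finite: "gauge_diam CC (M ` (CC - {0})) < \<infinity>"
proof -
  obtain k where k: "0 < k" "k < 1"
    "\<And>u v. u \<in> CC - {0} \<Longrightarrow> v \<in> CC - {0} \<Longrightarrow> \<exists>a b. disk_through k (M u) (M v) a b"
    using ex_disk_through by metis
  have "gauge_diam CC (M ` (CC - {0})) \<le> ereal (2 * artanh (schwarz_factor k))"
    unfolding gauge_diam_def
    by (intro SUP_least) (use k gauge_dist_le in blast)
  then show ?thesis by (rule le_less_trans) simp
qed

end

section \<open>Spectral gaps from rank-one approximation\<close>

lemma geometric_cauchy:
  fixes a :: "nat \<Rightarrow> 'a::banach"
  assumes \<eta>: "0 \<le> \<eta>" "\<eta> < 1" and step: "\<And>n. N \<le> n \<Longrightarrow> norm (a (Suc n) - a n) \<le> K * \<eta> ^ n"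
  obtains l where "a \<longlonglongrightarrow> l" "\<And>n. N \<le> n \<Longrightarrow> norm (a n - l) \<le> K * \<eta> ^ n / (1 - \<eta>)"
proof -
  have K: "0 \<le> K * \<eta> ^ n" if "N \<le> n" for n using step[OF that] norm_ge_zero order_trans by blast
  have tel: "norm (a (n + i) - a n) \<le> K * (\<eta> ^ n - \<eta> ^ (n + i)) / (1 - \<eta>)" if n: "N \<le> n" for n i
  proof (induction i)
    case (Suc i)
    have "norm (a (n + Suc i) - a n) \<le> norm (a (Suc (n + i)) - a (n + i)) + norm (a (n + i) - a n)"
      using norm_triangle_ineq[of "a (Suc (n + i)) - a (n + i)" "a (n + i) - a n"] by simp
    also have "\<dots> \<le> K * \<eta> ^ (n + i) + K * (\<eta> ^ n - \<eta> ^ (n + i)) / (1 - \<eta>)"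
      using Suc step[of "n + i"] n by (intro add_mono) auto
    also have "\<dots> = K * (\<eta> ^ n - \<eta> ^ (n + Suc i)) / (1 - \<eta>)"
      using \<eta> by (simp add: field_simps)
    finally show ?case .
  qed simp
  have bound: "norm (a m - a n) \<le> K * \<eta> ^ n / (1 - \<eta>)" if n: "N \<le> n" "n \<le> m" for m n
  proof -
    obtain i where m: "m = n + i" using n(2) le_Suc_ex by blast
    have "K * (\<eta> ^ n - \<eta> ^ (n + i)) \<le> K * \<eta> ^ n"
      using K[of "n + i"] n(1) by (simp add: algebra_simps)
    then have "K * (\<eta> ^ n - \<eta> ^ (n + i)) / (1 - \<eta>) \<le> K * \<eta> ^ n / (1 - \<eta>)"
      using \<eta> by (intro divide_right_mono) auto
    then show ?thesis using tel[OF n(1), of i] by (simp add: m)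
  qed
  have "(\<lambda>n. K * \<eta> ^ n / (1 - \<eta>)) \<longlonglongrightarrow> K * 0 / (1 - \<eta>)"
    using \<eta> by (intro tendsto_intros LIMSEQ_power_zero) auto
  then have lim: "(\<lambda>n. K * \<eta> ^ n / (1 - \<eta>)) \<longlonglongrightarrow> 0" by simp
  have "Cauchy a"
  proof (rule metric_CauchyI)
    fix e :: real assume e: "0 < e"
    then obtain n0 where n0: "\<And>n. n0 \<le> n \<Longrightarrow> norm (K * \<eta> ^ n / (1 - \<eta>)) < e / 2"
      using LIMSEQ_D[OF lim, of "e / 2"] by auto
    let ?M = "max N n0"
    have "K * \<eta> ^ ?M / (1 - \<eta>) < e / 2"
      using n0[of ?M, unfolded real_norm_def] abs_ge_self[of "K * \<eta> ^ ?M / (1 - \<eta>)"] by linarith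
    then have "dist (a m) (a ?M) < e / 2" if "?M \<le> m" for m
      unfolding dist_norm by (rule le_less_trans[OF bound[OF _ that], rotated]) simp
    then show "\<exists>M. \<forall>m\<ge>M. \<forall>n\<ge>M. dist (a m) (a n) < e"
      by (intro exI[of _ ?M] allI impI) (rule dist_triangle_half_l)
  qed
  then obtain l where l: "a \<longlonglongrightarrow> l" using Cauchy_convergent convergent_def by blast
  have "norm (a n - l) \<le> K * \<eta> ^ n / (1 - \<eta>)" if "N \<le> n" for n
  proof (rule LIMSEQ_le_const2)
    show "(\<lambda>m. norm (a n - a m)) \<longlonglongrightarrow> norm (a n - l)" by (intro tendsto_intros l)
    show "\<exists>M. \<forall>m\<ge>M. norm (a n - a m) \<le> K * \<eta> ^ n / (1 - \<eta>)"
      using bound[OF that] by (metis norm_minus_commute)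
  qed
  then show ?thesis using l that by blast
qed

lemma bounded_clinear_funpow: "bounded_clinear T \<Longrightarrow> bounded_clinear (T ^^ n)"
proof (induction n)
  case (Suc n)
  then show ?case
    by (auto simp: bounded_clinear_def intro: bounded_linear_compose[of T "T ^^ n"])
qed (simp add: bounded_clinear_def bounded_linear_ident id_def)

lemma bounded_clinear_le:
  assumes "bounded_clinear T"
  obtains B where "0 < B" "\<And>u. norm (T u) \<le> B * norm u"
  using bounded_linear.pos_bounded[OF bounded_clinear_bounded[OF assms]] by (metis mult.commute)

lemma bounded_clinearI:
  fixes T :: "'c::complex_banach \<Rightarrow> 'c"
  assumes "\<And>u v. T (u + v) = T u + T v" "\<And>c u. T (c *\<^sub>C u) = c *\<^sub>C T u" "\<And>u. norm (T u) \<le> B * norm u"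
  shows "bounded_clinear T"
  unfolding bounded_clinear_def
proof
  show "bounded_linear T"
  proof (rule bounded_linear_intro[where K = B])
    show "T (r *\<^sub>R u) = r *\<^sub>R T u" for r u
      using assms(2)[of "of_real r" u] by (simp add: scaleC_of_real)
  qed (use assms in \<open>auto simp: mult.commute\<close>)
qed (use assms in simp)

text \<open>On the kernel of \<open>Q\<close> the powers of \<open>M\<close> decay like r^k, so the
  Neumann series \<open>R\<close> inverts z - M there for all |z| > r, including z = \<mu>; on the
  range of \<open>Q\<close> the operator is multiplication by \<mu>. Outside the disk of radius r
  the spectrum is therefore \<mu> alone.\<close>

lemma spectral_gap_rank_one:
  fixes M Q :: "'c::complex_banach \<Rightarrow> 'c"
  assumes M: "bounded_clinear M" and Q: "bounded_clinear Q"
    and g: "g \<noteq> 0" "M g = \<mu> *\<^sub>C g"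
    and QQ: "\<And>u. Q (Q u) = Q u" and QM: "\<And>u. Q (M u) = M (Q u)"
    and range: "range Q = range (\<lambda>c. c *\<^sub>C g)"
    and decay: "\<And>k u. norm ((M ^^ k) (u - Q u)) \<le> K * r ^ k * norm u"
    and r: "0 \<le> r" "r < norm \<mu>"
  shows "spectral_gap M"
proof -
  note M_simps = bounded_clinear_add[OF M] bounded_clinear_diff[OF M] bounded_clinear_scaleC[OF M] bounded_clinear_0[OF M]
  note Q_simps = bounded_clinear_add[OF Q] bounded_clinear_diff[OF Q] bounded_clinear_scaleC[OF Q] bounded_clinear_0[OF Q]
  have MQ: "M (Q u) = \<mu> *\<^sub>C Q u" for u
  proof -
    obtain c where "Q u = c *\<^sub>C g" using range by blast
    then show ?thesis using g(2) by (simp add: M_simps scaleC_scaleC mult.commute)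
  qed
  note Mk = bounded_clinear_funpow[OF M]
  have QMk: "Q ((M ^^ k) u) = (M ^^ k) (Q u)" for k u
    by (induction k) (simp_all add: QM)
  define R where "R = (\<lambda>z u. \<Sum>k. (1 / z ^ Suc k) *\<^sub>C (M ^^ k) (u - Q u))"
  have R: "bounded_clinear (R z) \<and> (\<forall>u. z *\<^sub>C R z u - M (R z u) = u - Q u) \<and>
      (\<forall>u. R z (M u) = M (R z u)) \<and> (\<forall>u. Q (R z u) = 0)" if z: "r < norm z" for z
  proof -
    have z0: "z \<noteq> 0" using z r(1) by auto
    let ?t = "\<lambda>u k. (1 / z ^ Suc k) *\<^sub>C (M ^^ k) (u - Q u)"
    have tn: "norm (?t u k) \<le> K / norm z * norm u * (r / norm z) ^ k" for u k
    proof -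
      have "norm (?t u k) \<le> (1 / norm z ^ Suc k) * (K * r ^ k * norm u)"
        unfolding norm_scaleC norm_divide norm_power norm_one using decay by (intro mult_left_mono) auto
      also have "\<dots> = K / norm z * norm u * (r / norm z) ^ k"
        using z0 by (simp add: power_divide field_simps)
      finally show ?thesis .
    qed
    have geo: "summable (\<lambda>k. (r / norm z) ^ k)"
    proof (rule summable_geometric)
      have "r / norm z < 1" using z z0 by (subst divide_less_eq_1_pos) auto
      then show "norm (r / norm z) < 1" using r(1) by simp
    qed
    have sn: "summable (\<lambda>k. norm (?t u k))" for u
      by (rule summable_comparison_test'[OF summable_mult[OF geo, of "K / norm z * norm u"], of 0])
        (use tn in simp)
    have s: "summable (?t u)" for u by (rule summable_norm_cancel[OF sn])
    have add: "R z (u + v) = R z u + R z v" for u v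
      unfolding R_def suminf_add[OF s s]
      by (simp add: Q_simps scaleC_add_right bounded_clinear_add[OF Mk] bounded_clinear_diff[OF Mk]
          scaleC_diff_right algebra_simps)
    have bound: "norm (R z u) \<le> (K / norm z * (\<Sum>k. (r / norm z) ^ k)) * norm u" for u
    proof -
      have "norm (R z u) \<le> (\<Sum>k. norm (?t u k))" unfolding R_def by (rule summable_norm[OF sn])
      also have "\<dots> \<le> (\<Sum>k. K / norm z * norm u * (r / norm z) ^ k)"
        by (rule suminf_le[OF tn sn summable_mult[OF geo]])
      also have "\<dots> = K / norm z * norm u * (\<Sum>k. (r / norm z) ^ k)" by (rule suminf_mult[OF geo])
      finally show ?thesis by (simp add: algebra_simps)
    qed
    have bl: "bounded_linear (\<lambda>u::'c. c *\<^sub>C u)" for c :: complex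
      by (rule bounded_linear_intro[where K = "norm c"])
        (auto simp: scaleC_add_right scaleC_scaleC_real norm_scaleC mult.commute)
    have scale: "R z (c *\<^sub>C u) = c *\<^sub>C R z u" for c u
    proof -
      have "c *\<^sub>C R z u = (\<Sum>k. c *\<^sub>C ?t u k)" unfolding R_def by (rule bounded_linear.suminf[OF bl s])
      also have "\<dots> = R z (c *\<^sub>C u)"
        unfolding R_def by (simp add: Q_simps scaleC_scaleC bounded_clinear_scaleC[OF Mk] mult.commute
            flip: scaleC_diff_right)
      finally show ?thesis by simp
    qed
    have MR: "M (R z u) = (\<Sum>k. M (?t u k))" for u
      unfolding R_def by (rule bounded_linear.suminf[OF bounded_clinear_bounded[OF M] s])
    have "z *\<^sub>C R z u - M (R z u) = u - Q u" for u
    proof -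
      have "z *\<^sub>C R z u = (\<Sum>k. z *\<^sub>C ?t u k)" unfolding R_def by (rule bounded_linear.suminf[OF bl s])
      also have "\<dots> = z *\<^sub>C ?t u 0 + (\<Sum>k. z *\<^sub>C ?t u (Suc k))"
        using suminf_split_head[OF bounded_linear.summable[OF bl[of z] s[of u]]] by simp
      also have "(\<Sum>k. z *\<^sub>C ?t u (Suc k)) = M (R z u)"
        unfolding MR by (rule suminf_cong) (use z0 in \<open>simp add: scaleC_scaleC M_simps\<close>)
      finally show ?thesis using z0 by (simp add: scaleC_scaleC)
    qed
    moreover have "R z (M u) = M (R z u)" for u
    proof -
      have "M (u - Q u) = M u - Q (M u)" by (simp add: M_simps QM)
      then show ?thesis
        unfolding MR by (simp add: R_def M_simps funpow_swap1)
    qed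
    moreover have "Q (R z u) = 0" for u
    proof -
      have "Q (R z u) = (\<Sum>k. Q (?t u k))"
        unfolding R_def by (rule bounded_linear.suminf[OF bounded_clinear_bounded[OF Q] s])
      also have "\<dots> = 0" by (simp add: Q_simps QMk QQ bounded_clinear_0[OF Mk])
      finally show ?thesis .
    qed
    ultimately show ?thesis using bounded_clinearI[OF add scale bound] by blast
  qed
  have resolvent: "z \<notin> cspectrum M" if z: "r < norm z" "z \<noteq> \<mu>" for z
  proof -
    note Rz = R[OF z(1)]
    \<comment> \<open>The resolvent, assembled from its parts on the kernel and on the range of
      \<open>Q\<close>.\<close>
    define F where "F = (\<lambda>u. R z u + (1 / (z - \<mu>)) *\<^sub>C Q u)"
    obtain B1 where B1: "\<And>u. norm (R z u) \<le> B1 * norm u" using bounded_clinear_le Rz by metis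
    obtain B2 where B2: "\<And>u. norm (Q u) \<le> B2 * norm u" using bounded_clinear_le Q by metis
    have zl: "z - \<mu> \<noteq> 0" using z by simp
    have "bounded_clinear F"
    proof (rule bounded_clinearI)
      show "F (u + v) = F u + F v" for u v
        using Rz by (simp add: F_def bounded_clinear_add Q_simps scaleC_add_right)
      show "F (c *\<^sub>C u) = c *\<^sub>C F u" for c u
        using Rz by (simp add: F_def bounded_clinear_scaleC Q_simps scaleC_add_right scaleC_scaleC mult.commute)
      show "norm (F u) \<le> (B1 + norm (1 / (z - \<mu>)) * B2) * norm u" for u
      proof -
        have "norm (F u) \<le> norm (R z u) + norm (1 / (z - \<mu>)) * norm (Q u)"
          unfolding F_def by (metis norm_scaleC norm_triangle_ineq)
        also have "\<dots> \<le> B1 * norm u + norm (1 / (z - \<mu>)) * (B2 * norm u)"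
          by (intro add_mono mult_left_mono B1 B2) auto
        finally show ?thesis by (simp add: algebra_simps)
      qed
    qed
    moreover have "F (z *\<^sub>C u - M u) = u" for u
    proof -
      have "R z (z *\<^sub>C u - M u) = z *\<^sub>C R z u - M (R z u)"
        using Rz bounded_clinear_diff[of "R z"] bounded_clinear_scaleC[of "R z"] by metis
      moreover have "Q (z *\<^sub>C u - M u) = (z - \<mu>) *\<^sub>C Q u"
        by (simp add: Q_simps QM MQ scaleC_diff_left)
      ultimately show ?thesis using Rz zl by (simp add: F_def scaleC_scaleC)
    qed
    moreover have "z *\<^sub>C F u - M (F u) = u" for u
    proof -
      define k where "k = 1 / (z - \<mu>)"
      have k: "z * k - k * \<mu> = 1" using zl by (simp add: k_def diff_divide_distrib[symmetric])
      have "z *\<^sub>C F u - M (F u) = (z *\<^sub>C R z u - M (R z u)) + (z * k - k * \<mu>) *\<^sub>C Q u"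
        by (simp add: F_def k_def[symmetric] M_simps MQ scaleC_add_right scaleC_scaleC scaleC_diff_left)
      then show ?thesis using Rz by (simp add: k)
    qed
    ultimately show ?thesis unfolding cspectrum_def by blast
  qed
  have spec: "\<mu> \<in> cspectrum M"
  proof -
    have False if "bounded_clinear F" "\<forall>u. F (\<mu> *\<^sub>C u - M u) = u" for F
      using that(2)[rule_format, of g] bounded_clinear_0[OF that(1)] g by simp
    then show ?thesis unfolding cspectrum_def by blast
  qed
  have sub: "norm z \<le> r" if "z \<in> cspectrum M" "z \<noteq> \<mu>" for z
    using resolvent[of z] that by (meson not_le)
  have radius: "cspectral_radius M = norm \<mu>"
    unfolding cspectral_radius_def
    by (rule cSup_eq_maximum) (use spec sub r in force)+
  have "\<mu> isolated_in cspectrum M"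
    unfolding isolated_in_def
  proof (intro conjI exI[of _ "ball \<mu> (norm \<mu> - r)"])
    have "z = \<mu>" if "z \<in> ball \<mu> (norm \<mu> - r)" "z \<in> cspectrum M" for z
    proof (rule ccontr)
      assume "z \<noteq> \<mu>"
      then have "norm z \<le> r" using sub that(2) by blast
      moreover have "norm \<mu> \<le> norm (\<mu> - z) + norm z" using norm_triangle_ineq[of "\<mu> - z" z] by simp
      ultimately show False using that(1) by (simp add: dist_norm)
    qed
    then show "ball \<mu> (norm \<mu> - r) \<inter> cspectrum M = {\<mu>}" using spec r by auto
  qed (use spec in auto)
  moreover have "bij_betw (\<lambda>u. \<mu> *\<^sub>C u - M u) {u. Q u = 0} {u. Q u = 0}"
  proof (rule bij_betw_byWitness[where f' = "R \<mu>"])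
    note Rl = R[OF r(2)]
    show "\<forall>u\<in>{u. Q u = 0}. R \<mu> (\<mu> *\<^sub>C u - M u) = u"
    proof
      fix u assume "u \<in> {u. Q u = 0}"
      moreover have "R \<mu> (\<mu> *\<^sub>C u - M u) = \<mu> *\<^sub>C R \<mu> u - M (R \<mu> u)"
        using Rl bounded_clinear_diff[of "R \<mu>"] bounded_clinear_scaleC[of "R \<mu>"] by metis
      ultimately show "R \<mu> (\<mu> *\<^sub>C u - M u) = u" using Rl by simp
    qed
  qed (use R[OF r(2)] in \<open>auto simp: Q_simps QM M_simps\<close>)
  ultimately have "simple_isolated_eigenvalue M \<mu>"
    unfolding simple_isolated_eigenvalue_def
    by (intro conjI exI[of _ g] exI[of _ Q]) (use g Q QQ QM range in \<open>auto simp: fun_eq_iff\<close>)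
  moreover have "cspectrum M - {\<mu>} \<subseteq> cball 0 r"
  proof
    fix z assume "z \<in> cspectrum M - {\<mu>}"
    then show "z \<in> cball 0 r" using sub[of z] by simp
  qed
  ultimately show ?thesis
    unfolding spectral_gap_def radius using r by blast
qed

text \<open>\<open>f\<close> need not be an eigenfunctional, so f(y)g need not give a projection
  commuting with \<open>M\<close>. The limit \<nu>(y) of f(M^j y)/\<mu>^j is one, approached at rate
  \<eta>^j, and \<nu>(y)g is the spectral projection.\<close>

lemma spectral_gap_of_rank_one_approximation:
  fixes M :: "'c::complex_banach \<Rightarrow> 'c" and f :: "'c \<Rightarrow> complex"
  assumes M: "bounded_clinear M"
    and f: "\<And>u v. f (u + v) = f u + f v" "\<And>c u. f (c *\<^sub>C u) = c * f u" "\<And>u. norm (f u) \<le> B * norm u"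
    and g: "M g = \<mu> *\<^sub>C g" "\<mu> \<noteq> 0" "f g = 1" and \<eta>: "0 < \<eta>" "\<eta> < (1::real)"
    and est: "\<And>j y. N \<le> j \<Longrightarrow> norm ((M ^^ j) y - f ((M ^^ j) y) *\<^sub>C g) \<le> K * (\<eta> * norm \<mu>) ^ j * norm y"
  shows "spectral_gap M"
proof -
  note M_simps = bounded_clinear_add[OF M] bounded_clinear_diff[OF M] bounded_clinear_scaleC[OF M] bounded_clinear_0[OF M]
  note Mk = bounded_clinear_funpow[OF M]
  have fdiff: "f (u - v) = f u - f v" for u v
    using f(1)[of u "- v"] f(2)[of "-1" v] by simp
  have g0: "g \<noteq> 0"
  proof
    assume "g = 0"
    then show False using f(3)[of g] g(3) by simp
  qed
  have l: "0 < norm \<mu>" using g(2) by simp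
  obtain BM where BM: "0 < BM" "\<And>u. norm (M u) \<le> BM * norm u" using bounded_clinear_le[OF M] by blast
  have B0: "0 \<le> B" using f(3)[of g] g(3) g0 by (metis norm_ge_zero norm_one not_one_le_zero order_trans zero_le_mult_iff zero_less_norm_iff linorder_not_le)
  have Mg: "(M ^^ j) g = \<mu> ^ j *\<^sub>C g" for j
    by (induction j) (simp_all add: M_simps g(1) scaleC_scaleC mult.commute)
  define \<tau> where "\<tau> = (\<lambda>y j. f ((M ^^ j) y) / \<mu> ^ j)"
  define c where "c = B * BM * K / norm \<mu>"
  have step: "norm (\<tau> y (Suc j) - \<tau> y j) \<le> (c * norm y) * \<eta> ^ j" if "N \<le> j" for y j
  proof -
    let ?d = "(M ^^ j) y - f ((M ^^ j) y) *\<^sub>C g"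
    \<comment> \<open>As f(Mg) = \<mu>, the increment only sees the error \<open>?d\<close> of the
      rank-one approximation.\<close>
    have "\<tau> y (Suc j) - \<tau> y j = f (M ?d) / \<mu> ^ Suc j"
      using g(2) by (simp add: \<tau>_def M_simps fdiff f(2) g(1,3) scaleC_scaleC diff_divide_distrib)
    also have "norm \<dots> \<le> B * (BM * (K * (\<eta> * norm \<mu>) ^ j * norm y)) / norm \<mu> ^ Suc j"
    proof -
      have "norm (f (M ?d)) \<le> B * norm (M ?d)" by (rule f(3))
      also have "\<dots> \<le> B * (BM * norm ?d)" using B0 BM(2) by (intro mult_left_mono)
      also have "\<dots> \<le> B * (BM * (K * (\<eta> * norm \<mu>) ^ j * norm y))"
        using B0 BM(1) est[OF that, of y] by (intro mult_left_mono) auto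
      finally show ?thesis using l by (simp add: norm_divide norm_power norm_mult divide_right_mono)
    qed
    also have "\<dots> = (c * norm y) * \<eta> ^ j" using l by (simp add: c_def power_mult_distrib field_simps)
    finally show ?thesis .
  qed
  have "\<exists>l. (\<tau> y \<longlonglongrightarrow> l) \<and> (\<forall>n\<ge>N. norm (\<tau> y n - l) \<le> (c * norm y) * \<eta> ^ n / (1 - \<eta>))" for y
    using geometric_cauchy[of \<eta> N "\<tau> y" "c * norm y"] step[of _ y] \<eta> by (metis less_imp_le)
  then obtain \<nu> where \<nu>: "\<And>y. \<tau> y \<longlonglongrightarrow> \<nu> y"
    "\<And>y n. N \<le> n \<Longrightarrow> norm (\<tau> y n - \<nu> y) \<le> (c * norm y) * \<eta> ^ n / (1 - \<eta>)" by metis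
  have \<nu>add: "\<nu> (u + v) = \<nu> u + \<nu> v" for u v
  proof (rule LIMSEQ_unique[OF \<nu>(1)])
    have "\<tau> (u + v) = (\<lambda>j. \<tau> u j + \<tau> v j)"
      by (simp add: \<tau>_def bounded_clinear_add[OF Mk] f(1) add_divide_distrib)
    then show "\<tau> (u + v) \<longlonglongrightarrow> \<nu> u + \<nu> v" using tendsto_add[OF \<nu>(1)[of u] \<nu>(1)[of v]] by simp
  qed
  have \<nu>scale: "\<nu> (a *\<^sub>C u) = a * \<nu> u" for a u
  proof (rule LIMSEQ_unique[OF \<nu>(1)])
    have "\<tau> (a *\<^sub>C u) = (\<lambda>j. a * \<tau> u j)"
      by (simp add: \<tau>_def bounded_clinear_scaleC[OF Mk] f(2))
    then show "\<tau> (a *\<^sub>C u) \<longlonglongrightarrow> a * \<nu> u" using tendsto_mult[OF tendsto_const[of a] \<nu>(1)[of u]] by simp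
  qed
  have \<nu>M: "\<nu> (M u) = \<mu> * \<nu> u" for u
  proof (rule LIMSEQ_unique[OF \<nu>(1)])
    have "\<tau> (M u) = (\<lambda>j. \<mu> * \<tau> u (Suc j))"
      using g(2) by (simp add: \<tau>_def funpow_swap1)
    then show "\<tau> (M u) \<longlonglongrightarrow> \<mu> * \<nu> u"
      using tendsto_mult[OF tendsto_const[of \<mu>] LIMSEQ_Suc[OF \<nu>(1)[of u]]] by simp
  qed
  have \<nu>g: "\<nu> g = 1"
  proof (rule LIMSEQ_unique[OF \<nu>(1)])
    have "\<tau> g = (\<lambda>j. 1)" using g(2) by (simp add: \<tau>_def Mg f(2) g(3))
    then show "\<tau> g \<longlonglongrightarrow> 1" by simp
  qed
  obtain BN where BN: "0 < BN" "\<And>u. norm ((M ^^ N) u) \<le> BN * norm u" using bounded_clinear_le[OF Mk] by blast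
  define B\<nu> where "B\<nu> = B * BN / norm \<mu> ^ N + c * \<eta> ^ N / (1 - \<eta>)"
  have \<nu>bound: "norm (\<nu> y) \<le> B\<nu> * norm y" for y
  proof -
    have "norm (f ((M ^^ N) y)) \<le> B * (BN * norm y)"
      using f(3)[of "(M ^^ N) y"] mult_left_mono[OF BN(2)[of y] B0] by linarith
    then have "norm (\<tau> y N) \<le> B * (BN * norm y) / norm \<mu> ^ N"
      using l by (simp add: \<tau>_def norm_divide norm_power divide_right_mono)
    moreover have "norm (\<nu> y) \<le> norm (\<tau> y N) + norm (\<tau> y N - \<nu> y)"
      using norm_triangle_ineq4[of "\<tau> y N" "\<tau> y N - \<nu> y"] by simp
    ultimately have "norm (\<nu> y) \<le> B * (BN * norm y) / norm \<mu> ^ N + (c * norm y) * \<eta> ^ N / (1 - \<eta>)"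
      using \<nu>(2)[of N y] by linarith
    also have "\<dots> = B\<nu> * norm y" by (simp add: B\<nu>_def algebra_simps)
    finally show ?thesis .
  qed
  define Q where "Q = (\<lambda>y. \<nu> y *\<^sub>C g)"
  have Q: "bounded_clinear Q"
  proof (rule bounded_clinearI)
    show "norm (Q u) \<le> (B\<nu> * norm g) * norm u" for u
      using mult_right_mono[OF \<nu>bound[of u] norm_ge_zero[of g]] by (simp add: Q_def norm_scaleC algebra_simps)
  qed (simp_all add: Q_def \<nu>add \<nu>scale scaleC_add_left scaleC_scaleC)
  define r where "r = \<eta> * norm \<mu>"
  have r: "0 < r" "r < norm \<mu>" using \<eta> l by (auto simp: r_def)
  define K1 where "K1 = K + c / (1 - \<eta>) * norm g"
  have far: "norm ((M ^^ j) (y - Q y)) \<le> K1 * r ^ j * norm y" if j: "N \<le> j" for j y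
  proof -
    have "(M ^^ j) (y - Q y) = ((M ^^ j) y - f ((M ^^ j) y) *\<^sub>C g) + (\<mu> ^ j * (\<tau> y j - \<nu> y)) *\<^sub>C g"
      using g(2) by (simp add: Q_def bounded_clinear_diff[OF Mk] bounded_clinear_scaleC[OF Mk] Mg \<tau>_def
          scaleC_scaleC scaleC_diff_left right_diff_distrib mult.commute)
    then have "norm ((M ^^ j) (y - Q y)) \<le> norm ((M ^^ j) y - f ((M ^^ j) y) *\<^sub>C g) + norm \<mu> ^ j * norm (\<tau> y j - \<nu> y) * norm g"
      by (metis norm_mult norm_power norm_scaleC norm_triangle_ineq)
    also have "\<dots> \<le> K * r ^ j * norm y + norm \<mu> ^ j * ((c * norm y) * \<eta> ^ j / (1 - \<eta>)) * norm g"
      using est[OF j, of y] \<nu>(2)[OF j, of y] unfolding r_def by (intro add_mono mult_right_mono mult_left_mono) auto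
    also have "\<dots> = K1 * r ^ j * norm y" by (simp add: K1_def r_def power_mult_distrib algebra_simps)
    finally show ?thesis .
  qed
  have "\<exists>b>0. \<forall>y. norm ((M ^^ j) (y - Q y)) \<le> b * norm y" for j
  proof -
    obtain b1 where b1: "0 < b1" "\<And>u. norm ((M ^^ j) u) \<le> b1 * norm u" using bounded_clinear_le[OF Mk] by blast
    obtain b2 where b2: "0 < b2" "\<And>u. norm (Q u) \<le> b2 * norm u" using bounded_clinear_le[OF Q] by blast
    have "norm ((M ^^ j) (y - Q y)) \<le> (b1 * (1 + b2)) * norm y" for y
    proof -
      have "norm ((M ^^ j) (y - Q y)) \<le> b1 * norm (y - Q y)" by (rule b1)
      also have "\<dots> \<le> b1 * (norm y + b2 * norm y)"
        using b1(1) norm_triangle_ineq4[of y "Q y"] b2(2)[of y] by (intro mult_left_mono) auto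
      finally show ?thesis by (simp add: algebra_simps)
    qed
    then show ?thesis using b1(1) b2(1) by (intro exI[of _ "b1 * (1 + b2)"]) auto
  qed
  then obtain b where b: "\<And>j. 0 < b j" "\<And>j y. norm ((M ^^ j) (y - Q y)) \<le> b j * norm y" by metis
  \<comment> \<open>The estimate starts only at \<open>N\<close>; the finitely many earlier powers
    are absorbed in the constant.\<close>
  define K2 where "K2 = \<bar>K1\<bar> + (\<Sum>j<N. b j / r ^ j)"
  have sum0: "0 \<le> (\<Sum>j<N. b j / r ^ j)" using b(1) r by (intro sum_nonneg) (simp add: less_imp_le)
  have decay: "norm ((M ^^ j) (y - Q y)) \<le> K2 * r ^ j * norm y" for j y
  proof (cases "N \<le> j")
    case True
    have "K1 * r ^ j * norm y \<le> K2 * r ^ j * norm y"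
      using sum0 r by (intro mult_right_mono) (auto simp: K2_def)
    then show ?thesis using far[OF True, of y] by linarith
  next
    case False
    have "b j / r ^ j \<le> (\<Sum>j<N. b j / r ^ j)"
      using False b(1) r by (intro member_le_sum) (auto simp: less_imp_le)
    then have "b j / r ^ j \<le> K2" by (simp add: K2_def)
    then have "b j \<le> K2 * r ^ j" using r by (simp add: pos_divide_le_eq)
    then have "b j * norm y \<le> K2 * r ^ j * norm y" by (intro mult_right_mono) auto
    then show ?thesis using b(2)[of j y] by linarith
  qed
  have "range Q = range (\<lambda>c. c *\<^sub>C g)"
  proof safe
    fix a show "a *\<^sub>C g \<in> range Q"
      by (rule range_eqI[of _ _ "a *\<^sub>C g"]) (simp add: Q_def \<nu>scale \<nu>g)
  qed (simp add: Q_def)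
  then show ?thesis
    by (intro spectral_gap_rank_one[OF M Q g0 g(1) _ _ _ decay])
      (use r in \<open>auto simp: Q_def \<nu>scale \<nu>g \<nu>M M_simps g(1) scaleC_scaleC mult.commute\<close>)
qed

section \<open>Contraction and the spectral gap\<close>

lemma span_pair: "u \<in> span {x, y} \<longleftrightarrow> (\<exists>a b. u = a *\<^sub>R x + b *\<^sub>R y)"
proof -
  have "u \<in> span {x, y} \<longleftrightarrow> (\<exists>a. u - a *\<^sub>R x \<in> span {y})" by (rule span_breakdown_eq)
  also have "\<dots> \<longleftrightarrow> (\<exists>a b. u - a *\<^sub>R x = b *\<^sub>R y)" by (auto simp: span_singleton)
  also have "\<dots> \<longleftrightarrow> (\<exists>a b. u = a *\<^sub>R x + b *\<^sub>R y)" by (simp add: algebra_simps)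
  finally show ?thesis .
qed

text \<open>The supremum in \<open>norm_on\<close> is meaningful only for a bounded set. For a
  functional that is merely linear, boundedness comes from finite dimension, by compactness of the
  unit circle of coefficients.\<close>

lemma linear_bounded_on_span_pair:
  fixes m :: "'r::real_normed_vector \<Rightarrow> real"
  assumes m: "linear m"
  obtains B where "\<And>u. u \<in> span {x, y} \<Longrightarrow> \<bar>m u\<bar> \<le> B * norm u"
proof -
  define v where "v = (\<lambda>z::complex. Re z *\<^sub>R x + Im z *\<^sub>R y)"
  have span_v: "\<exists>z. u = v z" if "u \<in> span {x, y}" for u
    using that unfolding span_pair v_def by (metis complex.sel)
  have "compact (sphere (0::complex) 1)" "sphere (0::complex) 1 \<noteq> {}" by auto
  moreover have "continuous_on (sphere 0 1) (\<lambda>z. norm (v z))"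
    unfolding v_def by (intro continuous_intros)
  ultimately obtain z0 where z0: "z0 \<in> sphere 0 1" "\<And>z. z \<in> sphere 0 1 \<Longrightarrow> norm (v z0) \<le> norm (v z)"
    using continuous_attains_inf[of "sphere 0 1" "\<lambda>z. norm (v z)"] by blast
  show ?thesis
  proof (cases "v z0 = 0")
    case False
    have lower: "norm (v z0) * norm z \<le> norm (v z)" for z
    proof (cases "z = 0")
      case False
      have "norm z * Re (sgn z) = Re z" "norm z * Im (sgn z) = Im z"
        using False by (simp_all add: sgn_div_norm flip: mult.assoc)
      then have "v z = norm z *\<^sub>R v (sgn z)"
        by (simp only: v_def scaleR_add_right scaleR_scaleR)
      moreover have "norm (v z0) \<le> norm (v (sgn z))"
        using False by (intro z0) (simp add: norm_sgn)
      ultimately show ?thesis by (simp add: mult.commute mult_left_mono)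
    qed (simp add: v_def)
    show ?thesis
    proof (rule that[of "(\<bar>m x\<bar> + \<bar>m y\<bar>) / norm (v z0)"])
      fix u assume "u \<in> span {x, y}"
      then obtain z where u: "u = v z" using span_v by blast
      have "\<bar>m u\<bar> \<le> \<bar>Re z\<bar> * \<bar>m x\<bar> + \<bar>Im z\<bar> * \<bar>m y\<bar>"
        unfolding u v_def linear_add[OF m] linear_scale[OF m]
        by (metis abs_mult abs_triangle_ineq real_scaleR_def)
      also have "\<dots> \<le> norm z * \<bar>m x\<bar> + norm z * \<bar>m y\<bar>"
        by (intro add_mono mult_right_mono abs_Re_le_cmod abs_Im_le_cmod) auto
      also have "\<dots> = (\<bar>m x\<bar> + \<bar>m y\<bar>) * norm z" by (simp add: algebra_simps)
      also have "\<dots> \<le> (\<bar>m x\<bar> + \<bar>m y\<bar>) * (norm u / norm (v z0))"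
        using lower[of z] False by (intro mult_left_mono) (auto simp: u field_simps)
      finally show "\<bar>m u\<bar> \<le> (\<bar>m x\<bar> + \<bar>m y\<bar>) / norm (v z0) * norm u" by simp
    qed
  next
    case True
    \<comment> \<open>Here x and y are linearly dependent, so the span is generated by one
      vector.\<close>
    have "\<exists>w. \<forall>u\<in>span {x, y}. \<exists>c. u = c *\<^sub>R w"
    proof (cases "Re z0 = 0")
      case True
      then have "Im z0 \<noteq> 0" using z0(1) by (auto simp: cmod_def)
      then have y0: "y = 0" using \<open>v z0 = 0\<close> True by (simp add: v_def)
      show ?thesis
        by (rule exI[of _ x]) (auto simp: span_pair y0)
    next
      case False
      have "Re z0 *\<^sub>R x = - (Im z0 *\<^sub>R y)" using \<open>v z0 = 0\<close> by (simp add: v_def add_eq_0_iff)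
      then have "x = (1 / Re z0) *\<^sub>R (- (Im z0 *\<^sub>R y))" using False
        by (metis (no_types, lifting) divide_self_if scaleR_one scaleR_scaleR times_divide_eq_left mult_1)
      then have "x = (- (Im z0 / Re z0)) *\<^sub>R y" by simp
      then have "a *\<^sub>R x + b *\<^sub>R y = (a * (- (Im z0 / Re z0)) + b) *\<^sub>R y" for a b
        by (metis scaleR_left_distrib scaleR_scaleR)
      then show ?thesis by (intro exI[of _ y]) (auto simp: span_pair)
    qed
    then obtain w where w: "\<And>u. u \<in> span {x, y} \<Longrightarrow> \<exists>c. u = c *\<^sub>R w" by blast
    show ?thesis
    proof (rule that[of "\<bar>m w\<bar> / norm w"])
      fix u assume "u \<in> span {x, y}"
      then obtain c where u: "u = c *\<^sub>R w" using w by blast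
      show "\<bar>m u\<bar> \<le> \<bar>m w\<bar> / norm w * norm u"
        using linear_0[OF m] by (cases "w = 0") (auto simp: u linear_scale[OF m] abs_mult)
    qed
  qed
qed

context complexified_cone
begin

text \<open>The aperture functional m has no opposite signs at x and y - x: otherwise a positive
  combination of the two, a point of \<open>C\<close> killed by m, would be 0, against pointedness.
  So |m(x)| \<le> |m(y)|, and the aperture bound turns this into a comparison of norms.\<close>

lemma cone_normal:
  assumes "bounded_sectional_aperture C"
  obtains K where "0 < K" "\<And>x y. x \<in> C \<Longrightarrow> y - x \<in> C \<Longrightarrow> norm x \<le> K * norm y"
proof -
  obtain K where K: "0 < K" and ap: "\<And>x y. (x, y) \<noteq> (0, 0) \<Longrightarrow>
      \<exists>m. linear m \<and> (\<exists>u\<in>span {x, y}. m u \<noteq> 0) \<and>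
        (\<forall>u\<in>span {x, y} \<inter> C. \<bar>m u\<bar> \<ge> 1 / K * norm u * norm_on (span {x, y}) m)"
    using assms unfolding bounded_sectional_aperture_def by blast
  have "norm x \<le> K * norm y" if xy: "x \<in> C" "y - x \<in> C" for x y
  proof (cases "x = 0")
    case True
    then show ?thesis using K by simp
  next
    case False
    then obtain m where m: "linear m" "\<exists>u\<in>span {x, y}. m u \<noteq> 0"
      and low: "\<And>u. u \<in> span {x, y} \<Longrightarrow> u \<in> C \<Longrightarrow> 1 / K * norm u * norm_on (span {x, y}) m \<le> \<bar>m u\<bar>"
      using ap[of x y] by auto
    define N where "N = norm_on (span {x, y}) m"
    obtain B where B: "\<And>u. u \<in> span {x, y} \<Longrightarrow> \<bar>m u\<bar> \<le> B * norm u"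
      using linear_bounded_on_span_pair[OF m(1)] by blast
    have bdd: "bdd_above ((\<lambda>u. \<bar>m u\<bar> / norm u) ` (span {x, y} - {0}))"
      by (rule bdd_aboveI2[of _ _ B]) (use B in \<open>auto simp: pos_divide_le_eq\<close>)
    have up: "\<bar>m u\<bar> \<le> N * norm u" if "u \<in> span {x, y}" for u
    proof (cases "u = 0")
      case False
      have "\<bar>m u\<bar> / norm u \<le> N"
        unfolding N_def norm_on_def using that False by (intro cSUP_upper bdd) auto
      then show ?thesis using False by (simp add: pos_divide_le_eq)
    qed (simp add: linear_0[OF m(1)])
    obtain u0 where u0: "u0 \<in> span {x, y}" "m u0 \<noteq> 0" using m(2) by blast
    have "0 < \<bar>m u0\<bar>" using u0(2) by simp
    also have "\<dots> \<le> N * norm u0" by (rule up[OF u0(1)])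
    finally have N: "0 < N" using norm_ge_zero[of u0] by (simp add: zero_less_mult_iff)
    have sx: "x \<in> span {x, y}" "y \<in> span {x, y}" by (auto intro: span_base)
    have "0 \<le> m x * m (y - x)"
    proof (rule ccontr)
      assume neg: "\<not> 0 \<le> m x * m (y - x)"
      define z where "z = \<bar>m (y - x)\<bar> *\<^sub>R x + \<bar>m x\<bar> *\<^sub>R (y - x)"
      have zC: "z \<in> C" unfolding z_def by (intro cone_add cone_scaleR xy) auto
      have zs: "z \<in> span {x, y}" unfolding z_def by (intro span_add span_scale span_diff sx)
      have "m z = \<bar>m (y - x)\<bar> * m x + \<bar>m x\<bar> * m (y - x)"
        by (simp add: z_def linear_add[OF m(1)] linear_scale[OF m(1)])
      also have "\<dots> = 0" using neg by (auto simp: not_le mult_less_0_iff abs_if)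
      finally have "1 / K * norm z * N \<le> 0" using low[OF zs zC] by (simp add: N_def)
      then have "z = 0" using K N by (simp add: mult_le_0_iff divide_le_0_iff)
      then have "- (\<bar>m (y - x)\<bar> *\<^sub>R x) = \<bar>m x\<bar> *\<^sub>R (y - x)" by (simp add: z_def eq_neg_iff_add_eq_0 add.commute neg_eq_iff_add_eq_0)
      then have "- (\<bar>m (y - x)\<bar> *\<^sub>R x) \<in> C" using cone_scaleR[OF xy(2)] by simp
      then have "\<bar>m (y - x)\<bar> *\<^sub>R x = 0" by (rule cone_pointed[OF cone_scaleR[OF xy(1) abs_ge_zero]])
      then show False using neg False by simp
    qed
    then have "\<bar>m x\<bar> \<le> \<bar>m x + m (y - x)\<bar>"
      by (auto simp: zero_le_mult_iff abs_if)
    also have "m x + m (y - x) = m y" using linear_add[OF m(1), of x "y - x"] by simp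
    finally have "1 / K * norm x * N \<le> N * norm y"
      using low[OF sx(1) xy(1)] up[OF sx(2)] by (simp add: N_def)
    then have "N * (norm x / K) \<le> N * norm y" by (simp add: algebra_simps)
    then have "norm x / K \<le> norm y" by (rule mult_left_le_imp_le) (rule N)
    then show ?thesis using K by (simp add: pos_divide_le_eq mult.commute)
  qed
  then show ?thesis using K that by blast
qed

text \<open>If |l(x)| \<le> b l(e) on the dual cone, then be + x lies between 0 and 2be in the order
  of \<open>C\<close>, so normality bounds its norm; complex vectors are treated by
  components.\<close>

lemma norm_le_bounded_by:
  assumes "bounded_sectional_aperture C"
  obtains K where "0 < K" "\<And>e b u. e \<in> C \<Longrightarrow> 0 \<le> b \<Longrightarrow> bounded_by e b u \<Longrightarrow> norm u \<le> K * b * norm e"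
proof -
  obtain K where K: "0 < K" "\<And>x y. x \<in> C \<Longrightarrow> y - x \<in> C \<Longrightarrow> norm x \<le> K * norm y"
    using cone_normal[OF assms] by blast
  have real: "norm x \<le> (2 * K + 1) * b * norm e"
    if e: "e \<in> C" "0 \<le> b" and x: "\<And>l. l \<in> dual_cone C \<Longrightarrow> \<bar>l x\<bar> \<le> b * l e" for x e b
  proof -
    have "b *\<^sub>R e + x \<in> C" "b *\<^sub>R e - x \<in> C" using order_interval_cone[OF x] by auto
    moreover have "(2 * b) *\<^sub>R e = b *\<^sub>R e + b *\<^sub>R e" by (simp flip: scaleR_left_distrib)
    then have "(2 * b) *\<^sub>R e - (b *\<^sub>R e + x) = b *\<^sub>R e - x" by simp
    ultimately have "norm (b *\<^sub>R e + x) \<le> K * norm ((2 * b) *\<^sub>R e)"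
      using K(2)[of "b *\<^sub>R e + x" "(2 * b) *\<^sub>R e"] by metis
    moreover have "norm x \<le> norm (b *\<^sub>R e + x) + norm (b *\<^sub>R e)"
      using norm_triangle_ineq4[of "b *\<^sub>R e + x" "b *\<^sub>R e"] by simp
    ultimately show ?thesis using e(2) by (simp add: algebra_simps)
  qed
  have "norm u \<le> (2 * (2 * K + 1)) * b * norm e"
    if e: "e \<in> C" "0 \<le> b" and u: "bounded_by e b u" for e b u
  proof -
    note parts = bounded_by_parts[OF u]
    have "norm (re_part \<iota> J u) \<le> (2 * K + 1) * b * norm e" "norm (im_part \<iota> J u) \<le> (2 * K + 1) * b * norm e"
      using real[OF e parts(1)] real[OF e parts(2)] by auto
    then show ?thesis using norm_le_parts[of u] by (simp add: algebra_simps)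
  qed
  then show ?thesis using that[of "2 * (2 * K + 1)"] K(1) by auto
qed

end

context dominated_operator
begin

text \<open>Domination bounds \<open>M\<close> on \<open>C\<close> only; a real x in the order
  interval of be is half the difference of be + x and be - x, both in \<open>C\<close>.\<close>

lemma bounded_by_M:
  assumes "bounded_by e b u" "e \<in> C" "0 \<le> b"
  shows "bounded_by (P e) (2 * sqrt \<beta> * b) (M u)"
  unfolding bounded_by_def
proof
  fix l assume l: "l \<in> dual_cone C"
  have part: "norm (cp l (M (\<iota> x))) \<le> sqrt \<beta> * b * l (P e)"
    if x: "\<And>k. k \<in> dual_cone C \<Longrightarrow> \<bar>blinfun_apply k x\<bar> \<le> b * k e" for x
  proof -
    note C = order_interval_cone[OF x]
    have "2 *\<^sub>R M (\<iota> x) = M (\<iota> (b *\<^sub>R e + x)) - M (\<iota> (b *\<^sub>R e - x))"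
      by (simp add: iota_add iota_diff M_add M_diff scaleR_2)
    then have "2 * norm (cp l (M (\<iota> x))) = norm (cp l (M (\<iota> (b *\<^sub>R e + x))) - cp l (M (\<iota> (b *\<^sub>R e - x))))"
      using cpair_scaleR[of l 2 "M (\<iota> x)"] by (metis cpair_diff norm_mult norm_of_real abs_numeral)
    also have "\<dots> \<le> sqrt \<beta> * l (P (b *\<^sub>R e + x)) + sqrt \<beta> * l (P (b *\<^sub>R e - x))"
      using domination_upper[OF l C(1)] domination_upper[OF l C(2)]
        norm_triangle_ineq4[of "cp l (M (\<iota> (b *\<^sub>R e + x)))" "cp l (M (\<iota> (b *\<^sub>R e - x)))"] by linarith
    also have "\<dots> = 2 * (sqrt \<beta> * b * l (P e))"
      by (simp add: P_add P_diff P_scaleR blinfun.bilinear_simps algebra_simps)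
    finally show ?thesis by simp
  qed
  note parts = bounded_by_parts[OF assms(1)]
  have "M u = M (\<iota> (re_part \<iota> J u)) + \<i> *\<^sub>C M (\<iota> (im_part \<iota> J u))"
    by (metis M_add M_scaleC re_im_part)
  then have "norm (cp l (M u)) \<le> norm (cp l (M (\<iota> (re_part \<iota> J u)))) + norm (cp l (M (\<iota> (im_part \<iota> J u))))"
    using norm_triangle_ineq[of "cp l (M (\<iota> (re_part \<iota> J u)))" "\<i> * cp l (M (\<iota> (im_part \<iota> J u)))"]
    by (simp add: norm_mult)
  then show "norm (cp l (M u)) \<le> 2 * sqrt \<beta> * b * l (P e)"
    using part[OF parts(1)] part[OF parts(2)] by simp
qed

abbreviation ratio :: "('r \<Rightarrow>\<^sub>L real) \<Rightarrow> ('r \<Rightarrow>\<^sub>L real) \<Rightarrow> nat \<Rightarrow> 'c \<Rightarrow> complex" where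
  "ratio m l n u \<equiv> cp m ((M ^^ Suc n) u) / cp l ((M ^^ Suc n) u)"

lemma relevant_power_nonzero: "relevant l \<Longrightarrow> u \<in> CC - {0} \<Longrightarrow> cp l ((M ^^ Suc n) u) \<noteq> 0"
  using relevant_M_nonzero[OF _ M_power_invariant] by simp

lemma Re_ratio_pos:
  assumes "relevant m" "relevant l" "u \<in> CC - {0}"
  shows "0 < Re (ratio m l n u)"
proof -
  let ?v = "(M ^^ n) u"
  obtain w where w: "w \<in> C - {0}" "inside (P w) \<delta> (M ?v)" using M_CC[OF M_power_invariant[OF assms(3)]] by metis
  have "0 < \<delta> * m (P w) * l (P w)" using assms w(1) delta_pos by (simp add: relevant_def)
  also have "\<dots> \<le> Re (cp m (M ?v) * cnj (cp l (M ?v)))"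
    using w(2) assms relevant_dual by (simp add: inside_def)
  finally have "0 < Re (cp m (M ?v) * cnj (cp l (M ?v)))" .
  moreover have "cp m (M ?v) / cp l (M ?v) = (cp m (M ?v) * cnj (cp l (M ?v))) / of_real ((norm (cp l (M ?v)))\<^sup>2)"
    unfolding complex_div_cnj[of "cp m (M ?v)"] by simp
  moreover have "cp l (M ?v) \<noteq> 0" using relevant_power_nonzero[OF assms(2,3)] by simp
  ultimately show ?thesis by simp
qed

text \<open>The value of a ratio of two functionals along a disk through \<open>M u\<close> and \<open>M v\<close> is a function to the
  right half-plane, so that by Schwarz's lemma each application of \<open>M\<close> contracts its pseudo-hyperbolic
  oscillation by a fixed factor.\<close>

lemma ratio_contraction:
  assumes disk: "\<And>u v. u \<in> CC - {0} \<Longrightarrow> v \<in> CC - {0} \<Longrightarrow> \<exists>a b. disk_through k (M u) (M v) a b"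
    and k: "0 < k" "k < 1" and rel: "relevant m" "relevant l"
  shows "u \<in> CC - {0} \<Longrightarrow> v \<in> CC - {0} \<Longrightarrow>
    norm (ratio m l n u - ratio m l n v) \<le> schwarz_factor k ^ n * norm (ratio m l n u + cnj (ratio m l n v))"
proof (induction n arbitrary: u v)
  \<comment> \<open>\<open>ratio m l n\<close> contains n + 1 powers of \<open>M\<close>; the first
    only brings the values into the right half-plane, so no factor is gained yet.\<close>
  case 0
  define p q where "p = ratio m l 0 u" and "q = ratio m l 0 v"
  have "0 < Re p" "0 < Re q" unfolding p_def q_def using Re_ratio_pos rel 0 by blast+
  then have "0 < Re p * Re q" by simp
  moreover have "(norm (p + cnj q))\<^sup>2 - (norm (p - q))\<^sup>2 = 4 * (Re p * Re q)"
    unfolding cmod_power2 by (simp add: power2_eq_square algebra_simps)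
  ultimately have "(norm (p - q))\<^sup>2 \<le> (norm (p + cnj q))\<^sup>2" by linarith
  then have "norm (p - q) \<le> norm (p + cnj q)" by (rule power2_le_imp_le) simp
  then show ?case by (simp only: p_def q_def power_0 mult_1_left)
next
  case (Suc n)
  obtain a b where "disk_through k (M u) (M v) a b" using disk Suc.prems by blast
  then obtain e d where hol: "a holomorphic_on ball 0 1" "b holomorphic_on ball 0 1"
    and ends: "a (of_real k) \<noteq> 0" "b (of_real k) = 0" "a (- of_real k) = 0" "b (- of_real k) \<noteq> 0"
    and e: "e \<in> C - {0}" "0 < d" "\<And>z. norm z < 1 \<Longrightarrow> inside (P e) d (a z *\<^sub>C M u + b z *\<^sub>C M v)"
    unfolding disk_through_def by blast
  define \<Gamma> where "\<Gamma> = (\<lambda>z. a z *\<^sub>C M u + b z *\<^sub>C M v)"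
  have \<Gamma>: "\<Gamma> z \<in> CC - {0}" if z: "norm z < 1" for z
  proof -
    have "\<Gamma> z \<in> CC" using inside_CC[OF e(3)[OF z]] e(1,2) P_in by (simp add: \<Gamma>_def)
    moreover have "cp l (\<Gamma> z) \<noteq> 0"
      using inside_nonzero[OF e(3)[OF z] relevant_dual[OF rel(2)] e(2)] rel(2) e(1)
      by (simp add: \<Gamma>_def relevant_def)
    ultimately show ?thesis by auto
  qed
  note Mn = bounded_clinear_funpow[OF M_clinear]
  define W where "W = (\<lambda>z. ratio m l n (\<Gamma> z))"
  have cp_lin: "cp j ((M ^^ Suc n) (\<Gamma> z)) = a z * cp j ((M ^^ Suc n) (M u)) + b z * cp j ((M ^^ Suc n) (M v))" for j z
    unfolding \<Gamma>_def bounded_clinear_add[OF Mn] bounded_clinear_scaleC[OF Mn] by simp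
  have "W holomorphic_on ball 0 1"
  proof -
    have "(\<lambda>z. (a z * cp m ((M ^^ Suc n) (M u)) + b z * cp m ((M ^^ Suc n) (M v))) /
        (a z * cp l ((M ^^ Suc n) (M u)) + b z * cp l ((M ^^ Suc n) (M v)))) holomorphic_on ball 0 1"
    proof (intro holomorphic_intros hol)
      fix z :: complex assume "z \<in> ball 0 1"
      then have "cp l ((M ^^ Suc n) (\<Gamma> z)) \<noteq> 0" using \<Gamma>[of z] relevant_power_nonzero[OF rel(2)] by simp
      then show "a z * cp l ((M ^^ Suc n) (M u)) + b z * cp l ((M ^^ Suc n) (M v)) \<noteq> 0"
        by (simp only: cp_lin not_False_eq_True)
    qed
    then show ?thesis unfolding W_def cp_lin .
  qed
  moreover have "0 < Re (W z)" if "norm z < 1" for z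
    unfolding W_def by (rule Re_ratio_pos[OF rel \<Gamma>[OF that]])
  \<comment> \<open>The inductive hypothesis, applied at every point of the disk, supplies the prior
    bound that \<open>halfplane_contraction\<close> improves.\<close>
  moreover have "norm (W z - W (- of_real k)) \<le> schwarz_factor k ^ n * norm (W z + cnj (W (- of_real k)))"
    if "norm z < 1" for z
    unfolding W_def using k by (intro Suc.IH \<Gamma> that) auto
  ultimately have "norm (W (of_real k) - W (- of_real k))
      \<le> schwarz_factor k ^ n * schwarz_factor k * norm (W (of_real k) + cnj (W (- of_real k)))"
    by (rule halfplane_contraction[OF _ _ _ k])
  \<comment> \<open>At k and -k the disk passes through nonzero multiples of M u and M v, and the
    ratio is unchanged by such factors.\<close>
  moreover have "W (of_real k) = ratio m l (Suc n) u" "W (- of_real k) = ratio m l (Suc n) v"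
    using ends by (simp_all only: W_def cp_lin) (simp_all add: funpow_swap1)
  ultimately show ?case by (simp add: mult.commute)
qed

text \<open>The ratio at x + ry divided by the ratio at x is (1 + p)/(1 + q), with p and q the two
  quotients times r, so \<open>ratio_contraction\<close> makes p - q small. Both have modulus at
  most 1 because a functional can vanish along x + ty only for |t| > r.\<close>

lemma functional_quotients_close:
  assumes disk: "\<And>u v. u \<in> CC - {0} \<Longrightarrow> v \<in> CC - {0} \<Longrightarrow> \<exists>a b. disk_through k (M u) (M v) a b"
    and k: "0 < k" "k < 1" and rel: "relevant m" "relevant l"
    and r: "0 < r" "\<And>t. norm t \<le> r \<Longrightarrow> x + t *\<^sub>C y \<in> CC - {0}"
  shows "norm (cp m ((M ^^ Suc n) y) / cp m ((M ^^ Suc n) x) - cp l ((M ^^ Suc n) y) / cp l ((M ^^ Suc n) x))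
    \<le> 4 * schwarz_factor k ^ n / r"
proof -
  define \<eta> where "\<eta> = schwarz_factor k"
  have \<eta>: "0 \<le> \<eta> ^ n" using schwarz_factor_bounds[OF k] by (simp add: \<eta>_def)
  define X Y where "X = (\<lambda>j. cp j ((M ^^ Suc n) x))" and "Y = (\<lambda>j. cp j ((M ^^ Suc n) y))"
  note Mn = bounded_clinear_funpow[OF M_clinear]
  have lin: "cp j ((M ^^ Suc n) (x + t *\<^sub>C y)) = X j + t * Y j" for j t
    unfolding X_def Y_def bounded_clinear_add[OF Mn] bounded_clinear_scaleC[OF Mn] by simp
  have xC: "x \<in> CC - {0}" using r(2)[of 0] r(1) by simp
  have X0: "X j \<noteq> 0" if "relevant j" for j
    unfolding X_def by (rule relevant_power_nonzero[OF that xC])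
  have A: "r * norm (Y j / X j) \<le> 1" if j: "relevant j" for j
  proof (rule ccontr)
    assume "\<not> r * norm (Y j / X j) \<le> 1"
    then have big: "1 < r * norm (Y j / X j)" by simp
    then have "Y j \<noteq> 0" using r(1) by auto
    define t where "t = - X j / Y j"
    have "norm t \<le> r"
      using big \<open>Y j \<noteq> 0\<close> X0[OF j] by (simp add: t_def norm_divide field_simps)
    then have "cp j ((M ^^ Suc n) (x + t *\<^sub>C y)) \<noteq> 0" by (intro relevant_power_nonzero[OF j] r(2))
    then show False using \<open>Y j \<noteq> 0\<close> by (simp only: lin) (simp add: t_def)
  qed
  define p q where "p = of_real r * (Y m / X m)" and "q = of_real r * (Y l / X l)"
  have pq: "norm p \<le> 1" "norm q \<le> 1"
    using A[OF rel(1)] A[OF rel(2)] r(1) by (simp_all only: p_def q_def norm_mult norm_of_real abs_of_pos)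
  have eq: "X m + of_real r * Y m = X m * (1 + p)" "X l + of_real r * Y l = X l * (1 + q)"
    using X0 rel by (auto simp: p_def q_def field_simps)
  have rC: "x + of_real r *\<^sub>C y \<in> CC - {0}" using r by simp
  have q1: "1 + q \<noteq> 0"
    using relevant_power_nonzero[OF rel(2) rC, of n] X0[OF rel(2)] by (simp only: lin eq) simp
  have "norm (ratio m l n (x + of_real r *\<^sub>C y) - ratio m l n x)
      \<le> \<eta> ^ n * norm (ratio m l n (x + of_real r *\<^sub>C y) + cnj (ratio m l n x))"
    unfolding \<eta>_def by (rule ratio_contraction[OF disk k rel rC xC])
  also have "\<dots> \<le> \<eta> ^ n * (norm (ratio m l n (x + of_real r *\<^sub>C y)) + norm (ratio m l n x))"
  proof (rule mult_left_mono[OF _ \<eta>])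
    show "norm (p + cnj q) \<le> norm p + norm q" for p q :: complex
      using norm_triangle_ineq[of p "cnj q"] by simp
  qed
  finally have main: "norm (X m * (1 + p) / (X l * (1 + q)) - X m / X l)
      \<le> \<eta> ^ n * (norm (X m * (1 + p) / (X l * (1 + q))) + norm (X m / X l))"
    by (simp only: lin eq) (simp add: X_def)
  define c where "c = X m / (X l * (1 + q))"
  have c: "c \<noteq> 0" using X0 rel q1 by (simp add: c_def)
  have c1: "X m * (1 + p) / (X l * (1 + q)) = c * (1 + p)" "X m / X l = c * (1 + q)"
    using q1 X0 rel by (simp_all add: c_def)
  have "norm c * norm (p - q) = norm (c * (1 + p) - c * (1 + q))"
    by (simp add: norm_mult flip: right_diff_distrib)
  also have "\<dots> \<le> \<eta> ^ n * (norm (c * (1 + p)) + norm (c * (1 + q)))"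
    using main unfolding c1 .
  also have "\<dots> = norm c * (\<eta> ^ n * (norm (1 + p) + norm (1 + q)))"
    unfolding norm_mult by (simp add: algebra_simps)
  finally have "norm c * norm (p - q) \<le> norm c * (\<eta> ^ n * (norm (1 + p) + norm (1 + q)))" .
  then have "norm (p - q) \<le> \<eta> ^ n * (norm (1 + p) + norm (1 + q))" using c by simp
  also have "\<dots> \<le> \<eta> ^ n * 4"
  proof -
    have "norm (1 + p) \<le> 2" "norm (1 + q) \<le> 2"
      using norm_triangle_ineq[of 1 p] norm_triangle_ineq[of 1 q] pq by auto
    then show ?thesis using \<eta> by (intro mult_left_mono) auto
  qed
  finally have "norm (p - q) \<le> \<eta> ^ n * 4" .
  moreover have "norm (p - q) = r * norm (Y m / X m - Y l / X l)"
    unfolding p_def q_def right_diff_distrib[symmetric] norm_mult using r(1) by simp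
  ultimately show ?thesis using r(1) by (simp add: X_def Y_def \<eta>_def pos_le_divide_eq mult.commute)
qed

end

lemma tendsto_scaleC:
  fixes u :: "'c::complex_banach"
  assumes "(a \<longlongrightarrow> c) F" "(f \<longlongrightarrow> u) F"
  shows "((\<lambda>n. a n *\<^sub>C f n) \<longlongrightarrow> c *\<^sub>C u) F"
proof -
  have "bounded_bilinear (\<lambda>c (u::'c). c *\<^sub>C u)"
  proof
    show "\<exists>K. \<forall>a (b::'c). norm (a *\<^sub>C b) \<le> norm a * norm b * K"
      by (intro exI[of _ 1]) (simp add: norm_scaleC)
  qed (simp_all add: scaleC_add_left scaleC_add_right scaleC_scaleC_real scaleR_conv_of_real mult.commute)
  then show ?thesis by (rule bounded_bilinear.tendsto[OF _ assms])
qed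

context dominated_operator
begin

text \<open>One application of \<open>M\<close> beyond \<open>n0\<close> replaces x0 by P(x0) as
  order unit, to which the cross-ratio bounds apply.\<close>

lemma order_unit:
  assumes "inner_regular \<iota> J C (M ^^ n0)"
  obtains x0 c where "x0 \<in> C - {0}" "0 \<le> c" "\<And>u. bounded_by (P x0) (c * norm u) ((M ^^ Suc n0) u)"
proof -
  obtain x0 K where x0: "x0 \<in> C" and K: "\<And>u l. l \<in> dual_cone C \<Longrightarrow> norm (cp l ((M ^^ n0) u)) \<le> K * l x0 * norm u"
    using assms unfolding inner_regular_def by blast
  have bb: "bounded_by x0 (\<bar>K\<bar> * norm u) ((M ^^ n0) u)" for u
    unfolding bounded_by_def
  proof
    fix l assume l: "l \<in> dual_cone C"
    have "K * (l x0 * norm u) \<le> \<bar>K\<bar> * (l x0 * norm u)"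
      using dual_cone_nonneg[OF l x0] by (intro mult_right_mono) auto
    then show "norm (cp l ((M ^^ n0) u)) \<le> \<bar>K\<bar> * norm u * l x0"
      using K[OF l, of u] by (simp add: algebra_simps)
  qed
  have "x0 \<noteq> 0"
  proof
    assume "x0 = 0"
    obtain x where x: "x \<in> C - {0}" using cone_nontrivial by blast
    then have "\<iota> x \<noteq> 0" using inj_iota iota_0 by (metis DiffD2 injD singletonI)
    then have "(M ^^ n0) (\<iota> x) \<noteq> 0" using M_power_invariant[of "\<iota> x" n0] iota_CC x by auto
    moreover have "cp l ((M ^^ n0) (\<iota> x)) = 0" if "l \<in> dual_cone C" for l
      using bb[of "\<iota> x"] that \<open>x0 = 0\<close> by (simp add: bounded_by_def)
    ultimately show False using cpair_separates by blast
  qed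
  moreover have "bounded_by (P x0) ((2 * sqrt \<beta> * \<bar>K\<bar>) * norm u) ((M ^^ Suc n0) u)" for u
    using bounded_by_M[OF bb[of u] x0] by (simp add: algebra_simps)
  ultimately show ?thesis using that[of x0 "2 * sqrt \<beta> * \<bar>K\<bar>"] x0 constants by simp
qed

text \<open>Every image is comparable to the fixed unit P(x0), its size being read off from the
  single value L(Mz): upper domination bounds it by P(w), the cross ratio replaces P(w) by P(x0),
  and the margin bounds L(P(w)).\<close>

lemma M_image_size:
  assumes L: "relevant L" and x0: "x0 \<in> C - {0}" and z: "z \<in> CC - {0}"
  shows "bounded_by (P x0) (sqrt \<beta> * D / (sqrt \<delta> * L (P x0)) * norm (cp L (M z))) (M z)"
  unfolding bounded_by_def
proof
  fix l assume l: "l \<in> dual_cone C"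
  obtain w where w: "w \<in> C - {0}" "inside (P w) \<delta> (M z)" "bounded_by (P w) (sqrt \<beta>) (M z)"
    using M_CC[OF z] by metis
  have Lx: "0 < L (P x0)" using L x0 by (simp add: relevant_def)
  have "norm (cp l (M z)) \<le> sqrt \<beta> * l (P w)" using w(3) l by (simp add: bounded_by_def)
  also have "\<dots> \<le> sqrt \<beta> * (D * (l (P x0) * L (P w)) / L (P x0))"
    using cross_ratio[of w x0 l L] w(1) x0 l relevant_dual[OF L] Lx constants
    by (intro mult_left_mono) (auto simp: pos_le_divide_eq)
  also have "\<dots> \<le> sqrt \<beta> * (D * (l (P x0) * (norm (cp L (M z)) / sqrt \<delta>)) / L (P x0))"
  proof -
    have "L (P w) \<le> norm (cp L (M z)) / sqrt \<delta>"
      using inside_norm[OF w(2) relevant_dual[OF L]] delta_pos by (simp add: pos_le_divide_eq mult.commute)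
    then show ?thesis
      using Lx D_pos constants dual_cone_nonneg[OF l P_in[of x0]] x0
      by (intro mult_left_mono divide_right_mono) auto
  qed
  finally show "norm (cp l (M z)) \<le> sqrt \<beta> * D / (sqrt \<delta> * L (P x0)) * norm (cp L (M z)) * l (P x0)"
    by (simp add: algebra_simps)
qed

text \<open>Keeps the normalising factors of an orbit from collapsing in one step. In the order of
  \<open>C\<close>, w' dominates sqrt(\<delta>) P(w), and P(w) dominates a multiple of P(x) for a
  fixed x, so the constant rests on L(P(P(x))) > 0.\<close>

lemma M_growth_lower:
  assumes L: "relevant L"
  obtains c where "0 < c" "\<And>v. v \<in> CC - {0} \<Longrightarrow> c * norm (cp L (M v)) \<le> norm (cp L (M (M v)))"
proof -
  obtain x where x: "x \<in> C - {0}" using cone_nontrivial by blast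
  have Lx: "0 < L (P x)" "0 < L (P (P x))" using L x P_nonzero[OF x] by (auto simp: relevant_def)
  have Ld: "L \<in> dual_cone C" by (rule relevant_dual[OF L])
  have mono: "L (P a) \<le> L (P b)" if "b - a \<in> C" for a b
    using dual_cone_nonneg[OF Ld P_in[OF that]] by (simp add: P_diff blinfun.diff_right)
  define c where "c = \<delta> * (L (P (P x)) / (D * L (P x))) / sqrt \<beta>"
  have "0 < c" using delta_pos D_pos Lx constants by (simp add: c_def)
  moreover have "c * norm (cp L (M v)) \<le> norm (cp L (M (M v)))" if v: "v \<in> CC - {0}" for v
  proof -
    obtain w where w: "w \<in> C - {0}" "inside (P w) \<delta> (M v)" "bounded_by (P w) (sqrt \<beta>) (M v)"
      using M_CC[OF v] by metis
    obtain w' where w': "w' \<in> C - {0}" "\<And>l. l \<in> dual_cone C \<Longrightarrow> norm (cp l (M v)) \<le> l w'"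
      "inside (P w') \<delta> (M (M v))"
      using M_CC[OF M_invariant[OF v]] by metis
    have "w' - sqrt \<delta> *\<^sub>R P w \<in> C"
    proof (rule bipolar)
      fix l assume l: "l \<in> dual_cone C"
      have "sqrt \<delta> * l (P w) \<le> l w'"
        using inside_norm[OF w(2) l] w'(2)[OF l] delta_pos by linarith
      then show "0 \<le> l (w' - sqrt \<delta> *\<^sub>R P w)" by (simp add: blinfun.bilinear_simps)
    qed
    then have "L (P (sqrt \<delta> *\<^sub>R P w)) \<le> L (P w')" by (rule mono)
    then have 1: "sqrt \<delta> * L (P (P w)) \<le> L (P w')" by (simp add: P_scaleR blinfun.scaleR_right)
    define s where "s = L (P w) / (D * L (P x))"
    have "P w - s *\<^sub>R P x \<in> C"
    proof (rule bipolar)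
      fix l assume l: "l \<in> dual_cone C"
      have "l (P x) * L (P w) \<le> D * (l (P w) * L (P x))"
        using cross_ratio[of x w l L] x w(1) l Ld by simp
      then have "s * l (P x) \<le> l (P w)"
        using D_pos Lx by (simp add: s_def pos_divide_le_eq algebra_simps)
      then show "0 \<le> l (P w - s *\<^sub>R P x)" by (simp add: blinfun.bilinear_simps)
    qed
    then have "L (P (s *\<^sub>R P x)) \<le> L (P (P w))" by (rule mono)
    then have 2: "s * L (P (P x)) \<le> L (P (P w))" by (simp add: P_scaleR blinfun.scaleR_right)
    have 3: "norm (cp L (M v)) / sqrt \<beta> \<le> L (P w)"
      using w(3) Ld constants by (simp add: bounded_by_def pos_divide_le_eq mult.commute)
    have "c * norm (cp L (M v)) = \<delta> * (L (P (P x)) / (D * L (P x))) * (norm (cp L (M v)) / sqrt \<beta>)"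
      by (simp add: c_def)
    also have "\<dots> \<le> \<delta> * (L (P (P x)) / (D * L (P x))) * L (P w)"
      using 3 delta_pos D_pos Lx by (intro mult_left_mono) auto
    also have "\<dots> = sqrt \<delta> * (sqrt \<delta> * (s * L (P (P x))))"
      using delta_pos by (simp add: s_def flip: mult.assoc)
    also have "\<dots> \<le> sqrt \<delta> * (sqrt \<delta> * L (P (P w)))"
      using 2 delta_pos by (intro mult_left_mono) auto
    also have "\<dots> \<le> sqrt \<delta> * L (P w')"
      using 1 delta_pos by (intro mult_left_mono) auto
    also have "\<dots> \<le> norm (cp L (M (M v)))"
      using inside_norm[OF w'(3) Ld] delta_pos by simp
    finally show ?thesis .
  qed
  ultimately show ?thesis using that by blast
qed

text \<open>In units of P(x0), M^N z has a margin while M^N y is bounded by c|y|, so M^N z may be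
  perturbed by multiples of M^N y in a disk of radius proportional to 1/|y|.
  \<open>functional_quotients_close\<close> applies there, and normality of the cone turns its
  bounds into a norm bound.\<close>

lemma rank_one_estimate:
  assumes disk: "\<And>u v. u \<in> CC - {0} \<Longrightarrow> v \<in> CC - {0} \<Longrightarrow> \<exists>a b. disk_through k (M u) (M v) a b"
    and k: "0 < k" "k < 1"
    and ap: "bounded_sectional_aperture C"
    and unit: "x0 \<in> C - {0}" "0 \<le> c" "\<And>u. bounded_by (P x0) (c * norm u) ((M ^^ N) u)" and N: "0 < N"
    and L: "relevant L" and z: "z \<in> CC - {0}"
  obtains K where "\<And>n y. norm ((M ^^ (Suc n + N)) y -
      (cp L ((M ^^ (Suc n + N)) y) / cp L ((M ^^ (Suc n + N)) z)) *\<^sub>C (M ^^ (Suc n + N)) z)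
    \<le> K * schwarz_factor k ^ n * norm y * norm (cp L ((M ^^ (Suc n + N)) z))"
proof -
  define \<eta> where "\<eta> = schwarz_factor k"
  have \<eta>: "0 \<le> \<eta> ^ n" for n using schwarz_factor_bounds[OF k] by (simp add: \<eta>_def)
  obtain Kn where Kn: "0 < Kn" "\<And>e b u. e \<in> C \<Longrightarrow> 0 \<le> b \<Longrightarrow> bounded_by e b u \<Longrightarrow> norm u \<le> Kn * b * norm e"
    using norm_le_bounded_by[OF ap] by blast
  have Ld: "L \<in> dual_cone C" by (rule relevant_dual[OF L])
  have Lx: "0 < L (P x0)" using L unit(1) by (simp add: relevant_def)
  have PC: "P x0 \<in> C" using P_in unit(1) by simp
  obtain n0 where n0: "N = Suc n0" using N gr0_implies_Suc by blast
  define x where "x = (M ^^ N) z"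
  have xM: "x = M ((M ^^ n0) z)" by (simp add: x_def n0)
  obtain w where w: "w \<in> C - {0}" "inside (P w) \<delta> x"
    unfolding xM using M_CC[OF M_power_invariant[OF z]] by metis
  define s where "s = L (P w) / (D * L (P x0))"
  have s: "0 < s" using L w(1) Lx D_pos by (simp add: s_def relevant_def)
  have insx: "inside (P x0) (\<delta> * s\<^sup>2) x"
  proof (rule inside_weaken[OF w(2)])
    fix l assume l: "l \<in> dual_cone C"
    have "l (P x0) * L (P w) \<le> D * (l (P w) * L (P x0))"
      using cross_ratio[of x0 w l L] unit(1) w(1) l Ld by simp
    then show "s * l (P x0) \<le> l (P w)"
      using D_pos Lx by (simp add: s_def pos_divide_le_eq algebra_simps)
  qed (use delta_pos s PC in auto)
  define d where "d = \<delta> * s\<^sup>2"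
  have d: "0 < d" using delta_pos s by (simp add: d_def)
  define b where "b = c * norm z"
  have b: "0 \<le> b" "bounded_by (P x0) b x" using unit(2,3) by (auto simp: b_def x_def)
  obtain \<epsilon> where \<epsilon>: "0 < \<epsilon>" and "0 \<le> d / 2 - 2 * b * \<epsilon> - \<epsilon>\<^sup>2"
    using small_perturbation[of b "d / 2"] b(1) d by auto
  then have d': "d / 2 \<le> d - 2 * b * \<epsilon> - \<epsilon>\<^sup>2" by simp
  define r0 where "r0 = \<epsilon> / (c + 1)"
  have r0: "0 < r0" using \<epsilon> unit(2) by (simp add: r0_def)
  define \<kappa> where "\<kappa> = sqrt \<beta> * D / (sqrt \<delta> * L (P x0))"
  have \<kappa>: "0 \<le> \<kappa>" using constants D_pos delta_pos Lx by (simp add: \<kappa>_def)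
  define K where "K = Kn * (4 / r0 * \<kappa>) * norm (P x0)"
  have "norm ((M ^^ (Suc n + N)) y -
      (cp L ((M ^^ (Suc n + N)) y) / cp L ((M ^^ (Suc n + N)) z)) *\<^sub>C (M ^^ (Suc n + N)) z)
    \<le> K * \<eta> ^ n * norm y * norm (cp L ((M ^^ (Suc n + N)) z))" for n y
  proof (cases "y = 0")
    case True
    then show ?thesis by (simp add: bounded_clinear_0[OF bounded_clinear_funpow[OF M_clinear]] del: funpow.simps)
  next
    case False
    define Y Z where "Y = (M ^^ (Suc n + N)) y" and "Z = (M ^^ (Suc n + N)) z"
    have YZ: "Y = (M ^^ Suc n) ((M ^^ N) y)" "Z = (M ^^ Suc n) x"
      unfolding Y_def Z_def x_def by (simp_all only: funpow_add o_apply)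
    \<comment> \<open>\<open>Y\<close> is factored both ways: with M^N applied first for the
      perturbation, and with M^N applied last for the order-unit bound.\<close>
    have Y': "Y = (M ^^ N) ((M ^^ Suc n) y)" unfolding Y_def by (simp only: add.commute[of "Suc n"] funpow_add o_apply)
    have ZM: "Z = M ((M ^^ (n + N)) z)" by (simp add: Z_def)
    have in_cone: "x + t *\<^sub>C (M ^^ N) y \<in> CC - {0}" if t: "norm t \<le> r0 / norm y" for t
    proof -
      have "norm t * (c * norm y) \<le> r0 / norm y * (c * norm y)"
        using t unit(2) by (intro mult_right_mono) auto
      also have "\<dots> = r0 * c" using False by simp
      also have "\<dots> \<le> \<epsilon>" using \<epsilon> unit(2) by (simp add: r0_def pos_divide_le_eq field_simps)
      finally have "bounded_by (P x0) \<epsilon> (t *\<^sub>C (M ^^ N) y)"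
        using bounded_by_mono[OF bounded_by_scaleC[OF unit(3)[of y], of t] _ PC] by blast
      then have ins: "inside (P x0) (d / 2) (x + t *\<^sub>C (M ^^ N) y)"
        using inside_perturb[OF _ b(2) _ PC d'] insx by (simp add: d_def)
      have "cp L (x + t *\<^sub>C (M ^^ N) y) \<noteq> 0"
        by (rule inside_nonzero[OF ins Ld _ Lx]) (use d in simp)
      then have "x + t *\<^sub>C (M ^^ N) y \<noteq> 0" using cpair_0 by metis
      then show ?thesis using inside_CC[OF ins _ PC] d by auto
    qed
    have quot: "norm (cp l Y / cp l Z - cp L Y / cp L Z) \<le> 4 * \<eta> ^ n / (r0 / norm y)" if "relevant l" for l
      unfolding YZ \<eta>_def
      by (rule functional_quotients_close[OF disk k that L _ in_cone]) (use r0 False in auto)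
    define V where "V = Y - (cp L Y / cp L Z) *\<^sub>C Z"
    have "bounded_by (P x0) (4 * \<eta> ^ n / (r0 / norm y) * (\<kappa> * norm (cp L Z))) V"
      unfolding bounded_by_def
    proof
      fix l assume l: "l \<in> dual_cone C"
      show "norm (cp l V) \<le> 4 * \<eta> ^ n / (r0 / norm y) * (\<kappa> * norm (cp L Z)) * l (P x0)"
      \<comment> \<open>A functional that is not relevant vanishes at P(x0), hence at
        \<open>Y\<close> by the order-unit bound, and also at \<open>Z\<close>; for the others
        quotients can be formed.\<close>
      proof (cases "relevant l")
        case True
        have Zl: "cp l Z \<noteq> 0" using relevant_power_nonzero[OF True z, of "n + N"] by (simp add: Z_def)
        have "cp l V = cp l Z * (cp l Y / cp l Z - cp L Y / cp L Z)"
          using Zl by (simp add: V_def right_diff_distrib)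
        then have "norm (cp l V) = norm (cp l Z) * norm (cp l Y / cp l Z - cp L Y / cp L Z)"
          by (simp only: norm_mult)
        also have "\<dots> \<le> (\<kappa> * norm (cp L Z) * l (P x0)) * (4 * \<eta> ^ n / (r0 / norm y))"
        proof (rule mult_mono[OF _ quot[OF True]])
          show "norm (cp l Z) \<le> \<kappa> * norm (cp L Z) * l (P x0)"
            using M_image_size[OF L unit(1) M_power_invariant[OF z]] l
            unfolding ZM bounded_by_def \<kappa>_def by blast
        qed (use \<kappa> dual_cone_nonneg[OF l PC] in auto)
        finally show ?thesis by (simp add: mult_ac)
      next
        case False
        then have "\<not> 0 < l (P x0)"
          using dual_pos_everywhere[OF l, of x0] unit(1) l by (auto simp: relevant_def)
        then have l0: "l (P x0) = 0" using dual_cone_nonneg[OF l PC] by simp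
        have "cp l Y = 0" using unit(3)[of "(M ^^ Suc n) y"] l l0 unfolding Y' bounded_by_def by fastforce
        moreover have "cp l Z = 0"
          unfolding ZM by (rule irrelevant_M_zero[OF l False]) (use M_power_invariant[OF z] in auto)
        ultimately show ?thesis by (simp add: V_def l0)
      qed
    qed
    then have "norm V \<le> Kn * (4 * \<eta> ^ n / (r0 / norm y) * (\<kappa> * norm (cp L Z))) * norm (P x0)"
      using \<eta>[of n] r0 \<kappa> by (intro Kn(2) PC) auto
    also have "\<dots> = K * \<eta> ^ n * norm y * norm (cp L Z)" by (simp add: K_def)
    finally show ?thesis by (simp only: V_def Y_def Z_def)
  qed
  then show ?thesis using that unfolding \<eta>_def by blast
qed

theorem spectral_gap_M:
  assumes reg: "inner_regular \<iota> J C (M ^^ n0)" and ap: "bounded_sectional_aperture C"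
  shows "spectral_gap M"
proof -
  obtain k where k: "0 < k" "k < 1"
    and disk: "\<And>u v. u \<in> CC - {0} \<Longrightarrow> v \<in> CC - {0} \<Longrightarrow> \<exists>a b. disk_through k (M u) (M v) a b"
    using ex_disk_through by metis
  define \<eta> where "\<eta> = schwarz_factor k"
  have \<eta>: "0 < \<eta>" "\<eta> < 1" using schwarz_factor_bounds[OF k] by (auto simp: \<eta>_def)
  define N where "N = Suc n0"
  obtain x0 c where unit: "x0 \<in> C - {0}" "0 \<le> c" "\<And>u. bounded_by (P x0) (c * norm u) ((M ^^ N) u)"
    using order_unit[OF reg] unfolding N_def by blast
  obtain L where L: "relevant L" using ex_relevant by blast
  obtain B where B: "0 < B" "\<And>u. norm (cp L u) \<le> B * norm u" using norm_cpair_le by blast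
  obtain q where q: "0 < q" "\<And>v. v \<in> CC - {0} \<Longrightarrow> q * norm (cp L (M v)) \<le> norm (cp L (M (M v)))"
    using M_growth_lower[OF L] by blast
  have estimate: "\<exists>K. \<forall>n y. norm ((M ^^ (Suc n + N)) y -
      (cp L ((M ^^ (Suc n + N)) y) / cp L ((M ^^ (Suc n + N)) z)) *\<^sub>C (M ^^ (Suc n + N)) z)
    \<le> K * \<eta> ^ n * norm y * norm (cp L ((M ^^ (Suc n + N)) z))" if z: "z \<in> CC - {0}" for z
    using rank_one_estimate[OF disk k ap unit _ L z] unfolding \<eta>_def N_def by (metis zero_less_Suc)
  define z where "z = \<iota> x0"
  have z: "z \<in> CC - {0}"
  proof -
    have "\<iota> x0 \<noteq> 0" using inj_iota iota_0 unit(1) by (metis DiffD2 injD singletonI)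
    then show ?thesis using iota_CC unit(1) by (simp add: z_def)
  qed
  define Z where "Z = (\<lambda>n. (M ^^ (Suc n + N)) z)"
  define l where "l = (\<lambda>n. cp L (Z n))"
  have l0: "l n \<noteq> 0" for n using relevant_power_nonzero[OF L z, of "n + N"] by (simp add: l_def Z_def)
  have ZS: "M (Z n) = Z (Suc n)" for n by (simp add: Z_def)
  define g where "g = (\<lambda>n. (1 / l n) *\<^sub>C Z n)"
  have Lg: "cp L (g n) = 1" for n using l0[of n] by (simp add: g_def l_def)
  have ql: "q * norm (l n) \<le> norm (l (Suc n))" for n
    using q(2)[OF M_power_invariant[OF z], of "n + N"] by (simp add: l_def Z_def)
  obtain K where K: "\<And>n y. norm ((M ^^ (Suc n + N)) y - (cp L ((M ^^ (Suc n + N)) y) / l n) *\<^sub>C Z n)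
      \<le> K * \<eta> ^ n * norm y * norm (l n)"
    using estimate[OF z] unfolding l_def Z_def by blast
  \<comment> \<open>The estimate at y = Mz compares consecutive normalised iterates;
    \<open>ql\<close> exchanges the factor l(n) for l(n + 1), which the normalisation divides
    out.\<close>
  have step: "norm (g (Suc n) - g n) \<le> (\<bar>K\<bar> * norm (M z) / q) * \<eta> ^ n" for n
  proof -
    have "(M ^^ (Suc n + N)) (M z) = Z (Suc n)" by (simp add: Z_def funpow_swap1)
    then have "norm (Z (Suc n) - (l (Suc n) / l n) *\<^sub>C Z n) \<le> K * \<eta> ^ n * norm (M z) * norm (l n)"
      using K[of n "M z"] by (simp add: l_def)
    also have "\<dots> \<le> \<bar>K\<bar> * \<eta> ^ n * norm (M z) * (norm (l (Suc n)) / q)"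
      using ql[of n] q(1) \<eta> by (intro mult_mono) (auto simp: pos_le_divide_eq mult.commute)
    finally have "norm (Z (Suc n) - (l (Suc n) / l n) *\<^sub>C Z n) / norm (l (Suc n)) \<le> (\<bar>K\<bar> * norm (M z) / q) * \<eta> ^ n"
      using l0[of "Suc n"] by (simp add: pos_divide_le_eq mult_ac)
    moreover have "g (Suc n) - g n = (1 / l (Suc n)) *\<^sub>C (Z (Suc n) - (l (Suc n) / l n) *\<^sub>C Z n)"
      using l0 by (simp add: g_def scaleC_diff_right scaleC_scaleC)
    ultimately show ?thesis by (simp add: norm_scaleC norm_divide)
  qed
  obtain h where h: "g \<longlonglongrightarrow> h"
    using geometric_cauchy[of \<eta> 0 g "\<bar>K\<bar> * norm (M z) / q"] step \<eta> by (metis less_imp_le)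
  have Lh: "cp L h = 1"
    using LIMSEQ_unique[OF tendsto_cpair[OF h, of L]] by (simp add: Lg)
  have hC: "h \<in> CC - {0}"
  proof -
    have "Z n \<in> CC" for n using M_power_invariant[OF z, of "Suc n + N"] unfolding Z_def by blast
    then have "h \<in> CC" by (intro CC_sequentially_closed[OF h]) (simp add: g_def CC_scaleC)
    then show ?thesis using Lh by auto
  qed
  define \<mu> where "\<mu> = cp L (M h)"
  have Mg: "(\<lambda>n. M (g n)) \<longlonglongrightarrow> M h"
    by (rule bounded_linear.tendsto[OF bounded_clinear_bounded[OF M_clinear] h])
  have "M (g n) = cp L (M (g n)) *\<^sub>C g (Suc n)" for n
  proof -
    have M: "M (g n) = (1 / l n) *\<^sub>C Z (Suc n)" by (simp add: g_def M_scaleC ZS)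
    then have "cp L (M (g n)) = l (Suc n) / l n" by (simp add: l_def)
    moreover have "(l (Suc n) / l n) *\<^sub>C g (Suc n) = (1 / l n) *\<^sub>C Z (Suc n)"
      using l0[of "Suc n"] by (simp add: g_def scaleC_scaleC)
    ultimately show ?thesis using M by metis
  qed
  moreover have "(\<lambda>n. cp L (M (g n)) *\<^sub>C g (Suc n)) \<longlonglongrightarrow> \<mu> *\<^sub>C h"
    unfolding \<mu>_def by (intro tendsto_scaleC tendsto_cpair Mg LIMSEQ_Suc[OF h])
  ultimately have Mh: "M h = \<mu> *\<^sub>C h" using LIMSEQ_unique[OF Mg] by simp
  have \<mu>0: "\<mu> \<noteq> 0" using M_invariant[OF hC] Mh by auto
  have Mjh: "(M ^^ j) h = \<mu> ^ j *\<^sub>C h" for j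
    by (induction j) (simp_all add: M_scaleC Mh scaleC_scaleC mult.commute)
  \<comment> \<open>Second use of the estimate, now along the orbit of the eigenvector, where the
    normalising value is a power of \<mu>.\<close>
  obtain K' where K': "\<And>n y. norm ((M ^^ (Suc n + N)) y -
      (cp L ((M ^^ (Suc n + N)) y) / cp L ((M ^^ (Suc n + N)) h)) *\<^sub>C (M ^^ (Suc n + N)) h)
    \<le> K' * \<eta> ^ n * norm y * norm (cp L ((M ^^ (Suc n + N)) h))"
    using estimate[OF hC] by blast
  show ?thesis
  proof (rule spectral_gap_of_rank_one_approximation[OF M_clinear _ _ B(2) Mh \<mu>0 Lh \<eta>])
    fix j y assume "Suc N \<le> j"
    then obtain n where j: "j = Suc n + N" using le_Suc_ex by (metis add.commute add_Suc_shift)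
    have "norm ((M ^^ j) y - cp L ((M ^^ j) y) *\<^sub>C h) \<le> K' * \<eta> ^ n * norm y * norm \<mu> ^ j"
      using K'[of n y, folded j] \<mu>0 by (simp add: Mjh Lh scaleC_scaleC norm_power)
    \<comment> \<open>The exponent n lags behind j = n + 1 + N; the missing powers of \<eta> go into
      the constant.\<close>
    also have "\<dots> = (K' / \<eta> ^ Suc N) * (\<eta> * norm \<mu>) ^ j * norm y"
    proof -
      have "\<eta> ^ j = \<eta> ^ n * \<eta> ^ Suc N" by (simp add: j power_add)
      then show ?thesis using \<eta>(1) by (simp add: power_mult_distrib)
    qed
    finally show "norm ((M ^^ j) y - cp L ((M ^^ j) y) *\<^sub>C h) \<le> (K' / \<eta> ^ Suc N) * (\<eta> * norm \<mu>) ^ j * norm y" .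
  qed simp_all
qed

end

theorem theorem6p3:
  fixes \<iota> :: "'r::banach \<Rightarrow> 'c::complex_banach" and J :: "'c \<Rightarrow> 'c"
    and C :: "'r set" and CC :: "'c set" and P :: "'r \<Rightarrow> 'r" and M :: "'c \<Rightarrow> 'c"
    and \<alpha> \<beta> \<gamma> :: real and \<Delta> :: ereal
  assumes "complexification \<iota> J"
    and "real_cone C"
    and "CC = canonical_complexification \<iota> J C"
    and "bounded_linear P"
    and "P ` (C - {0}) \<subseteq> C - {0}"
    and "\<Delta> = hilbert_diam C (P ` (C - {0}))"
    and "\<Delta> < \<infinity>"
    and "bounded_clinear M"
    and "dominated \<iota> J C M P \<gamma> \<alpha> \<beta>"
    and "\<gamma> * cosh (real_of_ereal \<Delta> / 2) < \<alpha>"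
  shows "M ` (CC - {0}) \<subseteq> CC - {0} \<and> gauge_diam CC (M ` (CC - {0})) < \<infinity> \<and>
    ((\<exists>n0. inner_regular \<iota> J C (M ^^ n0)) \<and> bounded_sectional_aperture C \<longrightarrow> spectral_gap M)"
proof -
  \<comment> \<open>The diameter is known only to be below \<infinity>; \<open>real_of_ereal\<close>
    sends -\<infinity> to 0, so an inequality holds in every case.\<close>
  have \<Delta>: "\<Delta> \<le> ereal (real_of_ereal \<Delta>)" using assms(7) by (cases \<Delta>) auto
  have dist: "hilbert_dist C (P x) (P y) \<le> ereal (real_of_ereal \<Delta>)"
    if "x \<in> C - {0}" "y \<in> C - {0}" for x y
  proof -
    have "hilbert_dist C (P x) (P y) \<le> \<Delta>"
      unfolding assms(6) hilbert_diam_def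
      by (rule SUP_upper2[OF imageI[OF that(1)]]) (rule SUP_upper[OF imageI[OF that(2)]])
    then show ?thesis using \<Delta> by (rule order_trans)
  qed
  interpret complexified_cone \<iota> J C
    by standard (fact assms)+
  have "dominated_operator_axioms \<iota> J C P M \<alpha> \<beta> \<gamma> (real_of_ereal \<Delta>)"
    by (rule dominated_operator_axioms.intro[OF bounded_linear.linear[OF assms(4)] assms(5) dist assms(8-10)])
  then interpret dominated_operator \<iota> J C P M \<alpha> \<beta> \<gamma> "real_of_ereal \<Delta>"
    by (rule dominated_operator.intro[OF complexified_cone_axioms])
  have "M ` (CC - {0}) \<subseteq> CC - {0}"
    unfolding assms(3) using M_invariant by (rule image_subsetI)
  moreover have "gauge_diam CC (M ` (CC - {0})) < \<infinity>"
    unfolding assms(3) by (rule gauge_diam_finite)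
  ultimately show ?thesis
    using spectral_gap_M by blast
qed

end
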